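(* Let $\hat d=\hat d_0+\hat d_1+\hat d_2$ act on $\ker L_0\subset\mathcal F_{p,p_\varphi}$. Its cohomology (the relative cohomology of $\hat d$) is as follows, and vanishes in all other cases: (i) (tachyons) if $p^+p^-=0$ and $P^+(n)\ne0$ for all $n\ne0$ or $P^-(n)\neq 0$ for all $n\neq 0$: one-dimensional, at ghost number $0$; (ii) if $p^+=r$, $p^-=-s$ with $r,s$ negative integers: one-dimensional at ghost number $-1$ and one-dimensional at ghost number $0$; (iii) if $p^+=r$, $p^-=-s$ with $r,s$ positive integers: one-dimensional at ghost number $0$ and one-dimensional at ghost number $+1$.
   Context: Oscillators ($n\ne0$): $\alpha^\pm_n=\frac1{\sqrt2}(x_n\pm i\varphi_n)$ with $[\alpha^\pm_m,\alpha^\mp_n]=m\delta_{m+n,0}$, $[\alpha^\pm_m,\alpha^\pm_n]=0$; fermionic $\tilde b_n,c_n$ with $\{\tilde b_m,c_n\}=\delta_{m+n,0}$; fermionic $\zeta_n,\tilde\eta_n$ with $\{\zeta_m,\tilde\eta_n\}=\delta_{m+n,0}$; bosonic $\beta_n,\gamma_n$ with $[\gamma_m,\beta_n]=\delta_{m+n,0}$; all other (anti)commutators zero. $\mathcal F_{p,p_\varphi}$ is the Fock space generated by these modes on the vacuum $|p,p_\varphi\rangle$, which is annihilated by all modes with positive index. $p^\pm=\frac1{\sqrt2}\big(p\pm i(p_\varphi+i\sqrt2)\big)$ and $P^\pm(n)=p^\pm\mp n$. $\hat L_0$ is the level operator (sum of $-n$ over creation modes with index $n<0$), with $\hat L_0|p,p_\varphi\rangle=0$;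 $L_0=p^+p^-+\hat L_0$. Ghost number: $c_n,\tilde\eta_n$ carry $+1$, $\tilde b_n,\zeta_n$ carry $-1$, all others $0$, vacuum $0$. The operators (all level-preserving): $\hat d_0=\sum_{n\ne0}\big(P^+(n)\,c_{-n}\alpha^-_n+\tilde\eta_n\beta_{-n}\big)$, $\hat d_1=\sum_{n,m\ne0,\ n+m\ne0} c_{-n}\big(\alpha^+_{-m}\alpha^-_{n+m}+\tfrac12(m-n)c_{-m}\tilde b_{n+m}+m\,\zeta_{-m}\tilde\eta_{n+m}+m\,\beta_{-m}\gamma_{n+m}\big)$, $\hat d_2=\sum_{n\ne0}P^-(n)\,c_{-n}\alpha^+_n$. $\hat d$ is the relative BRST operator of the light-cone-gauge $c=1$ string (Wakimoto realization) with all zero modes of the ghost and $\beta\gamma$ systems removed, and is a differential on $\ker L_0$. *)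

theory Defs
  imports Complex_Main "HOL-Library.Function_Algebras"
begin

section \<open>Fock space of the light-cone c=1 string (Wakimoto realization), no zero modes\<close>

text \<open>Creation modes (index $-n$, $n \<ge> 1$) are encoded as pairs (kind, n).
 Bosonic kinds: 0 = alpha+, 1 = alpha-, 2 = beta, 3 = gamma.
 Fermionic kinds: 0 = b-tilde, 1 = c, 2 = zeta, 3 = eta-tilde.\<close>

type_synonym mode = "nat \<times> nat"

record mono =
  bos :: "mode \<Rightarrow> nat"      \<comment> \<open>occupation numbers of bosonic creation modes\<close>
  fer :: "mode set"            \<comment> \<open>occupied fermionic creation modes\<close>

text \<open>A basis monomial: finitely many creation modes, each of kind < 4 and index >= 1.
 The fermionic modes are multiplied in increasing lexicographic order of (kind, n).\<close>
definition valid_mono :: "mono \<Rightarrow> bool" where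
  "valid_mono \<mu> \<longleftrightarrow> finite {x. bos \<mu> x \<noteq> 0} \<and> finite (fer \<mu>) \<and>
     (\<forall>x. bos \<mu> x \<noteq> 0 \<longrightarrow> fst x < 4 \<and> snd x \<ge> 1) \<and>
     (\<forall>x\<in>fer \<mu>. fst x < 4 \<and> snd x \<ge> 1)"

type_synonym state = "mono \<Rightarrow> complex"

definition Fock :: "state set" where
  "Fock = {v. finite {\<mu>. v \<mu> \<noteq> 0} \<and> (\<forall>\<mu>. v \<mu> \<noteq> 0 \<longrightarrow> valid_mono \<mu>)}"

definition smul :: "complex \<Rightarrow> state \<Rightarrow> state" where
  "smul c v = (\<lambda>\<mu>. c * v \<mu>)"

definition level :: "mono \<Rightarrow> nat" where
  "level \<mu> = (\<Sum>x\<in>{x. bos \<mu> x \<noteq> 0}. bos \<mu> x * snd x) + (\<Sum>x\<in>fer \<mu>. snd x)"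

definition ghost :: "mono \<Rightarrow> int" where
  "ghost \<mu> = int (card {x\<in>fer \<mu>. fst x = 1}) + int (card {x\<in>fer \<mu>. fst x = 3})
           - int (card {x\<in>fer \<mu>. fst x = 0}) - int (card {x\<in>fer \<mu>. fst x = 2})"

definition bos_upd :: "mode \<Rightarrow> (nat \<Rightarrow> nat) \<Rightarrow> mono \<Rightarrow> mono" where
  "bos_upd x f \<mu> = \<mu>\<lparr>bos := (bos \<mu>)(x := f (bos \<mu> x))\<rparr>"

text \<open>Bosonic creation (multiplication by the mode) and the derivative in a mode.\<close>
definition crB :: "mode \<Rightarrow> state \<Rightarrow> state" where
  "crB x v = (\<lambda>\<mu>. if bos \<mu> x \<ge> 1 then v (bos_upd x (\<lambda>k. k - 1) \<mu>) else 0)"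

definition anB :: "mode \<Rightarrow> state \<Rightarrow> state" where
  "anB x v = (\<lambda>\<mu>. of_nat (bos \<mu> x + 1) * v (bos_upd x Suc \<mu>))"

definition lexless :: "mode \<Rightarrow> mode \<Rightarrow> bool" where
  "lexless a b \<longleftrightarrow> fst a < fst b \<or> (fst a = fst b \<and> snd a < snd b)"

definition fsign :: "mode \<Rightarrow> mode set \<Rightarrow> complex" where
  "fsign f S = (-1) ^ card {g\<in>S. lexless g f}"

text \<open>Fermionic creation (left multiplication) and left derivative in a mode.\<close>
definition crF :: "mode \<Rightarrow> state \<Rightarrow> state" where
  "crF f v = (\<lambda>\<mu>. if f \<in> fer \<mu> then fsign f (fer \<mu> - {f}) * v (\<mu>\<lparr>fer := fer \<mu> - {f}\<rparr>) else 0)"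

definition anF :: "mode \<Rightarrow> state \<Rightarrow> state" where
  "anF f v = (\<lambda>\<mu>. if f \<notin> fer \<mu> then fsign f (fer \<mu>) * v (\<mu>\<lparr>fer := insert f (fer \<mu>)\<rparr>) else 0)"

subsection \<open>Oscillators with index k (k \<noteq> 0)\<close>

definition alphaP :: "int \<Rightarrow> state \<Rightarrow> state" where
  "alphaP k = (if k < 0 then crB (0, nat (-k)) else (\<lambda>v. smul (of_int k) (anB (1, nat k) v)))"
definition alphaM :: "int \<Rightarrow> state \<Rightarrow> state" where
  "alphaM k = (if k < 0 then crB (1, nat (-k)) else (\<lambda>v. smul (of_int k) (anB (0, nat k) v)))"
definition betaO :: "int \<Rightarrow> state \<Rightarrow> state" where
  "betaO k = (if k < 0 then crB (2, nat (-k)) else (\<lambda>v. smul (-1) (anB (3, nat k) v)))"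
definition gammaO :: "int \<Rightarrow> state \<Rightarrow> state" where
  "gammaO k = (if k < 0 then crB (3, nat (-k)) else anB (2, nat k))"
definition btO :: "int \<Rightarrow> state \<Rightarrow> state" where
  "btO k = (if k < 0 then crF (0, nat (-k)) else anF (1, nat k))"
definition cO :: "int \<Rightarrow> state \<Rightarrow> state" where
  "cO k = (if k < 0 then crF (1, nat (-k)) else anF (0, nat k))"
definition zetaO :: "int \<Rightarrow> state \<Rightarrow> state" where
  "zetaO k = (if k < 0 then crF (2, nat (-k)) else anF (3, nat k))"
definition etaO :: "int \<Rightarrow> state \<Rightarrow> state" where
  "etaO k = (if k < 0 then crF (3, nat (-k)) else anF (2, nat k))"

definition pP :: "complex \<Rightarrow> complex \<Rightarrow> complex" where
  "pP p q = (p + \<i> * (q + \<i> * sqrt 2)) / sqrt 2"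
definition pM :: "complex \<Rightarrow> complex \<Rightarrow> complex" where
  "pM p q = (p - \<i> * (q + \<i> * sqrt 2)) / sqrt 2"
definition PP :: "complex \<Rightarrow> complex \<Rightarrow> int \<Rightarrow> complex" where
  "PP p q n = pP p q - of_int n"
definition PM :: "complex \<Rightarrow> complex \<Rightarrow> int \<Rightarrow> complex" where
  "PM p q n = pM p q + of_int n"

definition L0 :: "complex \<Rightarrow> complex \<Rightarrow> state \<Rightarrow> state" where
  "L0 p q v = (\<lambda>\<mu>. (pP p q * pM p q + of_nat (level \<mu>)) * v \<mu>)"

definition fsum :: "('i \<Rightarrow> complex) \<Rightarrow> complex" where
  "fsum f = sum f {i. f i \<noteq> 0}"

definition d0 :: "complex \<Rightarrow> complex \<Rightarrow> state \<Rightarrow> state" where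
  "d0 p q v = (\<lambda>\<mu>. fsum (\<lambda>n::int. if n = 0 then 0 else
      PP p q n * cO (-n) (alphaM n v) \<mu> + etaO n (betaO (-n) v) \<mu>))"

definition d1 :: "state \<Rightarrow> state" where
  "d1 v = (\<lambda>\<mu>. fsum (\<lambda>(n::int, m::int). if n = 0 \<or> m = 0 \<or> n + m = 0 then 0 else
      cO (-n) (alphaP (-m) (alphaM (n + m) v)) \<mu>
      + of_int (m - n) / 2 * cO (-n) (cO (-m) (btO (n + m) v)) \<mu>
      + of_int m * cO (-n) (zetaO (-m) (etaO (n + m) v)) \<mu>
      + of_int m * cO (-n) (betaO (-m) (gammaO (n + m) v)) \<mu>))"

definition d2 :: "complex \<Rightarrow> complex \<Rightarrow> state \<Rightarrow> state" where
  "d2 p q v = (\<lambda>\<mu>. fsum (\<lambda>n::int. if n = 0 then 0 else PM p q n * cO (-n) (alphaP n v) \<mu>))"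

definition dhat :: "complex \<Rightarrow> complex \<Rightarrow> state \<Rightarrow> state" where
  "dhat p q v = (\<lambda>\<mu>. d0 p q v \<mu> + d1 v \<mu> + d2 p q v \<mu>)"

definition kerL0 :: "complex \<Rightarrow> complex \<Rightarrow> state set" where
  "kerL0 p q = {v \<in> Fock. L0 p q v = (\<lambda>_. 0)}"

definition ghost_part :: "complex \<Rightarrow> complex \<Rightarrow> int \<Rightarrow> state set" where
  "ghost_part p q g = {v \<in> kerL0 p q. \<forall>\<mu>. v \<mu> \<noteq> 0 \<longrightarrow> ghost \<mu> = g}"

definition cdim :: "state set \<Rightarrow> nat" where
  "cdim = vector_space.dim smul"

definition coh_dim :: "complex \<Rightarrow> complex \<Rightarrow> int \<Rightarrow> nat" where
  "coh_dim p q g = cdim {v \<in> ghost_part p q g. dhat p q v = (\<lambda>_. 0)}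
                 - cdim (dhat p q ` ghost_part p q (g - 1))"

end

theory Submission
  imports Defs "HOL-Library.Groups_Big_Fun"
begin

text \<open>The operator d squares to M L_0, where M is the sum of all n c_(-n) c_n: the defect
 d^2 - M L_0 commutes with every mode except the b's, hence is determined by its values on
 monomials in the b's alone, where ghost number and level leave a single coefficient to compute;
 it vanishes because the central charge is 26 - 26 = 0. So d is a differential on ker L_0.

 Grade monomials by (number of alpha+) - (number of alpha-) + (number of c) - (number of b).
 Then d_0, d_1, d_2 raise the degree by 0, 1, 2. The leading part d_0 is a Koszul differential that
 pairs alpha-_(-n) with b_(-n), alpha+_(-n) with c_(-n), gamma with eta and zeta with beta, with
 coefficient P+(-n), n P+(n), -1 and 1; it has a contracting homotopy on all pairs with
 nonzero coefficient. If p+ = r is a nonzero integer, one pair survives, and at level N = r s it contributes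
 exactly two monomials, (alpha+_(-r))^s and (alpha+_(-r))^(s-1) c_(-r) for r > 0, and their analogues
 in alpha- and b for r < 0. Both have the same degree, so the remaining differentials of the
 filtration vanish and the two classes lift to the cohomology of d.\<close>

text \<open>With the ghost zero modes kept, the BRST operator has, up to signs, the form c_0 L_0 +
  b_0 M + d and squares to zero; dropping b_0 and c_0 is what leaves d^2 = M L_0. In the computation
  M appears because the commutator of d with c_n follows one formula for all nonzero n, and this
  formula fails at n = 0, where the mode is absent. The field b is exceptional because its
  anticommutator with d is the total Virasoro generator L_k, bilinear in the fields; only there can
  a central term arise. The obstacle is that d is an infinite sum, while \<open>fsum\<close> and
  \<open>Sum_any\<close> are 0 on families with infinitely many nonzero terms. On a fixed level only
  finitely many summands act nontrivially, so the calculus lives on the spaces \<open>VL L\<close>.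
  The degree is bounded by the level. Hence the filtration is finite, and the homotopy for d_0 is
  corrected to one for d in finitely many steps. If p+ p- = 0, the kernel of L_0 is the vacuum line,
  and if p+ p- is not an integer at most 0, it is zero; both cases are settled directly.\<close>

interpretation vs: vector_space smul
  by standard (auto simp: smul_def fun_eq_iff algebra_simps)

lemmas smul_add = vs.scale_right_distrib

abbreviation pt :: "mono \<Rightarrow> state" where
  "pt \<mu> \<equiv> (\<lambda>\<nu>. if \<nu> = \<mu> then 1 else 0)"

section \<open>Uniform description of the eight fields and their modes\<close>

datatype fld = Ap | Am | Be | Ga | Bt | Cc | Ze | Et

fun md :: "fld \<Rightarrow> int \<Rightarrow> state \<Rightarrow> state" where
  "md Ap = alphaP" | "md Am = alphaM" | "md Be = betaO" | "md Ga = gammaO"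
| "md Bt = btO" | "md Cc = cO" | "md Ze = zetaO" | "md Et = etaO"

declare md.simps [simp del]

fun is_fer :: "fld \<Rightarrow> bool" where
  "is_fer Ap = False" | "is_fer Am = False" | "is_fer Be = False" | "is_fer Ga = False"
| "is_fer Bt = True" | "is_fer Cc = True" | "is_fer Ze = True" | "is_fer Et = True"

fun cr_kind :: "fld \<Rightarrow> nat" where
  "cr_kind Ap = 0" | "cr_kind Am = 1" | "cr_kind Be = 2" | "cr_kind Ga = 3"
| "cr_kind Bt = 0" | "cr_kind Cc = 1" | "cr_kind Ze = 2" | "cr_kind Et = 3"

fun dual_fld :: "fld \<Rightarrow> fld" where
  "dual_fld Ap = Am" | "dual_fld Am = Ap" | "dual_fld Be = Ga" | "dual_fld Ga = Be"
| "dual_fld Bt = Cc" | "dual_fld Cc = Bt" | "dual_fld Ze = Et" | "dual_fld Et = Ze"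

fun an_coeff :: "fld \<Rightarrow> int \<Rightarrow> complex" where
  "an_coeff Ap k = of_int k" | "an_coeff Am k = of_int k" | "an_coeff Be k = -1" | "an_coeff Ga k = 1"
| "an_coeff Bt k = 1" | "an_coeff Cc k = 1" | "an_coeff Ze k = 1" | "an_coeff Et k = 1"

definition cr :: "bool \<Rightarrow> mode \<Rightarrow> state \<Rightarrow> state" where
  "cr b x = (if b then crF x else crB x)"

definition an :: "bool \<Rightarrow> mode \<Rightarrow> state \<Rightarrow> state" where
  "an b x = (if b then anF x else anB x)"

lemma md_eq: "md X k v = (if k < 0 then cr (is_fer X) (cr_kind X, nat (-k)) v
    else smul (an_coeff X k) (an (is_fer X) (cr_kind (dual_fld X), nat k) v))"
  by (cases X) (simp_all add: md.simps alphaP_def alphaM_def betaO_def gammaO_def btO_def cO_def zetaO_def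
      etaO_def cr_def an_def smul_def del: of_int_of_nat_eq)

definition exch :: "fld \<Rightarrow> fld \<Rightarrow> complex" where
  "exch X Y = (if is_fer X \<and> is_fer Y then -1 else 1)"

text \<open>The condition on the index reflects that modes of index 0 act as zero, so a pair of
  index 0 has no central term even for fields whose \<open>an_coeff\<close> is a nonzero
  constant.\<close>

definition contr :: "fld \<Rightarrow> fld \<Rightarrow> int \<Rightarrow> complex" where
  "contr X Y m = (if Y = dual_fld X \<and> m \<noteq> 0 then an_coeff X m else 0)"

definition VV :: "state set" where
  "VV = {v. \<forall>\<mu>. v \<mu> \<noteq> 0 \<longrightarrow> valid_mono \<mu>}"

text \<open>The level is an integer so that \<open>md X k\<close> maps \<open>VL L\<close> into
  \<open>VL (L - k)\<close> without side conditions. For negative L the space is zero, which is how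
  modes of large index are seen to annihilate a state.\<close>

definition VL :: "int \<Rightarrow> state set" where
  "VL L = {v. \<forall>\<mu>. v \<mu> \<noteq> 0 \<longrightarrow> valid_mono \<mu> \<and> int (level \<mu>) = L}"

lemma VL_VV: "v \<in> VL L \<Longrightarrow> v \<in> VV"
  by (auto simp: VL_def VV_def)

lemma VL_zero [simp]: "0 \<in> VL L"
  by (auto simp: VL_def)

lemma VL_add: "v \<in> VL L \<Longrightarrow> w \<in> VL L \<Longrightarrow> v + w \<in> VL L"
  by (auto simp: VL_def) (metis add.right_neutral)+
lemma VL_smul: "v \<in> VL L \<Longrightarrow> smul c v \<in> VL L"
  by (auto simp: VL_def smul_def)

lemma VL_neg: "L < 0 \<Longrightarrow> v \<in> VL L \<Longrightarrow> v = 0"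
  by (force simp: VL_def fun_eq_iff)

subsection \<open>Commutation relations\<close>

lemma anB_crB: "anB x (crB y v) = crB y (anB x v) + (if x = y then v else 0)"
  by (rule ext) (auto simp: anB_def crB_def bos_upd_def algebra_simps fun_upd_twist)

lemma crB_crB: "crB x (crB y v) = crB y (crB x v)"
  by (rule ext) (auto simp: anB_def crB_def bos_upd_def algebra_simps fun_upd_twist)

lemma anB_anB: "anB x (anB y v) = anB y (anB x v)"
  by (rule ext) (auto simp: anB_def crB_def bos_upd_def algebra_simps fun_upd_twist)

lemma mono_upd_comm: "\<mu>\<lparr>fer := F, bos := b\<rparr> = \<mu>\<lparr>bos := b, fer := F\<rparr>"
  by (cases \<mu>) simp

lemma bos_fer_comm:
  "anB x (crF y v) = crF y (anB x v)" "anB x (anF y v) = anF y (anB x v)"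
  "crB x (crF y v) = crF y (crB x v)" "crB x (anF y v) = anF y (crB x v)"
  by (auto simp: anB_def crB_def crF_def anF_def bos_upd_def fun_eq_iff mono_upd_comm)

lemma lexless_asym: "f \<noteq> g \<Longrightarrow> lexless f g \<longleftrightarrow> \<not> lexless g f"
  by (cases f; cases g) (auto simp: lexless_def)

lemma lexless_irrefl [simp]: "\<not> lexless f f"
  by (auto simp: lexless_def)

lemma fsign_insert:
  assumes "finite S" "g \<notin> S"
  shows "fsign f (insert g S) = (if lexless g f then - fsign f S else fsign f S)"
proof (cases "lexless g f")
  case True
  have "{h \<in> insert g S. lexless h f} = insert g {h \<in> S. lexless h f}" using True by auto
  then show ?thesis using assms True by (simp add: fsign_def)
next
  case False
  have "{h \<in> insert g S. lexless h f} = {h \<in> S. lexless h f}" using False by auto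
  then show ?thesis using False by (simp add: fsign_def)
qed

lemma fsign_remove:
  assumes "finite S" "g \<in> S"
  shows "fsign f (S - {g}) = (if lexless g f then - fsign f S else fsign f S)"
  using fsign_insert[of "S - {g}" g f] assms by (simp add: insert_absorb split: if_splits)

lemma fsign_sq: "fsign f S * (fsign f S * z) = z" "fsign f S * fsign f S = 1"
proof -
  have "fsign f S = 1 \<or> fsign f S = -1" unfolding fsign_def by (metis neg_one_even_power neg_one_odd_power)
  then show "fsign f S * (fsign f S * z) = z" "fsign f S * fsign f S = 1" by auto
qed

lemma VV_fin: "v \<in> VV \<Longrightarrow> infinite (fer \<mu>) \<Longrightarrow> v \<mu> = 0"
  by (auto simp: VV_def valid_mono_def)

text \<open>Membership in \<open>VV\<close> takes care of infinite fermion sets: there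
  \<open>card\<close>, and with it \<open>fsign\<close>, loses its meaning, but the state
  vanishes.\<close>

lemma crF_crF: assumes "v \<in> VV" shows "crF f (crF g v) = - crF g (crF f v)"
proof (rule ext)
  fix \<mu>
  show "crF f (crF g v) \<mu> = (- crF g (crF f v)) \<mu>"
  proof (cases "finite (fer \<mu>)")
    case False
    then show ?thesis using assms by (auto simp: crF_def VV_fin)
  next
    case True
    have "fer \<mu> - {f} - {g} = fer \<mu> - {g} - {f}" by auto
    then show ?thesis using True lexless_asym[of f g]
      by (cases "f = g") (auto simp: crF_def fsign_remove)
  qed
qed

lemma anF_anF: assumes "v \<in> VV" shows "anF f (anF g v) = - anF g (anF f v)"
proof (rule ext)
  fix \<mu>
  show "anF f (anF g v) \<mu> = (- anF g (anF f v)) \<mu>"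
  proof (cases "finite (fer \<mu>)")
    case False
    then show ?thesis using assms by (auto simp: anF_def VV_fin)
  next
    case True
    have "insert f (insert g (fer \<mu>)) = insert g (insert f (fer \<mu>))" by auto
    then show ?thesis using True lexless_asym[of f g]
      by (cases "f = g") (auto simp: anF_def fsign_insert)
  qed
qed

lemma anF_crF: assumes "v \<in> VV" shows "anF f (crF g v) = - crF g (anF f v) + (if f = g then v else 0)"
proof (rule ext)
  fix \<mu>
  show "anF f (crF g v) \<mu> = (- crF g (anF f v) + (if f = g then v else 0)) \<mu>"
  proof (cases "finite (fer \<mu>)")
    case False
    then show ?thesis using assms by (auto simp: crF_def anF_def VV_fin)
  next
    case True
    have "f \<noteq> g \<Longrightarrow> insert f (fer \<mu> - {g}) = insert f (fer \<mu>) - {g}" by auto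
    then show ?thesis using True lexless_asym[of f g]
      by (cases "f = g") (auto simp: crF_def anF_def fsign_insert fsign_remove fsign_sq insert_absorb)
  qed
qed

lemma op_add: "cr b x (v + w) = cr b x v + cr b x w" "an b x (v + w) = an b x v + an b x w"
  by (auto simp: cr_def an_def crB_def crF_def anB_def anF_def fun_eq_iff algebra_simps)
lemma op_smul: "cr b x (smul c v) = smul c (cr b x v)" "an b x (smul c v) = smul c (an b x v)"
  by (auto simp: cr_def an_def crB_def crF_def anB_def anF_def fun_eq_iff algebra_simps smul_def)

lemma md_add: "md X k (v + w) = md X k v + md X k w"
  by (simp add: md_eq op_add smul_add)
lemma md_smul: "md X k (smul c v) = smul c (md X k v)"
  by (simp add: md_eq op_smul mult.commute)
lemma md_zero [simp]: "md X k 0 = 0"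
  using md_smul[of X k 0 0] by simp
lemma md_uminus: "md X k (- v) = - md X k v"
  using md_smul[of X k "-1" v] by simp
lemma md_diff: "md X k (v - w) = md X k v - md X k w"
  using md_add[of X k v "-w"] by (simp add: md_uminus)
lemma md_sum: "md X k (sum f A) = (\<Sum>i\<in>A. md X k (f i))"
  using sum_comp_morphism[of "md X k" f A] by (simp only: comp_def md_zero md_add)

definition bsgn :: "bool \<Rightarrow> bool \<Rightarrow> complex" where "bsgn a b = (if a \<and> b then -1 else 1)"

lemma cr_cr: "v \<in> VV \<Longrightarrow> cr a x (cr b y v) = smul (bsgn a b) (cr b y (cr a x v))"
  by (auto simp: cr_def crB_crB bos_fer_comm bsgn_def intro: crF_crF)
lemma an_an: "v \<in> VV \<Longrightarrow> an a x (an b y v) = smul (bsgn a b) (an b y (an a x v))"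
  by (auto simp: an_def anB_anB bos_fer_comm bsgn_def intro: anF_anF)
lemma an_cr: "v \<in> VV \<Longrightarrow> an a x (cr b y v) = smul (bsgn a b) (cr b y (an a x v))
     + (if a = b \<and> x = y then v else 0)"
  by (auto simp: an_def cr_def anB_crB bos_fer_comm bsgn_def anF_crF[simplified])
lemma cr_an: "v \<in> VV \<Longrightarrow> cr b y (an a x v) = smul (bsgn a b) (an a x (cr b y v)) 
     - (if a = b \<and> x = y then smul (bsgn a b) v else 0)"
  by (auto simp: an_cr bsgn_def smul_add algebra_simps)

lemma md_zero_mode: "v \<in> VV \<Longrightarrow> md X 0 v = 0"
proof -
  assume v: "v \<in> VV"
  have "an b (x, 0) v = 0" for b x
  proof (rule ext)
    fix \<mu>
    show "an b (x, 0) v \<mu> = 0 \<mu>"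
    proof (cases b)
      case True
      have "\<not> valid_mono (\<mu>\<lparr>fer := insert (x, 0) (fer \<mu>)\<rparr>)" by (auto simp: valid_mono_def)
      then have "v (\<mu>\<lparr>fer := insert (x, 0) (fer \<mu>)\<rparr>) = 0" using v by (auto simp: VV_def)
      then show ?thesis using True by (simp add: an_def anF_def)
    next
      case False
      have "\<not> valid_mono (bos_upd (x, 0) Suc \<mu>)" by (auto simp: valid_mono_def bos_upd_def)
      then have "v (bos_upd (x, 0) Suc \<mu>) = 0" using v by (auto simp: VV_def)
      then show ?thesis using False by (simp add: an_def anB_def)
    qed
  qed
  then show ?thesis by (simp add: md_eq)
qed

lemma an_kind_eq_iff:
  "(is_fer X = is_fer Y \<and> cr_kind (dual_fld X) = cr_kind Y) \<longleftrightarrow> Y = dual_fld X"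
  by (cases X; cases Y) simp_all

lemma dual_dual [simp]: "dual_fld (dual_fld X) = X" and is_fer_dual [simp]: "is_fer (dual_fld X) = is_fer X"
  by (cases X; simp)+

lemma an_coeff_dual: "an_coeff (dual_fld X) k = - (if is_fer X then -1 else 1) * an_coeff X (- k)"
  by (cases X) auto

subsection \<open>Gradings\<close>

text \<open>Level, ghost number and filtration degree are all additive over the occupied modes. In
  this common form a single lemma on creators and one on annihilators serve all three
  gradings.\<close>

definition wt :: "(mode \<Rightarrow> int) \<Rightarrow> (mode \<Rightarrow> int) \<Rightarrow> mono \<Rightarrow> int" where
  "wt wB wF \<mu> = (\<Sum>x | bos \<mu> x \<noteq> 0. int (bos \<mu> x) * wB x) + (\<Sum>x\<in>fer \<mu>. wF x)"

definition gh_wt :: "mode \<Rightarrow> int" where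
  "gh_wt x = (if fst x = 1 \<or> fst x = 3 then 1 else if fst x = 0 \<or> fst x = 2 then -1 else 0)"
definition dg_bos :: "mode \<Rightarrow> int" where
  "dg_bos x = (if fst x = 0 then 1 else if fst x = 1 then -1 else 0)"
definition dg_fer :: "mode \<Rightarrow> int" where
  "dg_fer x = (if fst x = 1 then 1 else if fst x = 0 then -1 else 0)"

definition deg :: "mono \<Rightarrow> int" where
  "deg = wt dg_bos dg_fer"

lemma level_wt: "int (level \<mu>) = wt (\<lambda>x. int (snd x)) (\<lambda>x. int (snd x)) \<mu>"
  by (simp add: level_def wt_def)

lemma ghost_wt: assumes "valid_mono \<mu>" shows "ghost \<mu> = wt (\<lambda>_. 0) gh_wt \<mu>"
proof -
  have fin: "finite (fer \<mu>)" using assms by (simp add: valid_mono_def)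
  have "int (card {x \<in> fer \<mu>. fst x = i}) = (\<Sum>x\<in>fer \<mu>. if fst x = i then 1 else 0)" for i
    using fin by (simp add: sum.If_cases Int_def)
  then have "ghost \<mu> = (\<Sum>x\<in>fer \<mu>. (if fst x = 1 then 1 else 0) + (if fst x = 3 then 1 else 0)
      - (if fst x = 0 then 1 else 0) - (if fst x = 2 then 1 else 0))"
    by (simp only: ghost_def sum.distrib sum_subtractf)
  also have "\<dots> = (\<Sum>x\<in>fer \<mu>. gh_wt x)" by (rule sum.cong) (auto simp: gh_wt_def)
  finally show ?thesis by (simp add: wt_def)
qed

abbreviation ok_mode :: "mode \<Rightarrow> bool" where "ok_mode x \<equiv> fst x < 4 \<and> snd x \<ge> 1"

lemma supp_bos_upd: "{y. bos (bos_upd x Suc \<mu>) y \<noteq> 0} = insert x {y. bos \<mu> y \<noteq> 0}"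
  by (auto simp: bos_upd_def)

lemma valid_bos_upd: "valid_mono (bos_upd x Suc \<mu>) \<longleftrightarrow> valid_mono \<mu> \<and> ok_mode x"
proof -
  have eq: "valid_mono \<nu> \<longleftrightarrow> finite {y. bos \<nu> y \<noteq> 0} \<and> finite (fer \<nu>) \<and>
      (\<forall>y\<in>{y. bos \<nu> y \<noteq> 0}. ok_mode y) \<and> (\<forall>y\<in>fer \<nu>. ok_mode y)" for \<nu>
    by (auto simp: valid_mono_def)
  have "fer (bos_upd x Suc \<mu>) = fer \<mu>" by (simp add: bos_upd_def)
  then show ?thesis unfolding eq supp_bos_upd by auto
qed

lemma wt_bos_upd: assumes "valid_mono \<mu>" shows "wt wB wF (bos_upd x Suc \<mu>) = wt wB wF \<mu> + wB x"
proof -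
  have fin: "finite {y. bos \<mu> y \<noteq> 0}" using assms by (simp add: valid_mono_def)
  let ?S = "insert x {y. bos \<mu> y \<noteq> 0}"
  have "(\<Sum>y | bos \<mu> y \<noteq> 0. int (bos \<mu> y) * wB y) = (\<Sum>y\<in>?S. int (bos \<mu> y) * wB y)"
    using fin by (intro sum.mono_neutral_left) auto
  moreover have "(\<Sum>y\<in>?S. int (bos (bos_upd x Suc \<mu>) y) * wB y)
     = (\<Sum>y\<in>?S. int (bos \<mu> y) * wB y + (if y = x then wB x else 0))"
    by (rule sum.cong) (auto simp: bos_upd_def algebra_simps)
  moreover have "\<dots> = (\<Sum>y\<in>?S. int (bos \<mu> y) * wB y) + wB x"
    using fin by (simp add: sum.distrib del: sum.insert)
  moreover have "fer (bos_upd x Suc \<mu>) = fer \<mu>" by (simp add: bos_upd_def)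
  ultimately show ?thesis unfolding wt_def supp_bos_upd by simp
qed

lemma valid_fer_upd: "valid_mono (\<mu>\<lparr>fer := insert f (fer \<mu>)\<rparr>) \<longleftrightarrow> valid_mono \<mu> \<and> ok_mode f"
  by (auto simp: valid_mono_def)

lemma wt_fer_upd: "valid_mono \<mu> \<Longrightarrow> f \<notin> fer \<mu> \<Longrightarrow>
    wt wB wF (\<mu>\<lparr>fer := insert f (fer \<mu>)\<rparr>) = wt wB wF \<mu> + wF f"
  by (simp add: wt_def valid_mono_def)

lemma cr_nonzero:
  assumes "cr b x v \<mu> \<noteq> 0" "v \<in> VV" "ok_mode x"
  shows "valid_mono \<mu> \<and> (\<exists>\<nu>. v \<nu> \<noteq> 0 \<and> valid_mono \<nu> \<and>
     (\<forall>wB wF. wt wB wF \<mu> = wt wB wF \<nu> + (if b then wF x else wB x)))"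
proof (cases b)
  case True
  define \<nu> where "\<nu> = \<mu>\<lparr>fer := fer \<mu> - {x}\<rparr>"
  have x: "x \<in> fer \<mu>" and v: "v \<nu> \<noteq> 0"
    using assms True by (auto simp: cr_def crF_def \<nu>_def split: if_splits)
  have \<mu>: "\<mu> = \<nu>\<lparr>fer := insert x (fer \<nu>)\<rparr>" "x \<notin> fer \<nu>" using x by (auto simp: \<nu>_def insert_absorb)
  have "valid_mono \<nu>" using v assms by (auto simp: VV_def)
  moreover have "valid_mono \<mu>"
    by (subst \<mu>(1)) (use calculation assms(3) in \<open>simp add: valid_fer_upd\<close>)
  moreover have "wt wB wF \<mu> = wt wB wF \<nu> + wF x" for wB wF
    by (subst \<mu>(1)) (use calculation \<mu>(2) in \<open>simp add: wt_fer_upd\<close>)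
  ultimately show ?thesis using v True by (intro conjI exI[of _ \<nu>]) auto
next
  case False
  define \<nu> where "\<nu> = bos_upd x (\<lambda>k. k - 1) \<mu>"
  have x: "bos \<mu> x \<ge> 1" and v: "v \<nu> \<noteq> 0"
    using assms False by (auto simp: cr_def crB_def \<nu>_def split: if_splits)
  have \<mu>: "\<mu> = bos_upd x Suc \<nu>" using x by (auto simp: \<nu>_def bos_upd_def)
  have "valid_mono \<nu>" using v assms by (auto simp: VV_def)
  moreover have "valid_mono \<mu>"
    by (subst \<mu>) (use calculation assms(3) in \<open>simp add: valid_bos_upd\<close>)
  moreover have "wt wB wF \<mu> = wt wB wF \<nu> + wB x" for wB wF
    by (subst \<mu>) (use calculation in \<open>simp add: wt_bos_upd\<close>)
  ultimately show ?thesis using v False by (intro conjI exI[of _ \<nu>]) auto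
qed

lemma an_nonzero:
  assumes "an b x v \<mu> \<noteq> 0" "v \<in> VV"
  shows "valid_mono \<mu> \<and> (\<exists>\<nu>. v \<nu> \<noteq> 0 \<and> valid_mono \<nu> \<and>
     (\<forall>wB wF. wt wB wF \<mu> = wt wB wF \<nu> - (if b then wF x else wB x)))"
proof (cases b)
  case True
  define \<nu> where "\<nu> = \<mu>\<lparr>fer := insert x (fer \<mu>)\<rparr>"
  have x: "x \<notin> fer \<mu>" and v: "v \<nu> \<noteq> 0"
    using assms True by (auto simp: an_def anF_def \<nu>_def split: if_splits)
  have \<nu>: "valid_mono \<nu>" using v assms by (auto simp: VV_def)
  then have \<mu>: "valid_mono \<mu>" using valid_fer_upd \<nu>_def by auto
  have "wt wB wF \<nu> = wt wB wF \<mu> + wF x" for wB wF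
    using wt_fer_upd[OF \<mu> x] \<nu>_def by auto
  then show ?thesis using \<mu> \<nu> v True by (intro conjI exI[of _ \<nu>]) auto
next
  case False
  define \<nu> where "\<nu> = bos_upd x Suc \<mu>"
  have v: "v \<nu> \<noteq> 0"
    using assms False by (auto simp: an_def anB_def \<nu>_def split: if_splits)
  have \<nu>: "valid_mono \<nu>" using v assms by (auto simp: VV_def)
  then have \<mu>: "valid_mono \<mu>" using valid_bos_upd \<nu>_def by auto
  have "wt wB wF \<nu> = wt wB wF \<mu> + wB x" for wB wF
    using wt_bos_upd[OF \<mu>] \<nu>_def by auto
  then show ?thesis using \<mu> \<nu> v False by (intro conjI exI[of _ \<nu>]) auto
qed

text \<open>Homogeneity is expressed through supports: each monomial of the output arises from a
  monomial of the input with shifted gradings. In this form it passes to compositions, sums and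
  \<open>Sum_any\<close> without any appeal to linearity.\<close>

definition raises :: "(state \<Rightarrow> state) \<Rightarrow> int \<Rightarrow> int \<Rightarrow> int \<Rightarrow> bool" where
  "raises A l g f \<longleftrightarrow> (\<forall>v\<in>VV. \<forall>\<mu>. A v \<mu> \<noteq> 0 \<longrightarrow> valid_mono \<mu> \<and>
     (\<exists>\<nu>. v \<nu> \<noteq> 0 \<and> int (level \<mu>) = int (level \<nu>) + l \<and> ghost \<mu> = ghost \<nu> + g \<and> deg \<mu> = deg \<nu> + f))"

lemma raisesD:
  assumes "raises A l g f" "v \<in> VV" "A v \<mu> \<noteq> 0"
  obtains \<nu> where "v \<nu> \<noteq> 0" "int (level \<mu>) = int (level \<nu>) + l" "ghost \<mu> = ghost \<nu> + g"
    "deg \<mu> = deg \<nu> + f" "valid_mono \<mu>" "valid_mono \<nu>"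
  using assms unfolding raises_def VV_def by blast

lemma raises_VV: "raises A l g f \<Longrightarrow> v \<in> VV \<Longrightarrow> A v \<in> VV"
  unfolding raises_def VV_def by blast

lemma raises_VL: assumes "raises A l g f" "v \<in> VL L" shows "A v \<in> VL (L + l)"
proof -
  have "valid_mono \<mu> \<and> int (level \<mu>) = L + l" if "A v \<mu> \<noteq> 0" for \<mu>
    using raisesD[OF assms(1) VL_VV[OF assms(2)] that] assms(2) by (auto simp: VL_def)
  then show ?thesis by (simp add: VL_def)
qed

lemma raises_comp:
  assumes "raises A l g f" "raises B l' g' f'"
  shows "raises (\<lambda>v. A (B v)) (l + l') (g + g') (f + f')"
  unfolding raises_def
proof (intro ballI allI impI)
  fix v \<mu> assume v: "v \<in> VV" and nz: "A (B v) \<mu> \<noteq> 0"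
  obtain \<nu> where \<nu>: "B v \<nu> \<noteq> 0" "int (level \<mu>) = int (level \<nu>) + l" "ghost \<mu> = ghost \<nu> + g"
    "deg \<mu> = deg \<nu> + f" "valid_mono \<mu>"
    using raisesD[OF assms(1) raises_VV[OF assms(2) v] nz] by metis
  obtain \<kappa> where "v \<kappa> \<noteq> 0" "int (level \<nu>) = int (level \<kappa>) + l'" "ghost \<nu> = ghost \<kappa> + g'"
    "deg \<nu> = deg \<kappa> + f'"
    using raisesD[OF assms(2) v \<nu>(1)] by metis
  then show "valid_mono \<mu> \<and> (\<exists>\<nu>. v \<nu> \<noteq> 0 \<and> int (level \<mu>) = int (level \<nu>) + (l + l')
      \<and> ghost \<mu> = ghost \<nu> + (g + g') \<and> deg \<mu> = deg \<nu> + (f + f'))"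
    using \<nu> by (intro conjI exI[of _ \<kappa>]) auto
qed

lemma raises_add: "raises A l g f \<Longrightarrow> raises B l g f \<Longrightarrow> raises (\<lambda>v. A v + B v) l g f"
  unfolding raises_def by simp (metis add_0)

lemma raises_smul: "raises A l g f \<Longrightarrow> raises (\<lambda>v. smul c (A v)) l g f"
  unfolding raises_def smul_def by simp

lemma sum_state_apply: "(sum f A :: state) \<mu> = (\<Sum>i\<in>A. f i \<mu>)"
  by (induction A rule: infinite_finite_induct) auto

lemma raises_sum: assumes "\<And>i. i \<in> I \<Longrightarrow> raises (A i) l g f" shows "raises (\<lambda>v. \<Sum>i\<in>I. A i v) l g f"
proof -
  have "\<exists>i\<in>I. A i v \<mu> \<noteq> 0" if "(\<Sum>i\<in>I. A i v) \<mu> \<noteq> 0" for v \<mu>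
    using that by (metis sum_state_apply sum.neutral)
  then show ?thesis using assms unfolding raises_def by meson
qed

fun gh_fld :: "fld \<Rightarrow> int" where
  "gh_fld Cc = 1" | "gh_fld Et = 1" | "gh_fld Bt = -1" | "gh_fld Ze = -1" | "gh_fld _ = 0"
fun dg_fld :: "fld \<Rightarrow> int" where
  "dg_fld Ap = 1" | "dg_fld Am = -1" | "dg_fld Cc = 1" | "dg_fld Bt = -1" | "dg_fld _ = 0"

lemma raises_md: "raises (md X k) (- k) (gh_fld X) (dg_fld X)"
  unfolding raises_def
proof (intro ballI allI impI)
  fix v \<mu> assume v: "v \<in> VV" and nz: "md X k v \<mu> \<noteq> 0"
  let ?R = "\<lambda>\<nu>. v \<nu> \<noteq> 0 \<and> int (level \<mu>) = int (level \<nu>) + (- k) \<and> ghost \<mu> = ghost \<nu> + gh_fld X \<and> deg \<mu> = deg \<nu> + dg_fld X"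
  consider "k < 0" | "k \<ge> 0" by linarith
  then show "valid_mono \<mu> \<and> (\<exists>\<nu>. ?R \<nu>)"
  proof cases
    case 1
    have "ok_mode (cr_kind X, nat (- k))" using 1 by (cases X) auto
    moreover have "cr (is_fer X) (cr_kind X, nat (- k)) v \<mu> \<noteq> 0"
      using nz 1 by (simp add: md_eq)
    ultimately obtain \<nu> where r: "valid_mono \<mu>" "v \<nu> \<noteq> 0" "valid_mono \<nu>"
      and w: "\<And>wB wF. wt wB wF \<mu> = wt wB wF \<nu> + (if is_fer X then wF (cr_kind X, nat (- k)) else wB (cr_kind X, nat (- k)))"
      using cr_nonzero[OF _ v] by blast
    have "?R \<nu>"
      unfolding level_wt ghost_wt[OF r(1)] ghost_wt[OF r(3)] deg_def w
      using 1 r by (cases X) (simp_all add: gh_wt_def dg_bos_def dg_fer_def)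
    then show ?thesis using r by blast
  next
    case 2
    have "an (is_fer X) (cr_kind (dual_fld X), nat k) v \<mu> \<noteq> 0"
      using nz 2 by (simp add: md_eq smul_def)
    then obtain \<nu> where r: "valid_mono \<mu>" "v \<nu> \<noteq> 0" "valid_mono \<nu>"
      and w: "\<And>wB wF. wt wB wF \<mu> = wt wB wF \<nu> - (if is_fer X then wF (cr_kind (dual_fld X), nat k) else wB (cr_kind (dual_fld X), nat k))"
      using an_nonzero[OF _ v] by blast
    have "?R \<nu>"
      unfolding level_wt ghost_wt[OF r(1)] ghost_wt[OF r(3)] deg_def w
      using 2 r by (cases X) (simp_all add: gh_wt_def dg_bos_def dg_fer_def)
    then show ?thesis using r by blast
  qed
qed

lemma md_VV: "v \<in> VV \<Longrightarrow> md X k v \<in> VV"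
  using raises_md by (rule raises_VV)

lemma md_VL: "v \<in> VL L \<Longrightarrow> md X k v \<in> VL (L - k)"
  using raises_VL[OF raises_md, of v L X k] by simp

lemma md_kill: "v \<in> VL L \<Longrightarrow> k > L \<Longrightarrow> md X k v = 0"
  using VL_neg[of "L - k" "md X k v"] md_VL[of v L X k] by simp

text \<open>The canonical relations for all fields and all signs of the indices at once, so that
  indices can later run over all integers. At index 0 both sides vanish.\<close>

theorem md_comm:
  assumes v: "v \<in> VV"
  shows "md X k (md Y l v) = smul (exch X Y) (md Y l (md X k v))
     + (if k + l = 0 then smul (contr X Y k) v else 0)"
proof (cases "k = 0 \<or> l = 0")
  case True
  then show ?thesis using v md_zero_mode[OF v] md_zero_mode[OF md_VV[OF v]] by (auto simp: contr_def)
next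
  case nz: False
  have sb: "exch X Y = bsgn (is_fer X) (is_fer Y)" by (simp add: exch_def bsgn_def)
  consider "k < 0" "l < 0" | "k < 0" "l > 0" | "k > 0" "l < 0" | "k > 0" "l > 0"
    using nz by linarith
  then show ?thesis
  proof cases
    case 1
    have "cr (is_fer X) (cr_kind X, nat (- k)) (cr (is_fer Y) (cr_kind Y, nat (- l)) v) =
      smul (exch X Y) (cr (is_fer Y) (cr_kind Y, nat (- l)) (cr (is_fer X) (cr_kind X, nat (- k)) v))"
      unfolding sb by (rule cr_cr[OF v])
    then show ?thesis using 1 by (simp add: md_eq)
  next
    case 2
    have c: "cr (is_fer X) (cr_kind X, nat (- k)) (an (is_fer Y) (cr_kind (dual_fld Y), nat l) v)
      = smul (exch X Y) (an (is_fer Y) (cr_kind (dual_fld Y), nat l) (cr (is_fer X) (cr_kind X, nat (- k)) v))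
        - (if Y = dual_fld X \<and> k + l = 0 then smul (exch X Y) v else 0)"
      using 2 an_kind_eq_iff[of Y X] dual_dual
      by (subst cr_an[OF v]) (auto simp: exch_def bsgn_def)
    \<comment> \<open>Here the creator stands on the left, so the contraction appears with the
      opposite order and sign; \<open>an_coeff_dual\<close> restores the coefficient of X.\<close>
    have "- (an_coeff Y l * exch X Y) = an_coeff X k" if "Y = dual_fld X" "k + l = 0"
    proof -
      have l: "l = - k" using that by simp
      show ?thesis using that(1) an_coeff_dual[of X "- k"] unfolding l by (simp add: exch_def)
    qed
    then show ?thesis using 2 
      by (auto simp: md_eq c op_smul vs.scale_right_diff_distrib contr_def mult.commute
          simp flip: vs.scale_minus_left)
  next
    case 3
    have c: "an (is_fer X) (cr_kind (dual_fld X), nat k) (cr (is_fer Y) (cr_kind Y, nat (- l)) v)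
      = smul (exch X Y) (cr (is_fer Y) (cr_kind Y, nat (- l)) (an (is_fer X) (cr_kind (dual_fld X), nat k) v))
        + (if Y = dual_fld X \<and> k + l = 0 then v else 0)"
      using 3 an_kind_eq_iff[of X Y] by (subst an_cr[OF v]) (auto simp: sb)
    show ?thesis using 3
      by (auto simp: md_eq c op_smul smul_add contr_def mult.commute)
  next
    case 4
    have "an (is_fer X) (cr_kind (dual_fld X), nat k) (an (is_fer Y) (cr_kind (dual_fld Y), nat l) v) =
      smul (exch X Y) (an (is_fer Y) (cr_kind (dual_fld Y), nat l) (an (is_fer X) (cr_kind (dual_fld X), nat k) v))"
      unfolding sb by (rule an_an[OF v])
    then show ?thesis using 4 by (simp add: md_eq op_smul mult.commute mult.left_commute)
  qed
qed

subsection \<open>Locally finite sums\<close>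

lemma md_Sum_any: "finite {i. f i \<noteq> 0} \<Longrightarrow> md X k (Sum_any f) = Sum_any (\<lambda>i. md X k (f i))"
  by (subst (1 2) Sum_any.expand_superset[where A = "{i. f i \<noteq> 0}"]) (auto simp: md_sum)

lemma smul_Sum_any: "smul c (Sum_any f) = Sum_any (\<lambda>i. smul c (f i))"
proof (cases "c = 0")
  case False
  then have "{i. smul c (f i) \<noteq> 0} = {i. f i \<noteq> 0}" by simp
  then show ?thesis by (simp only: Sum_any.expand_set vs.scale_sum_right)
next
  case True then show ?thesis by simp
qed

lemma uminus_Sum_any: "- Sum_any f = Sum_any (\<lambda>i. - f i :: state)"
  using smul_Sum_any[of "-1" f] by simp

lemma Sum_any_apply: "finite {i. f i \<noteq> 0} \<Longrightarrow> Sum_any f \<mu> = fsum (\<lambda>i. f i \<mu>)" for f :: "'i \<Rightarrow> state"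
  unfolding Sum_any.expand_set fsum_def sum_state_apply
  by (rule sum.mono_neutral_right) auto

lemma sum_VL: "(\<And>i. i \<in> A \<Longrightarrow> f i \<in> VL L) \<Longrightarrow> sum f A \<in> VL L"
  by (induction A rule: infinite_finite_induct) (simp_all add: VL_add)

lemma Sum_any_VL: "(\<And>i. f i \<in> VL L) \<Longrightarrow> Sum_any f \<in> VL L"
  unfolding Sum_any.expand_set by (rule sum_VL)

text \<open>Contracting a mode with one factor of a cubic term fixes one summation index as a
  function of the other; this collapses the double sum.\<close>

lemma Sum_any_graph:
  "Sum_any (\<lambda>(n::'i, m::'j). if m = h n then G n m else 0) = Sum_any (\<lambda>n. G n (h n))"
proof -
  let ?F = "\<lambda>(n, m). if m = h n then G n m else 0"
  have eq: "{x. ?F x \<noteq> 0} = (\<lambda>n. (n, h n)) ` {n. G n (h n) \<noteq> 0}" by (auto split: if_splits)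
  show ?thesis unfolding Sum_any.expand_set eq
    by (subst sum.reindex) (auto intro: inj_onI)
qed

lemma Sum_any_swap_pair: "Sum_any (\<lambda>(n, m). G n m) = Sum_any (\<lambda>(m, n). G n m)"
  by (rule Sum_any.reindex_cong[of prod.swap]) (auto simp: fun_eq_iff)

lemma Sum_any_graph':
  "Sum_any (\<lambda>(n::'i, m::'j). if n = h m then G n m else 0) = Sum_any (\<lambda>m. G (h m) m)"
  by (subst Sum_any_swap_pair) (rule Sum_any_graph)

subsection \<open>The BRST operator in terms of modes\<close>

text \<open>Modes of index 0 vanish on \<^const>\<open>VV\<close> (\<open>md_zero_mode\<close>), so the restrictions to nonzero indices
 in the sums defining the operator can be dropped.\<close>

definition term0 :: "complex \<Rightarrow> int \<Rightarrow> state \<Rightarrow> state" where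
  "term0 a n v = smul (a - of_int n) (md Cc (- n) (md Am n v)) + md Et n (md Be (- n) v)"

definition term1 :: "int \<Rightarrow> int \<Rightarrow> state \<Rightarrow> state" where
  "term1 n m v = md Cc (- n) (md Ap (- m) (md Am (n + m) v))
     + smul (of_int (m - n) / 2) (md Cc (- n) (md Cc (- m) (md Bt (n + m) v)))
     + smul (of_int m) (md Cc (- n) (md Ze (- m) (md Et (n + m) v)))
     + smul (of_int m) (md Cc (- n) (md Be (- m) (md Ga (n + m) v)))"

definition term2 :: "complex \<Rightarrow> int \<Rightarrow> state \<Rightarrow> state" where
  "term2 b n v = smul (b + of_int n) (md Cc (- n) (md Ap n v))"

text \<open>A mode whose index exceeds the level kills the state. If it stands on the left, it can
  be moved to the right because there is no contraction.\<close>

lemma pair_kill: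
  assumes v: "v \<in> VL L" and nd: "contr X Y i = 0 \<or> i + j \<noteq> 0" and "i > L \<or> j > L"
  shows "md X i (md Y j v) = 0"
proof (cases "j > L")
  case True then show ?thesis using md_kill[OF v] by simp
next
  case False
  have "md X i (md Y j v) = smul (exch X Y) (md Y j (md X i v))"
    using nd by (subst md_comm[OF VL_VV[OF v]]) auto
  then show ?thesis using md_kill[OF v, of i X] False assms(3) by simp
qed

lemma pair_swap:
  assumes v: "v \<in> VV" and nd: "contr X Y i = 0 \<or> i + j \<noteq> 0"
  shows "md X i (md Y j v) = smul (exch X Y) (md Y j (md X i v))"
  using nd by (subst md_comm[OF v]) auto

text \<open>Since the indices add up to 0, a contraction of the last mode with one of the others
  would force the remaining index to be 0, where the mode vanishes. So the killing mode can always
  be moved to the right.\<close>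

lemma triple_kill:
  assumes v: "v \<in> VL L" and s: "i + j + l = 0" and "Y \<noteq> dual_fld X" and k: "i > L \<or> j > L \<or> l > L"
  shows "md X i (md Y j (md Z l v)) = 0"
proof (cases "i = 0 \<or> j = 0")
  case True
  then show ?thesis using v md_zero_mode by (metis VL_VV md_VV md_zero)
next
  case False
  have jl: "j + l \<noteq> 0" and il: "i + l \<noteq> 0" using s False by auto
  show ?thesis
  proof (cases "i > L")
    case False
    then show ?thesis using pair_kill[OF v, of Y Z j l] jl k by simp
  next
    case True
    have "md X i (md Y j (md Z l v)) = smul (exch X Y) (md Y j (md X i (md Z l v)))"
      using assms(3) by (intro pair_swap md_VV VL_VV[OF v]) (simp add: contr_def)
    moreover have "md X i (md Z l v) = 0"
      using pair_kill[OF v, of X Z i l] il True by simp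
    ultimately show ?thesis by simp
  qed
qed

lemma term0_kill: "v \<in> VL L \<Longrightarrow> n \<notin> {-L..L} \<Longrightarrow> term0 a n v = 0"
  using pair_kill[of v L Cc Am "-n" n] pair_kill[of v L Et Be n "-n"]
  by (auto simp: term0_def contr_def)

lemma term2_kill: "v \<in> VL L \<Longrightarrow> n \<notin> {-L..L} \<Longrightarrow> term2 b n v = 0"
  using pair_kill[of v L Cc Ap "-n" n]
  by (auto simp: term2_def contr_def)

lemma term1_kill: "v \<in> VL L \<Longrightarrow> - n > L \<or> - m > L \<or> n + m > L \<Longrightarrow> term1 n m v = 0"
  unfolding term1_def using triple_kill[of v L "- n" "- m" "n + m"] by simp

lemma term0_fin: "v \<in> VL L \<Longrightarrow> finite {n. term0 a n v \<noteq> 0}"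
  by (rule finite_subset[of _ "{-L..L}"]) (auto dest: term0_kill)
lemma term2_fin: "v \<in> VL L \<Longrightarrow> finite {n. term2 b n v \<noteq> 0}"
  by (rule finite_subset[of _ "{-L..L}"]) (auto dest: term2_kill)

lemma term1_supp: assumes "v \<in> VL L" shows "{(n, m). term1 n m v \<noteq> 0} \<subseteq> {-2*\<bar>L\<bar>..2*\<bar>L\<bar>} \<times> {-2*\<bar>L\<bar>..2*\<bar>L\<bar>}"
proof -
  have "n \<in> {-2*\<bar>L\<bar>..2*\<bar>L\<bar>} \<and> m \<in> {-2*\<bar>L\<bar>..2*\<bar>L\<bar>}" if "term1 n m v \<noteq> 0" for n m
  proof -
    have "\<not> (- n > L \<or> - m > L \<or> n + m > L)" using term1_kill[OF assms] that by blast
    then show ?thesis by auto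
  qed
  then show ?thesis by auto
qed
lemma term1_fin: "v \<in> VL L \<Longrightarrow> finite {x. (\<lambda>(n, m). term1 n m v) x \<noteq> 0}"
  using finite_subset[OF term1_supp] by (simp add: case_prod_unfold)

definition Q0 :: "complex \<Rightarrow> state \<Rightarrow> state" where "Q0 a v = Sum_any (\<lambda>n. term0 a n v)"
definition Q1 :: "state \<Rightarrow> state" where "Q1 v = Sum_any (\<lambda>(n, m). term1 n m v)"
definition Q2 :: "complex \<Rightarrow> state \<Rightarrow> state" where "Q2 b v = Sum_any (\<lambda>n. term2 b n v)"
definition Q :: "complex \<Rightarrow> complex \<Rightarrow> state \<Rightarrow> state" where "Q a b v = Q0 a v + Q1 v + Q2 b v"

text \<open>The given operator sums coefficient by coefficient, \<open>Q\<close> sums states. The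
  two agree when only finitely many summands are nonzero, hence the restriction to one
  level.\<close>

lemma dhat_eq_Q:
  assumes v: "v \<in> VL L"
  shows "dhat p q v = Q (pP p q) (pM p q) v"
proof -
  note z = md_zero_mode[OF VL_VV[OF v]]
  have vv: "\<And>X k. md X k v \<in> VV" "\<And>X k Y l. md X k (md Y l v) \<in> VV" using VL_VV[OF v] by (auto intro!: md_VV)
  have 0: "d0 p q v = Q0 (pP p q) v"
    unfolding Q0_def d0_def 
    by (rule ext, subst Sum_any_apply[OF term0_fin[OF v]], rule arg_cong[of _ _ fsum], rule ext)
      (auto simp: term0_def smul_def PP_def simp flip: md.simps simp: z)
  have 2: "d2 p q v = Q2 (pM p q) v"
    unfolding Q2_def d2_def
    by (rule ext, subst Sum_any_apply[OF term2_fin[OF v]], rule arg_cong[of _ _ fsum], rule ext)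
      (auto simp: term2_def smul_def PM_def simp flip: md.simps simp: z)
  have 1: "d1 v = Q1 v"
    unfolding Q1_def d1_def
    by (rule ext, subst Sum_any_apply[OF term1_fin[OF v]], rule arg_cong[of _ _ fsum], rule ext)
      (auto simp: term1_def smul_def simp flip: md.simps simp: z md_zero_mode[OF vv(1)] md_zero_mode[OF vv(2)])
  show ?thesis by (simp add: dhat_def Q_def 0 1 2 fun_eq_iff)
qed

subsection \<open>Linearity and grading of the BRST operator\<close>

lemma raises_Sum_any: assumes "\<And>i. raises (A i) l g f" shows "raises (\<lambda>v. Sum_any (\<lambda>i. A i v)) l g f"
proof -
  have "\<exists>i. A i v \<mu> \<noteq> 0" if "Sum_any (\<lambda>i. A i v) \<mu> \<noteq> 0" for v \<mu>
    using that unfolding Sum_any.expand_set by (metis sum_state_apply sum.neutral)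
  then show ?thesis using assms unfolding raises_def by meson
qed

lemma raises_eq: "raises A l g f \<Longrightarrow> l = l' \<Longrightarrow> g = g' \<Longrightarrow> f = f' \<Longrightarrow> raises A l' g' f'"
  by simp

lemma raises_pair: "raises (\<lambda>v. md X i (md Y j v)) (- i - j) (gh_fld X + gh_fld Y) (dg_fld X + dg_fld Y)"
  using raises_comp[OF raises_md[of X i] raises_md[of Y j]] by simp
lemma raises_triple: "raises (\<lambda>v. md X i (md Y j (md Z l v))) (- i - j - l)
    (gh_fld X + gh_fld Y + gh_fld Z) (dg_fld X + dg_fld Y + dg_fld Z)"
  using raises_comp[OF raises_md[of X i] raises_pair[of Y j Z l]] by (simp add: algebra_simps)

lemma raises_Q0: "raises (Q0 a) 0 1 0"
  unfolding Q0_def term0_def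
  by (intro raises_Sum_any raises_add raises_smul raises_eq[OF raises_pair]) auto
lemma raises_Q2: "raises (Q2 b) 0 1 2"
  unfolding Q2_def term2_def
  by (intro raises_Sum_any raises_add raises_smul raises_eq[OF raises_pair]) auto
lemma raises_term1: "raises (term1 n m) 0 1 1"
  unfolding term1_def
  by (intro raises_add raises_smul raises_eq[OF raises_triple]) auto
lemma raises_Q1: "raises Q1 0 1 1"
  unfolding Q1_def case_prod_unfold
  by (intro raises_Sum_any raises_term1)

lemma Q0_VL: "v \<in> VL L \<Longrightarrow> Q0 a v \<in> VL L" and Q1_VL: "v \<in> VL L \<Longrightarrow> Q1 v \<in> VL L"
  and Q2_VL: "v \<in> VL L \<Longrightarrow> Q2 b v \<in> VL L"
  using raises_VL[OF raises_Q0] raises_VL[OF raises_Q1] raises_VL[OF raises_Q2] by fastforce+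

lemma Q_VL: "v \<in> VL L \<Longrightarrow> Q a b v \<in> VL L"
  unfolding Q_def by (intro VL_add Q0_VL Q1_VL Q2_VL)

lemma term0_add: "term0 a n (v + w) = term0 a n v + term0 a n w"
  by (simp add: term0_def md_add smul_add)
lemma term1_add: "term1 n m (v + w) = term1 n m v + term1 n m w"
  by (simp add: term1_def md_add smul_add)
lemma term2_add: "term2 b n (v + w) = term2 b n v + term2 b n w"
  by (simp add: term2_def md_add smul_add)
lemma term0_smul: "term0 a n (smul c v) = smul c (term0 a n v)"
  by (simp add: term0_def md_smul smul_add mult.commute)
lemma term1_smul: "term1 n m (smul c v) = smul c (term1 n m v)"
  by (simp add: term1_def md_smul smul_add mult.commute)
lemma term2_smul: "term2 b n (smul c v) = smul c (term2 b n v)"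
  by (simp add: term2_def md_smul smul_add mult.commute)

text \<open>\<open>Sum_any\<close> is 0 on a family with infinitely many nonzero terms, so
  additivity is asserted on a fixed level, where the supports are finite. Scaling does not change
  supports and needs no such restriction.\<close>

lemma Q0_add: "v \<in> VL L \<Longrightarrow> w \<in> VL L \<Longrightarrow> Q0 a (v + w) = Q0 a v + Q0 a w"
  by (simp add: Q0_def term0_add Sum_any.distrib term0_fin)
lemma Q1_add: "v \<in> VL L \<Longrightarrow> w \<in> VL L \<Longrightarrow> Q1 (v + w) = Q1 v + Q1 w"
  unfolding Q1_def by (subst Sum_any.distrib[OF term1_fin term1_fin, symmetric]) (auto simp: term1_add case_prod_unfold)
lemma Q2_add: "v \<in> VL L \<Longrightarrow> w \<in> VL L \<Longrightarrow> Q2 b (v + w) = Q2 b v + Q2 b w"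
  by (simp add: Q2_def term2_add Sum_any.distrib term2_fin)
lemma Q0_smul: "Q0 a (smul c v) = smul c (Q0 a v)"
  by (simp add: Q0_def term0_smul smul_Sum_any)
lemma Q1_smul: "Q1 (smul c v) = smul c (Q1 v)"
  by (simp add: Q1_def term1_smul smul_Sum_any case_prod_unfold)
lemma Q2_smul: "Q2 b (smul c v) = smul c (Q2 b v)"
  by (simp add: Q2_def term2_smul smul_Sum_any)

lemma Q_add: "v \<in> VL L \<Longrightarrow> w \<in> VL L \<Longrightarrow> Q a b (v + w) = Q a b v + Q a b w"
  by (simp add: Q_def Q0_add Q1_add Q2_add)
lemma Q_smul: "Q a b (smul c v) = smul c (Q a b v)"
  by (simp add: Q_def Q0_smul Q1_smul Q2_smul smul_add)
lemma Q_zero [simp]: "Q a b 0 = 0"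
  using Q_smul[of a b 0 0] by simp
lemma Q_uminus: "Q a b (- v) = - Q a b v"
  using Q_smul[of a b "-1" v] by simp

lemma Q_sum: "(\<And>i. i \<in> A \<Longrightarrow> f i \<in> VL L) \<Longrightarrow> Q a b (sum f A) = (\<Sum>i\<in>A. Q a b (f i))"
proof (induction A rule: infinite_finite_induct)
  case (insert x F)
  have sF: "sum f F \<in> VL L" and fx: "f x \<in> VL L" using insert.prems by (auto intro: sum_VL)
  have "Q a b (sum f F) = (\<Sum>i\<in>F. Q a b (f i))" using insert by blast
  then show ?case by (simp only: sum.insert[OF insert.hyps] Q_add[OF fx sF])
qed simp_all

lemma Q_Sum_any:
  assumes "finite {i. f i \<noteq> 0}" "\<And>i. f i \<in> VL L"
  shows "Q a b (Sum_any f) = Sum_any (\<lambda>i. Q a b (f i))"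
  using assms by (subst (1 2) Sum_any.expand_superset[where A = "{i. f i \<noteq> 0}"]) (auto simp: Q_sum[where L = L])

subsection \<open>Commutators of the BRST operator with the modes\<close>

definition eps :: "fld \<Rightarrow> complex" where "eps X = (if is_fer X then -1 else 1)"

lemma eps_simps [simp]: "eps Ap = 1" "eps Am = 1" "eps Be = 1" "eps Ga = 1"
  "eps Bt = -1" "eps Cc = -1" "eps Ze = -1" "eps Et = -1"
  by (simp_all add: eps_def)

text \<open>The commutator of A_i B_j with X_k, one summand per contraction. The factor
  \<open>exch B X\<close> is the sign for moving X past B before it meets A.\<close>

definition contr_pair :: "fld \<Rightarrow> int \<Rightarrow> fld \<Rightarrow> int \<Rightarrow> fld \<Rightarrow> int \<Rightarrow> state \<Rightarrow> state" where
  "contr_pair A i B j X k v =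
     (if k = - j then smul (contr B X j) (md A i v) else 0)
   + (if k = - i then smul (exch B X * contr A X i) (md B j v) else 0)"

definition contr_triple :: "fld \<Rightarrow> int \<Rightarrow> fld \<Rightarrow> int \<Rightarrow> fld \<Rightarrow> int \<Rightarrow> fld \<Rightarrow> int \<Rightarrow> state \<Rightarrow> state" where
  "contr_triple A i B j C l X k v =
     (if k = - l then smul (contr C X l) (md A i (md B j v)) else 0)
   + (if k = - j then smul (exch C X * contr B X j) (md A i (md C l v)) else 0)
   + (if k = - i then smul (exch C X * exch B X * contr A X i) (md B j (md C l v)) else 0)"

lemma md_comm': "v \<in> VV \<Longrightarrow> md X k (md Y l v) = smul (exch X Y) (md Y l (md X k v))
     + (if l = - k then smul (contr X Y k) v else 0)"
  using md_comm[of v X k Y l] by (simp add: add_eq_0_iff)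

lemma pair_comm:
  assumes v: "v \<in> VV"
  shows "md A i (md B j (md X k v)) = smul (exch A X * exch B X) (md X k (md A i (md B j v)))
     + contr_pair A i B j X k v"
proof -
  have 1: "md B j (md X k v) = smul (exch B X) (md X k (md B j v)) + (if k = - j then smul (contr B X j) v else 0)"
    by (rule md_comm'[OF v])
  have 2: "md A i (md X k (md B j v)) = smul (exch A X) (md X k (md A i (md B j v))) + (if k = - i then smul (contr A X i) (md B j v) else 0)"
    by (rule md_comm'[OF md_VV[OF v]])
  show ?thesis unfolding 1 md_add md_smul 2 contr_pair_def
    by (simp add: smul_add md_smul mult.commute)
qed

lemma triple_comm:
  assumes v: "v \<in> VV"
  shows "md A i (md B j (md C l (md X k v))) =
     smul (exch A X * exch B X * exch C X) (md X k (md A i (md B j (md C l v))))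
     + contr_triple A i B j C l X k v"
proof -
  have 1: "md B j (md C l (md X k v)) = smul (exch B X * exch C X) (md X k (md B j (md C l v))) + contr_pair B j C l X k v"
    by (rule pair_comm[OF v])
  have 2: "md A i (md X k (md B j (md C l v))) = smul (exch A X) (md X k (md A i (md B j (md C l v))))
     + (if k = - i then smul (contr A X i) (md B j (md C l v)) else 0)"
    by (rule md_comm'[OF md_VV[OF md_VV[OF v]]])
  show ?thesis unfolding 1 md_add md_smul 2 contr_pair_def contr_triple_def
    by (simp add: smul_add md_smul md_add mult.commute mult.left_commute)
qed

definition contr0 :: "complex \<Rightarrow> fld \<Rightarrow> int \<Rightarrow> state \<Rightarrow> int \<Rightarrow> state" where
  "contr0 a X k v n = smul (a - of_int n) (contr_pair Cc (- n) Am n X k v) + contr_pair Et n Be (- n) X k v"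
definition contr1 :: "fld \<Rightarrow> int \<Rightarrow> state \<Rightarrow> int \<Rightarrow> int \<Rightarrow> state" where
  "contr1 X k v n m = contr_triple Cc (- n) Ap (- m) Am (n + m) X k v
     + smul (of_int (m - n) / 2) (contr_triple Cc (- n) Cc (- m) Bt (n + m) X k v)
     + smul (of_int m) (contr_triple Cc (- n) Ze (- m) Et (n + m) X k v)
     + smul (of_int m) (contr_triple Cc (- n) Be (- m) Ga (n + m) X k v)"
definition contr2 :: "complex \<Rightarrow> fld \<Rightarrow> int \<Rightarrow> state \<Rightarrow> int \<Rightarrow> state" where
  "contr2 b X k v n = smul (b + of_int n) (contr_pair Cc (- n) Ap n X k v)"

lemma term0_comm: "v \<in> VV \<Longrightarrow> term0 a n (md X k v) = smul (eps X) (md X k (term0 a n v)) + contr0 a X k v n"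
  unfolding term0_def contr0_def
  by (simp add: pair_comm[of v Cc "- n" Am n X k] pair_comm[of v Et n Be "- n" X k])
    (simp add: smul_add md_smul md_add exch_def eps_def add_ac)

lemma term2_comm: "v \<in> VV \<Longrightarrow> term2 b n (md X k v) = smul (eps X) (md X k (term2 b n v)) + contr2 b X k v n"
  unfolding term2_def contr2_def
  by (simp add: pair_comm[of v Cc "- n" Ap n X k])
    (simp add: smul_add md_smul md_add exch_def eps_def add_ac)

lemma term1_comm: "v \<in> VV \<Longrightarrow> term1 n m (md X k v) = smul (eps X) (md X k (term1 n m v)) + contr1 X k v n m"
  unfolding term1_def contr1_def
  by (simp add: triple_comm[of v Cc "- n" Ap "- m" Am "n + m" X k] triple_comm[of v Cc "- n" Cc "- m" Bt "n + m" X k]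
       triple_comm[of v Cc "- n" Ze "- m" Et "n + m" X k] triple_comm[of v Cc "- n" Be "- m" Ga "n + m" X k])
    (simp add: smul_add md_smul md_add exch_def eps_def add_ac)

text \<open>Finiteness of the family K comes for free: it is a difference of two finitely supported
  families.\<close>

lemma Sum_any_comm:
  fixes F G :: "'i \<Rightarrow> state"
  assumes f: "finite {i. F i \<noteq> 0}" "finite {i. G i \<noteq> 0}" and eq: "\<And>i. G i = smul c (md X k (F i)) + K i"
  shows "Sum_any G = smul c (md X k (Sum_any F)) + Sum_any K"
proof -
  have K: "K i = G i + - smul c (md X k (F i))" for i using eq by simp
  have fin: "finite {i. - smul c (md X k (F i)) \<noteq> 0}"
    by (rule finite_subset[OF _ f(1)]) auto
  have "Sum_any K = Sum_any G + Sum_any (\<lambda>i. - smul c (md X k (F i)))"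
    unfolding K by (rule Sum_any.distrib[OF f(2) fin])
  also have "Sum_any (\<lambda>i. - smul c (md X k (F i))) = - smul c (md X k (Sum_any F))"
    by (simp only: md_Sum_any[OF f(1)] smul_Sum_any uminus_Sum_any)
  finally show ?thesis by (metis add.commute diff_add_cancel diff_conv_add_uminus)
qed

text \<open>The graded commutator of d with X_k, written as the sum of all contractions.\<close>

definition Q_comm :: "complex \<Rightarrow> complex \<Rightarrow> fld \<Rightarrow> int \<Rightarrow> state \<Rightarrow> state" where
  "Q_comm a b X k v = Sum_any (contr0 a X k v) + Sum_any (\<lambda>(n, m). contr1 X k v n m) + Sum_any (contr2 b X k v)"

lemma Q_md: assumes v: "v \<in> VL L"
  shows "Q a b (md X k v) = smul (eps X) (md X k (Q a b v)) + Q_comm a b X k v"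
proof -
  note vv = VL_VV[OF v] and v' = md_VL[OF v, of X k]
  have 0: "Q0 a (md X k v) = smul (eps X) (md X k (Q0 a v)) + Sum_any (contr0 a X k v)"
    unfolding Q0_def by (rule Sum_any_comm[OF term0_fin[OF v] term0_fin[OF v']]) (rule term0_comm[OF vv])
  have 2: "Q2 b (md X k v) = smul (eps X) (md X k (Q2 b v)) + Sum_any (contr2 b X k v)"
    unfolding Q2_def by (rule Sum_any_comm[OF term2_fin[OF v] term2_fin[OF v']]) (rule term2_comm[OF vv])
  have 1: "Q1 (md X k v) = smul (eps X) (md X k (Q1 v)) + Sum_any (\<lambda>(n, m). contr1 X k v n m)"
    unfolding Q1_def by (rule Sum_any_comm[OF term1_fin[OF v] term1_fin[OF v']]) (auto simp: term1_comm[OF vv])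
  show ?thesis unfolding Q_def 0 1 2 Q_comm_def
    by (simp add: md_add smul_add algebra_simps)
qed

text \<open>The modes of a field of weight h satisfy [L_n, X_k] = ((h - 1) n - k) X_(n+k). For c the commutator
 is quadratic in c, whence the factor 1/2.\<close>

fun lin_coeff :: "fld \<Rightarrow> int \<Rightarrow> int \<Rightarrow> complex" where
  "lin_coeff Be n k = - of_int (n + k)" | "lin_coeff Ze n k = - of_int (n + k)"
| "lin_coeff Cc n k = of_int (- k - 2 * n) / 2" | "lin_coeff _ n k = - of_int k"

text \<open>The contribution of the quadratic parts of d: the momentum factors of d_0 and d_2 send
  the alphas to c, and d_0 sends zeta to beta and gamma to -eta. The field b is treated in
  \<open>Q_comm_Bt\<close>.\<close>

fun inhom :: "complex \<Rightarrow> complex \<Rightarrow> fld \<Rightarrow> int \<Rightarrow> state \<Rightarrow> state" where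
  "inhom a b Ap k v = smul (- of_int k * (a + of_int k)) (md Cc k v)"
| "inhom a b Am k v = smul (- of_int k * (b - of_int k)) (md Cc k v)"
| "inhom a b Ze k v = md Be k v"
| "inhom a b Ga k v = - md Et k v"
| "inhom a b _ k v = 0"

definition lin :: "fld \<Rightarrow> int \<Rightarrow> state \<Rightarrow> state" where
  "lin X k v = Sum_any (\<lambda>n. smul (lin_coeff X n k) (md Cc (- n) (md X (n + k) v)))"

lemma contr_simps [simp]:
  "contr Ap Y k = (if Y = Am then of_int k else 0)" "contr Am Y k = (if Y = Ap then of_int k else 0)"
  "contr Be Y k = (if Y = Ga \<and> k \<noteq> 0 then -1 else 0)" "contr Ga Y k = (if Y = Be \<and> k \<noteq> 0 then 1 else 0)"
  "contr Bt Y k = (if Y = Cc \<and> k \<noteq> 0 then 1 else 0)" "contr Cc Y k = (if Y = Bt \<and> k \<noteq> 0 then 1 else 0)"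
  "contr Ze Y k = (if Y = Et \<and> k \<noteq> 0 then 1 else 0)" "contr Et Y k = (if Y = Ze \<and> k \<noteq> 0 then 1 else 0)"
  by (auto simp: contr_def)

lemma Q_comm_zero: "v \<in> VV \<Longrightarrow> v \<in> VL L \<Longrightarrow> Q_comm a b X 0 v = 0"
  using Q_md[of v L a b X 0] by (simp add: md_zero_mode[OF VL_VV[OF Q_VL]] md_zero_mode)

text \<open>A mode of index 0 has zero commutator. For most fields the coefficient -k agrees with
  this at k = 0, but for beta, zeta and c the formula would leave n-dependent terms, so there k = 0
  is excluded.\<close>

lemma contr1_eq:
  assumes v: "v \<in> VV" and k: "k \<noteq> 0 \<or> X \<notin> {Be, Ze, Cc}" and X: "X \<noteq> Bt"
  shows "contr1 X k v n m = (if m = (if X \<in> {Am, Et, Ga} then k else - k - n)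
     then smul (lin_coeff X n k) (md Cc (- n) (md X (n + k) v)) else 0)"
proof -
  note z = md_zero_mode[OF v] md_zero_mode[OF md_VV[OF v]]
  have e: "k = - n - m \<longleftrightarrow> m = - k - n" "k = m \<longleftrightarrow> m = k" by auto
  show ?thesis
    using X k by (cases X; simp add: contr1_def contr_triple_def exch_def e; auto simp: z algebra_simps)
qed

lemma Q_comm_eq:
  assumes v: "v \<in> VL L" and k: "k \<noteq> 0 \<or> X \<notin> {Be, Ze, Cc}" and X: "X \<noteq> Bt"
  shows "Q_comm a b X k v = lin X k v + inhom a b X k v"
proof -
  note z = md_zero_mode[OF VL_VV[OF v]]
  have 1: "Sum_any (\<lambda>(n, m). contr1 X k v n m) = lin X k v"
    unfolding contr1_eq[OF VL_VV[OF v] k X] lin_def by (subst Sum_any_graph) simp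
  have 0: "Sum_any (contr0 a X k v) = (case X of Ap \<Rightarrow> inhom a b Ap k v | Ze \<Rightarrow> inhom a b Ze k v | Ga \<Rightarrow> inhom a b Ga k v | _ \<Rightarrow> 0)"
  proof -
    have "contr0 a X k v n = (if n = (if X = Ga then k else - k) then
       (case X of Ap \<Rightarrow> inhom a b Ap k v | Ze \<Rightarrow> inhom a b Ze k v | Ga \<Rightarrow> inhom a b Ga k v | _ \<Rightarrow> 0) else 0)" for n
    proof -
      have e: "k = n \<longleftrightarrow> n = k" "k = - n \<longleftrightarrow> n = - k" by auto
      show ?thesis using X by (cases X; simp add: contr0_def contr_pair_def exch_def e; auto simp: z algebra_simps)
    qed
    then show ?thesis by simp
  qed
  have 2: "Sum_any (contr2 b X k v) = (case X of Am \<Rightarrow> inhom a b Am k v | _ \<Rightarrow> 0)"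
  proof -
    have "contr2 b X k v n = (if n = - k then (case X of Am \<Rightarrow> inhom a b Am k v | _ \<Rightarrow> 0) else 0)" for n
    proof -
      have e: "k = n \<longleftrightarrow> n = k" "k = - n \<longleftrightarrow> n = - k" by auto
      show ?thesis using X by (cases X; simp add: contr2_def contr_pair_def exch_def e; auto simp: z algebra_simps)
    qed
    then show ?thesis by simp
  qed
  show ?thesis unfolding Q_comm_def 0 1 2 using X by (cases X) simp_all
qed

subsection \<open>Squares of the commutators\<close>

text \<open>For every field except b the double commutator with d involves only reorderings of
 anticommuting or commuting modes, so no central term appears. \<open>cc_op\<close> is the coefficient of b_0 in the BRST
 operator with ghost zero modes.\<close>

definition cc_op :: "state \<Rightarrow> state" where
  "cc_op v = Sum_any (\<lambda>n. smul (of_int n) (md Cc (- n) (md Cc n v)))"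

text \<open>A uniform bound on the support of a double family; it justifies iterating and reindexing
  double sums.\<close>

definition box :: "int \<Rightarrow> (int \<Rightarrow> int \<Rightarrow> state) \<Rightarrow> bool" where
  "box B F \<longleftrightarrow> (\<forall>i j. F i j \<noteq> 0 \<longrightarrow> i \<in> {-B..B} \<and> j \<in> {-B..B})"

lemma box_fin: assumes "box B F" shows "finite {x. (\<lambda>(i, j). F i j) x \<noteq> 0}"
proof (rule finite_subset)
  show "{x. (\<lambda>(i, j). F i j) x \<noteq> 0} \<subseteq> {-B..B} \<times> {-B..B}"
    using assms unfolding box_def by auto
qed simp

lemma box_fin2: assumes "box B F" shows "finite {i. Sum_any (F i) \<noteq> 0}"
proof (rule finite_subset)
  show "{i. Sum_any (F i) \<noteq> 0} \<subseteq> {-B..B}"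
  proof
    fix i assume "i \<in> {i. Sum_any (F i) \<noteq> 0}"
    then obtain j where "F i j \<noteq> 0" by (auto elim: Sum_any.not_neutral_obtains_not_neutral)
    then show "i \<in> {-B..B}" using assms unfolding box_def by blast
  qed
qed simp

lemma box_nested: assumes "box B F"
  shows "Sum_any (\<lambda>n. Sum_any (F n)) = Sum_any (\<lambda>(n, m). F n m)"
proof (rule Sum_any.cartesian_product)
  show "{a. \<exists>b. F a b \<noteq> 0} \<times> {b. \<exists>a. F a b \<noteq> 0} \<subseteq> {-B..B} \<times> {-B..B}"
    using assms unfolding box_def by blast
qed simp

lemma box_smul: "box B F \<Longrightarrow> box B (\<lambda>i j. smul (c i j) (F i j))"
  by (auto simp: box_def)

text \<open>The product c_(-i) c_(-j) is antisymmetric, so symmetric coefficients cancel. This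
  reduces double commutators to identities between coefficients.\<close>

lemma antisym_Sum_any:
  fixes F :: "int \<Rightarrow> int \<Rightarrow> state"
  assumes anti: "\<And>i j. F j i = - F i j" and g: "\<And>i j. g i j = g j i"
  shows "Sum_any (\<lambda>(i, j). smul (g i j) (F i j)) = 0"
proof -
  let ?S = "Sum_any (\<lambda>(i, j). smul (g i j) (F i j))"
  have "?S = Sum_any (\<lambda>(i, j). smul (g j i) (F j i))"
    by (rule Sum_any.reindex_cong[of prod.swap]) (auto simp: fun_eq_iff)
  also have "(\<lambda>(i, j). smul (g j i) (F j i)) = (\<lambda>x. - (\<lambda>(i, j). smul (g i j) (F i j)) x)"
  proof (rule ext)
    fix x :: "int \<times> int"
    obtain i j where x: "x = (i, j)" by (cases x)
    have "smul (g j i) (F j i) = - smul (g i j) (F i j)"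
      by (subst g[of j i], subst anti[of j i]) (rule vs.scale_minus_right)
    then show "(\<lambda>(i, j). smul (g j i) (F j i)) x = - (\<lambda>(i, j). smul (g i j) (F i j)) x"
      by (simp add: x)
  qed
  also have "Sum_any \<dots> = - ?S" by (rule uminus_Sum_any[symmetric])
  finally have "?S = - ?S" .
  then show ?thesis by (auto simp: fun_eq_iff)
qed

text \<open>The common shape of the cubic terms in a double commutator of d with X_k.\<close>

definition cc_mode :: "fld \<Rightarrow> int \<Rightarrow> state \<Rightarrow> int \<Rightarrow> int \<Rightarrow> state" where
  "cc_mode X k v i j = md Cc (- i) (md Cc (- j) (md X (i + j + k) v))"

lemma cc_mode_supp: assumes v: "v \<in> VL L" and X: "X \<noteq> Bt" and "cc_mode X k v i j \<noteq> 0"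
  shows "- i \<le> L \<and> - j \<le> L \<and> i + j + k \<le> L"
proof (rule ccontr)
  assume n: "\<not> ?thesis"
  have vv: "v \<in> VV" by (rule VL_VV[OF v])
  have 1: "md Cc (- j) (md X (i + j + k) v) = 0" if "- j > L \<or> i + j + k > L"
    using that X by (intro pair_kill[OF v]) auto
  have 2: "md Cc (- i) (md X (i + j + k) v) = 0" if "- i > L"
    using that X by (intro pair_kill[OF v]) auto
  have "cc_mode X k v i j = smul (exch Cc Cc) (md Cc (- j) (md Cc (- i) (md X (i + j + k) v)))"
    unfolding cc_mode_def by (rule pair_swap[OF md_VV[OF vv]]) simp
  then have "cc_mode X k v i j = 0" if "- i > L" using 2 that by simp
  moreover have "cc_mode X k v i j = 0" if "- j > L \<or> i + j + k > L" using 1 that by (simp add: cc_mode_def)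
  ultimately show False using n assms(3) by auto
qed

lemma cc_mode_box: assumes "v \<in> VL L" "X \<noteq> Bt" shows "box (3 * \<bar>L\<bar> + \<bar>k\<bar>) (cc_mode X k v)"
proof -
  have "i \<in> {- (3 * \<bar>L\<bar> + \<bar>k\<bar>)..3 * \<bar>L\<bar> + \<bar>k\<bar>} \<and> j \<in> {- (3 * \<bar>L\<bar> + \<bar>k\<bar>)..3 * \<bar>L\<bar> + \<bar>k\<bar>}"
    if "cc_mode X k v i j \<noteq> 0" for i j
    using cc_mode_supp[OF assms that] by auto
  then show ?thesis unfolding box_def by blast
qed

lemma cc_mode_anti: assumes "v \<in> VV" shows "cc_mode X k v j i = - cc_mode X k v i j"
proof -
  have "cc_mode X k v j i = smul (exch Cc Cc) (md Cc (- i) (md Cc (- j) (md X (j + i + k) v)))"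
    unfolding cc_mode_def by (rule pair_swap[OF md_VV[OF assms]]) simp
  then show ?thesis by (simp add: cc_mode_def exch_def add.commute)
qed

lemma cc_mode_box': assumes "v \<in> VL L" "X \<noteq> Bt"
  shows "box (6 * \<bar>L\<bar> + 2 * \<bar>k\<bar>) (\<lambda>n m. cc_mode X k v m (n - m))"
proof -
  have "n \<in> {- (6 * \<bar>L\<bar> + 2 * \<bar>k\<bar>)..6 * \<bar>L\<bar> + 2 * \<bar>k\<bar>} \<and> m \<in> {- (6 * \<bar>L\<bar> + 2 * \<bar>k\<bar>)..6 * \<bar>L\<bar> + 2 * \<bar>k\<bar>}"
    if "cc_mode X k v m (n - m) \<noteq> 0" for n m
    using cc_mode_supp[OF assms that] by auto
  then show ?thesis unfolding box_def by blast
qed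

lemma lin_Cc: "lin Cc (- n) (md X (n + k) v) = Sum_any (\<lambda>m. smul (of_int (n - 2 * m) / 2) (cc_mode X k v m (n - m)))"
  by (simp add: lin_def cc_mode_def add.commute)

lemma lin_fin: assumes v: "v \<in> VL L" and X: "X \<noteq> Bt"
  shows "finite {n. smul (c n) (md Cc (- n) (md X (n + k) v)) \<noteq> 0}"
proof (rule finite_subset)
  show "{n. smul (c n) (md Cc (- n) (md X (n + k) v)) \<noteq> 0} \<subseteq> {- L..L - k}"
  proof
    fix n assume "n \<in> {n. smul (c n) (md Cc (- n) (md X (n + k) v)) \<noteq> 0}"
    then have "md Cc (- n) (md X (n + k) v) \<noteq> 0" by auto
    then have "\<not> (- n > L \<or> n + k > L)" using pair_kill[OF v, of Cc X "- n" "n + k"] X by auto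
    then show "n \<in> {- L..L - k}" by auto
  qed
qed simp

definition dc_terms :: "complex \<Rightarrow> complex \<Rightarrow> fld \<Rightarrow> int \<Rightarrow> state \<Rightarrow> int \<Rightarrow> state" where
  "dc_terms a b X k v n = smul (lin_coeff X n k) (Q_comm a b Cc (- n) (md X (n + k) v))"

lemma cc_op_md_shift: assumes v: "v \<in> VL L"
  shows "Sum_any (\<lambda>m. smul (lin_coeff X 0 k * (of_int (0 - 2 * m) / 2)) (cc_mode X k v m (0 - m))) = - smul (lin_coeff X 0 k) (cc_op (md X k v))"
proof -
  have "- smul (lin_coeff X 0 k) (cc_op (md X k v)) = smul (- lin_coeff X 0 k) (cc_op (md X k v))" by simp
  also have "\<dots> = Sum_any (\<lambda>m. smul (lin_coeff X 0 k * (of_int (0 - 2 * m) / 2)) (cc_mode X k v m (0 - m)))"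
    unfolding cc_op_def smul_Sum_any by (rule Sum_any.cong) (simp add: cc_mode_def)
  finally show ?thesis by simp
qed

text \<open>This is where M originates. At n = 0 the commutator of d with c is zero, since c_0 is
  absent, whereas the formula \<open>lin\<close> for c would give minus \<open>cc_op\<close>.
  Filling in this value completes the double sum, and the correction is the term with
  \<open>cc_op\<close>.\<close>

lemma dc_terms_sum:
  assumes v: "v \<in> VL L" and X: "X \<noteq> Bt"
  shows "finite {n. dc_terms a b X k v n \<noteq> 0}"
    and "Sum_any (dc_terms a b X k v) =
      Sum_any (\<lambda>(i, j). smul (lin_coeff X (i + j) k * (of_int (j - i) / 2)) (cc_mode X k v i j)) + smul (lin_coeff X 0 k) (cc_op (md X k v))"
proof -
  define F where "F n m = smul (lin_coeff X n k * (of_int (n - 2 * m) / 2)) (cc_mode X k v m (n - m))" for n m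
  have bF: "box (6 * \<bar>L\<bar> + 2 * \<bar>k\<bar>) F"
    unfolding F_def by (rule box_smul[OF cc_mode_box'[OF v X]])
  have U: "dc_terms a b X k v n = Sum_any (F n) + (if n = 0 then smul (lin_coeff X 0 k) (cc_op (md X k v)) else 0)" for n
  proof (cases "n = 0")
    case True
    have "Q_comm a b Cc 0 (md X k v) = 0"
      using v by (intro Q_comm_zero[of _ "L - k"] md_VV VL_VV[OF v] md_VL[OF v])
    moreover have "Sum_any (F 0) = - smul (lin_coeff X 0 k) (cc_op (md X k v))"
      unfolding F_def by (rule cc_op_md_shift[OF v])
    ultimately show ?thesis using True by (simp add: dc_terms_def)
  next
    case False
    have "Q_comm a b Cc (- n) (md X (n + k) v) = lin Cc (- n) (md X (n + k) v) + inhom a b Cc (- n) (md X (n + k) v)"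
      using False by (intro Q_comm_eq[OF md_VL[OF v]]) auto
    then show ?thesis using False
      by (simp add: dc_terms_def lin_Cc smul_Sum_any F_def)
  qed
  have f1: "finite {n. Sum_any (F n) \<noteq> 0}" by (rule box_fin2[OF bF])
  have f2: "finite {n::int. (if n = 0 then smul (lin_coeff X 0 k) (cc_op (md X k v)) else 0) \<noteq> 0}"
    by (rule finite_subset[of _ "{0::int}"]) auto
  show "finite {n. dc_terms a b X k v n \<noteq> 0}"
    unfolding U by (rule finite_subset[OF _ finite_UnI[OF f1 f2]]) auto
  have "Sum_any (dc_terms a b X k v) = Sum_any (\<lambda>n. Sum_any (F n)) + smul (lin_coeff X 0 k) (cc_op (md X k v))"
    unfolding U[abs_def] by (subst Sum_any.distrib[OF f1 f2]) simp
  also have "Sum_any (\<lambda>n. Sum_any (F n)) = Sum_any (\<lambda>(n, m). F n m)"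
    by (rule box_nested[OF bF])
  also have "\<dots> = Sum_any (\<lambda>(i, j). smul (lin_coeff X (i + j) k * (of_int (j - i) / 2)) (cc_mode X k v i j))"
  proof (rule Sum_any.reindex_cong[of "\<lambda>(i, j). (i + j, i)"])
    show "bij (\<lambda>(i, j). (i + j, i :: int))"
      by (rule bij_betw_byWitness[where f' = "\<lambda>(n, m). (m, n - m)"]) auto
  qed (auto simp: F_def fun_eq_iff)
  finally show "Sum_any (dc_terms a b X k v) =
      Sum_any (\<lambda>(i, j). smul (lin_coeff X (i + j) k * (of_int (j - i) / 2)) (cc_mode X k v i j)) + smul (lin_coeff X 0 k) (cc_op (md X k v))" .
qed

definition dX_terms :: "complex \<Rightarrow> complex \<Rightarrow> fld \<Rightarrow> int \<Rightarrow> state \<Rightarrow> int \<Rightarrow> state" where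
  "dX_terms a b X k v n = smul (lin_coeff X n k) (md Cc (- n) (Q_comm a b X (n + k) v))"

lemma Q_lin:
  assumes v: "v \<in> VL L" and X: "X \<noteq> Bt"
  shows "finite {n. dX_terms a b X k v n \<noteq> 0}"
    and "Q a b (lin X k v) = - smul (eps X) (lin X k (Q a b v)) + Sum_any (dc_terms a b X k v) - Sum_any (dX_terms a b X k v)"
proof -
  let ?S = "\<lambda>n. smul (lin_coeff X n k) (md Cc (- n) (md X (n + k) v))"
  let ?T = "\<lambda>n. smul (- eps X) (smul (lin_coeff X n k) (md Cc (- n) (md X (n + k) (Q a b v))))"
  have S: "?S n \<in> VL (L - k)" for n
    using VL_smul[OF md_VL[OF md_VL[OF v, of X "n + k"], of Cc "- n"], of "lin_coeff X n k"] by simp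
  have fS: "finite {n. ?S n \<noteq> 0}" by (rule lin_fin[OF v X])
  have fD: "finite {n. Q a b (?S n) \<noteq> 0}"
    by (rule finite_subset[OF _ fS]) auto
  have fT: "finite {n. ?T n \<noteq> 0}"
    by (rule finite_subset[OF _ lin_fin[OF Q_VL[OF v] X, of "\<lambda>n. lin_coeff X n k" k a b]]) auto
  have eq: "Q a b (?S n) = ?T n + dc_terms a b X k v n - dX_terms a b X k v n" for n
  proof -
    have "Q a b (?S n) = smul (lin_coeff X n k) (smul (eps Cc) (md Cc (- n) (Q a b (md X (n + k) v))) + Q_comm a b Cc (- n) (md X (n + k) v))"
      by (simp only: Q_smul Q_md[OF md_VL[OF v]])
    also have "Q a b (md X (n + k) v) = smul (eps X) (md X (n + k) (Q a b v)) + Q_comm a b X (n + k) v"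
      by (rule Q_md[OF v])
    finally have E: "Q a b (?S n) = smul (lin_coeff X n k) (smul (eps Cc) (md Cc (- n) (smul (eps X) (md X (n + k) (Q a b v)) + Q_comm a b X (n + k) v)) + Q_comm a b Cc (- n) (md X (n + k) v))" .
    show ?thesis unfolding E
      by (simp add: dc_terms_def dX_terms_def md_add md_smul smul_add vs.scale_right_diff_distrib mult.commute)
  qed
  have W: "dX_terms a b X k v n = ?T n + dc_terms a b X k v n + - Q a b (?S n)" for n
    unfolding eq by simp
  have fU: "finite {n. dc_terms a b X k v n \<noteq> 0}" by (rule dc_terms_sum(1)[OF v X])
  have fTU: "finite {n. ?T n + dc_terms a b X k v n \<noteq> 0}"
    by (rule finite_subset[OF _ finite_UnI[OF fT fU]]) auto
  have fmD: "finite {n. - Q a b (?S n) \<noteq> 0}" using fD by simp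
  show "finite {n. dX_terms a b X k v n \<noteq> 0}"
    unfolding W by (rule finite_subset[OF _ finite_UnI[OF fTU fmD]]) auto
  have "Sum_any (dX_terms a b X k v) = Sum_any ?T + Sum_any (dc_terms a b X k v) + - Sum_any (\<lambda>n. Q a b (?S n))"
    unfolding W[abs_def] by (simp only: Sum_any.distrib[OF fTU fmD] Sum_any.distrib[OF fT fU] uminus_Sum_any)
  also have "Sum_any (\<lambda>n. Q a b (?S n)) = Q a b (lin X k v)"
    unfolding lin_def by (rule Q_Sum_any[OF fS S, symmetric])
  also have "Sum_any ?T = - smul (eps X) (lin X k (Q a b v))"
    unfolding lin_def smul_Sum_any[symmetric] by simp
  finally show "Q a b (lin X k v) = - smul (eps X) (lin X k (Q a b v)) + Sum_any (dc_terms a b X k v) - Sum_any (dX_terms a b X k v)"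
    by (simp only: diff_conv_add_uminus) (metis add.commute add_diff_cancel_left' diff_conv_add_uminus minus_diff_eq)
qed

lemma antisym_Sum_any1:
  fixes T :: "int \<Rightarrow> state"
  assumes anti: "\<And>n. T (- n - k) = - T n" and g: "\<And>n. g (- n - k) = g n"
  shows "Sum_any (\<lambda>n. smul (g n) (T n)) = 0"
proof -
  let ?S = "Sum_any (\<lambda>n. smul (g n) (T n))"
  have "?S = Sum_any (\<lambda>n. smul (g (- n - k)) (T (- n - k)))"
    by (rule Sum_any.reindex_cong[of "\<lambda>n. - n - k"])
      (auto simp: fun_eq_iff intro!: bij_betw_byWitness[where f' = "\<lambda>n. - n - k"])
  also have "\<dots> = Sum_any (\<lambda>n. - smul (g n) (T n))"
    unfolding anti g by simp
  also have "\<dots> = - ?S" by (rule uminus_Sum_any[symmetric])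
  finally have "?S = - ?S" .
  then show ?thesis by (auto simp: fun_eq_iff)
qed

lemma Sum_any_lin_comb:
  assumes "finite {x. T x \<noteq> 0}"
  shows "Sum_any (\<lambda>x. smul (g x) (T x)) - Sum_any (\<lambda>x. smul (h x) (T x)) = Sum_any (\<lambda>x. smul (g x - h x) (T x))"
    and "Sum_any (\<lambda>x. smul (g x) (T x)) + Sum_any (\<lambda>x. smul (h x) (T x)) = Sum_any (\<lambda>x. smul (g x + h x) (T x))"
proof -
  have f: "finite {x. smul (c x) (T x) \<noteq> 0}" for c
    by (rule finite_subset[OF _ assms]) auto
  show p: "Sum_any (\<lambda>x. smul (g x) (T x)) + Sum_any (\<lambda>x. smul (h x) (T x)) = Sum_any (\<lambda>x. smul (g x + h x) (T x))" for g h
    by (simp only: vs.scale_left_distrib Sum_any.distrib[OF f f])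
  have "Sum_any (\<lambda>x. smul (g x - h x) (T x)) + Sum_any (\<lambda>x. smul (h x) (T x)) = Sum_any (\<lambda>x. smul (g x) (T x))"
    unfolding p by simp
  then show "Sum_any (\<lambda>x. smul (g x) (T x)) - Sum_any (\<lambda>x. smul (h x) (T x)) = Sum_any (\<lambda>x. smul (g x - h x) (T x))"
    by (metis add_diff_cancel_right')
qed

definition inhom_terms :: "complex \<Rightarrow> complex \<Rightarrow> fld \<Rightarrow> int \<Rightarrow> state \<Rightarrow> int \<Rightarrow> state" where
  "inhom_terms a b X k v n = smul (lin_coeff X n k) (md Cc (- n) (inhom a b X (n + k) v))"

lemma cc_anti: "v \<in> VV \<Longrightarrow> md Cc i (md Cc j v) = - md Cc j (md Cc i v)"
  using pair_swap[of v Cc Cc i j] by (simp add: exch_def)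

lemma cc_fin:  "v \<in> VL L \<Longrightarrow> finite {n. md Cc (- n) (md Cc (n + k) v) \<noteq> 0}"
  using lin_fin[of v L Cc "\<lambda>_. 1" k] by simp

text \<open>The reflection n -> -n - k exchanges the two c modes and flips the sign of their
  product. The hypothesis says that the difference of the two coefficient families is invariant
  under it, so the difference of the sums vanishes.\<close>

lemma inhom_quad:
  assumes v: "v \<in> VL L" 
    and c: "\<And>n. - of_int k * c0 (n + k) - c0 k * (of_int (- k - 2 * n) / 2)
      = - of_int k * c0 (- n) + c0 k * (of_int (- k - 2 * n) / 2)"
  shows "Sum_any (\<lambda>n. smul (- of_int k) (md Cc (- n) (smul (c0 (n + k)) (md Cc (n + k) v)))) = smul (c0 k) (lin Cc k v)"
proof -
  let ?T = "\<lambda>n. md Cc (- n) (md Cc (n + k) v)"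
  have f: "finite {n. ?T n \<noteq> 0}" by (rule cc_fin[OF v])
  have "Sum_any (\<lambda>n. smul (- of_int k * c0 (n + k)) (?T n)) - Sum_any (\<lambda>n. smul (c0 k * (of_int (- k - 2 * n) / 2)) (?T n))
    = Sum_any (\<lambda>n. smul (- of_int k * c0 (n + k) - c0 k * (of_int (- k - 2 * n) / 2)) (?T n))"
    by (rule Sum_any_lin_comb(1)[OF f])
  also have "\<dots> = 0"
  proof (rule antisym_Sum_any1[of _ k])
    fix n
    have "md Cc (- (- n - k)) (md Cc (- n - k + k) v) = md Cc (n + k) (md Cc (- n) v)" by (simp add: add.commute)
    also have "\<dots> = - ?T n" by (rule cc_anti[OF VL_VV[OF v]])
    finally show "?T (- n - k) = - ?T n" .
    have "- n - k + k = - n" and "- k - 2 * (- n - k) = - (- k - 2 * n)" by simp_all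
    then show "- of_int k * c0 (- n - k + k) - c0 k * (of_int (- k - 2 * (- n - k)) / 2) =
         - of_int k * c0 (n + k) - c0 k * (of_int (- k - 2 * n) / 2)"
      using c[of n] by (simp only: of_int_minus) (simp add: algebra_simps)
  qed
  finally have "Sum_any (\<lambda>n. smul (- of_int k * c0 (n + k)) (?T n)) = Sum_any (\<lambda>n. smul (c0 k * (of_int (- k - 2 * n) / 2)) (?T n))"
    by (simp only: right_minus_eq)
  then show ?thesis by (simp add: lin_def smul_Sum_any md_smul)
qed

lemma inhom_terms_sum:
  assumes v: "v \<in> VL L" and X: "X \<noteq> Bt" "X \<noteq> Cc" and k: "k \<noteq> 0"
  shows "finite {n. inhom_terms a b X k v n \<noteq> 0}"
    and "Q a b (inhom a b X k v) + smul (eps X) (inhom a b X k (Q a b v)) = Sum_any (inhom_terms a b X k v)"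
proof -
  have fin: "finite {n. smul (c n) (md Cc (- n) (md Y (n + k) v)) \<noteq> 0}" if "Y \<noteq> Bt" for Y c
    by (rule lin_fin[OF v that])
  have Dc: "Q a b (smul c (md Cc k v)) + smul c (md Cc k (Q a b v)) = smul c (lin Cc k v)" for c
  proof -
    have E: "Q a b (smul c (md Cc k v)) = smul c (smul (eps Cc) (md Cc k (Q a b v)) + Q_comm a b Cc k v)"
      by (simp only: Q_smul Q_md[OF v])
    show ?thesis unfolding E using k by (simp add: smul_add vs.scale_right_diff_distrib Q_comm_eq[OF v])
  qed
  have "finite {n. inhom_terms a b X k v n \<noteq> 0} \<and>
    Q a b (inhom a b X k v) + smul (eps X) (inhom a b X k (Q a b v)) = Sum_any (inhom_terms a b X k v)"
  proof (cases X)
    case Ap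
    have e: "inhom_terms a b X k v = (\<lambda>n. smul (- of_int k) (md Cc (- n) (smul (- of_int (n + k) * (a + of_int (n + k))) (md Cc (n + k) v))))"
      by (simp add: inhom_terms_def Ap fun_eq_iff)
    have "finite {n. inhom_terms a b X k v n \<noteq> 0}"
      unfolding e md_smul vs.scale_scale by (rule fin) simp
    moreover have "Sum_any (inhom_terms a b X k v) = smul (- of_int k * (a + of_int k)) (lin Cc k v)"
      unfolding e by (rule inhom_quad[OF v, of k "\<lambda>j. - of_int j * (a + of_int j)"]) (simp add: field_simps)
    ultimately show ?thesis using Dc[of "- of_int k * (a + of_int k)"] by (simp add: Ap)
  next
    case Am
    have e: "inhom_terms a b X k v = (\<lambda>n. smul (- of_int k) (md Cc (- n) (smul (- of_int (n + k) * (b - of_int (n + k))) (md Cc (n + k) v))))"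
      by (simp add: inhom_terms_def Am fun_eq_iff)
    have "finite {n. inhom_terms a b X k v n \<noteq> 0}"
      unfolding e md_smul vs.scale_scale by (rule fin) simp
    moreover have "Sum_any (inhom_terms a b X k v) = smul (- of_int k * (b - of_int k)) (lin Cc k v)"
      unfolding e by (rule inhom_quad[OF v, of k "\<lambda>j. - of_int j * (b - of_int j)"]) (simp add: field_simps)
    ultimately show ?thesis using Dc[of "- of_int k * (b - of_int k)"] by (simp add: Am)
  next
    case Ze
    have e: "inhom_terms a b X k v = (\<lambda>n. smul (lin_coeff Be n k) (md Cc (- n) (md Be (n + k) v)))"
      by (simp add: inhom_terms_def Ze fun_eq_iff)
    have "finite {n. inhom_terms a b X k v n \<noteq> 0}" unfolding e by (rule fin) simp
    moreover have "Sum_any (inhom_terms a b X k v) = lin Be k v" by (simp only: e lin_def)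
    moreover have "Q a b (md Be k v) = md Be k (Q a b v) + lin Be k v"
      using Q_md[OF v, of a b Be k] Q_comm_eq[OF v, of k Be a b] k by simp
    ultimately show ?thesis by (simp add: Ze)
  next
    case Ga
    have e: "inhom_terms a b X k v = (\<lambda>n. smul (- lin_coeff Et n k) (md Cc (- n) (md Et (n + k) v)))"
      by (simp add: inhom_terms_def Ga fun_eq_iff md_uminus)
    have "finite {n. inhom_terms a b X k v n \<noteq> 0}" unfolding e by (rule fin) simp
    moreover have "Sum_any (inhom_terms a b X k v) = - lin Et k v" by (simp only: e lin_def uminus_Sum_any vs.scale_minus_left)
    moreover have "Q a b (md Et k v) = - md Et k (Q a b v) + lin Et k v"
      using Q_md[OF v, of a b Et k] Q_comm_eq[OF v, of k Et a b] k by simp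
    ultimately show ?thesis by (simp add: Ga Q_uminus)
  qed (use X in \<open>simp_all add: inhom_terms_def\<close>)
  then show "finite {n. inhom_terms a b X k v n \<noteq> 0}"
    and "Q a b (inhom a b X k v) + smul (eps X) (inhom a b X k (Q a b v)) = Sum_any (inhom_terms a b X k v)" by blast+
qed

lemma dX_terms_sum:
  assumes v: "v \<in> VL L" and X: "X \<noteq> Bt" "X \<noteq> Cc" and k: "k \<noteq> 0"
  shows "Sum_any (dX_terms a b X k v) = Sum_any (\<lambda>(i, j). smul (lin_coeff X i k * lin_coeff X j (i + k)) (cc_mode X k v i j)) + Sum_any (inhom_terms a b X k v)"
proof -
  define F where "F i j = smul (lin_coeff X i k * lin_coeff X j (i + k)) (cc_mode X k v i j)" for i j
  have bF: "box (3 * \<bar>L\<bar> + \<bar>k\<bar>) F"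
    unfolding F_def by (rule box_smul[OF cc_mode_box[OF v X(1)]])
  have l: "smul (lin_coeff X n k) (md Cc (- n) (lin X (n + k) v)) = Sum_any (F n)" for n
  proof -
    have e: "m + (n + k) = n + m + k" for m by simp
    have "md Cc (- n) (lin X (n + k) v) = Sum_any (\<lambda>m. md Cc (- n) (smul (lin_coeff X m (n + k)) (md Cc (- m) (md X (n + m + k) v))))"
      unfolding lin_def e[symmetric] by (rule md_Sum_any[OF lin_fin[OF v X(1)]])
    then show ?thesis
      by (simp only: smul_Sum_any) (rule Sum_any.cong, simp add: F_def md_smul cc_mode_def)
  qed
  have W: "dX_terms a b X k v n = Sum_any (F n) + inhom_terms a b X k v n" for n
  proof (cases "n + k = 0 \<and> X \<in> {Be, Ze}")
    case True
    then have "lin_coeff X n k = 0" by auto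
    then show ?thesis by (simp add: dX_terms_def inhom_terms_def F_def)
  next
    case False
    then have "Q_comm a b X (n + k) v = lin X (n + k) v + inhom a b X (n + k) v"
      using X by (intro Q_comm_eq[OF v]) auto
    then show ?thesis unfolding dX_terms_def inhom_terms_def l[symmetric] by (simp only: md_add smul_add)
  qed
  show ?thesis unfolding W[abs_def] 
    by (subst Sum_any.distrib[OF box_fin2[OF bF] inhom_terms_sum(1)[OF v X k]]) (simp only: box_nested[OF bF], simp only: F_def)
qed

lemma abelian_shuffle: "A = - e + u - w \<Longrightarrow> w = t + i \<Longrightarrow> u = s + m \<Longrightarrow> s - t = 0 \<Longrightarrow> J + ei = i \<Longrightarrow>
   (A + J) + (e + ei) = m" for A :: "'a::ab_group_add"
  by (simp add: algebra_simps)

lemma VL_uminus: "v \<in> VL L \<Longrightarrow> - v \<in> VL L"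
  using VL_smul[of v L "-1"] by simp

text \<open>The inhomogeneous parts cancel, the cubic terms cancel by antisymmetry in the two c
  modes, and only the correction for the absent c_0 remains.\<close>

lemma Q_comm_sq:
  assumes v: "v \<in> VL L" and X: "X \<noteq> Bt" "X \<noteq> Cc"
  shows "Q a b (Q_comm a b X k v) + smul (eps X) (Q_comm a b X k (Q a b v)) = - smul (of_int k) (cc_op (md X k v))"
proof (cases "k = 0")
  case True
  have "cc_op 0 = 0" by (simp add: cc_op_def)
  then show ?thesis using True v
    by (simp add: Q_comm_zero[OF VL_VV[OF v] v] Q_comm_zero[OF VL_VV[OF Q_VL[OF v]] Q_VL[OF v]] md_zero_mode[OF VL_VV[OF v]])
next
  case k: False
  have d: "Q_comm a b X k w = lin X k w + inhom a b X k w" if "w \<in> VL L" for w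
    using k X by (intro Q_comm_eq[OF that]) auto
  have VLi: "lin X k v \<in> VL (L - k)"
  proof -
    have "smul (lin_coeff X n k) (md Cc (- n) (md X (n + k) v)) \<in> VL (L - k)" for n
      using VL_smul[OF md_VL[OF md_VL[OF v, of X "n + k"], of Cc "- n"], of "lin_coeff X n k"] by simp
    then show ?thesis unfolding lin_def by (rule Sum_any_VL)
  qed
  have VIn: "inhom a b X k v \<in> VL (L - k)"
    using X by (cases X) (auto intro!: VL_uminus VL_smul md_VL[OF v])
  let ?g = "\<lambda>i j. lin_coeff X (i + j) k * (of_int (j - i) / 2)" and ?h = "\<lambda>i j. lin_coeff X i k * lin_coeff X j (i + k)"
  have "Sum_any (\<lambda>(i, j). smul (?g i j) (cc_mode X k v i j)) - Sum_any (\<lambda>(i, j). smul (?h i j) (cc_mode X k v i j))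
    = Sum_any (\<lambda>(i, j). smul (?g i j - ?h i j) (cc_mode X k v i j))"
    using Sum_any_lin_comb(1)[OF box_fin[OF cc_mode_box[OF v X(1)]], of "\<lambda>(i, j). ?g i j" k "\<lambda>(i, j). ?h i j"]
    by (simp add: case_prod_unfold)
  also have "\<dots> = 0"
  proof (rule antisym_Sum_any)
    \<comment> \<open>After antisymmetrization in i and j this is the Witt algebra relation for the
      action of the L_n on the modes of X.\<close>
    show "?g i j - ?h i j = ?g j i - ?h j i" for i j
      using X by (cases X) (simp_all add: field_simps)
  qed (rule cc_mode_anti[OF VL_VV[OF v]])
  finally have z: "Sum_any (\<lambda>(i, j). smul (?g i j) (cc_mode X k v i j)) - Sum_any (\<lambda>(i, j). smul (?h i j) (cc_mode X k v i j)) = 0" .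
  have m: "smul (lin_coeff X 0 k) (cc_op (md X k v)) = - smul (of_int k) (cc_op (md X k v))"
    using X by (cases X) auto
  have "(Q a b (lin X k v) + Q a b (inhom a b X k v)) + (smul (eps X) (lin X k (Q a b v)) + smul (eps X) (inhom a b X k (Q a b v)))
     = smul (lin_coeff X 0 k) (cc_op (md X k v))"
    by (rule abelian_shuffle[OF Q_lin(2)[OF v X(1)] dX_terms_sum[OF v X k] dc_terms_sum(2)[OF v X(1)] z inhom_terms_sum(2)[OF v X k]])
  then show ?thesis
    unfolding d[OF v] d[OF Q_VL[OF v]] m Q_add[OF VLi VIn] smul_add .
qed

lemma cc_mode_Cc_cyc: "v \<in> VV \<Longrightarrow> cc_mode Cc k v j (- i - j - k) = cc_mode Cc k v i j"
  using pair_comm[of v Cc "- j" Cc "i + j + k" Cc "- i"]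
  by (simp add: cc_mode_def contr_pair_def exch_def algebra_simps)

lemma triple_zero: assumes "s + s + s = 0" shows "s = (0 :: state)"
proof -
  have "smul 3 s = s + s + s" by (rule ext) (simp add: smul_def)
  then show ?thesis unfolding assms by simp
qed

text \<open>For X = c the summand contains three c modes and is invariant under their cyclic
  permutation, so it suffices that the cyclic sum of the coefficients vanishes. This is the form in
  which the Jacobi identity of the Witt algebra is used.\<close>

lemma cyc_Sum_any:
  fixes F :: "int \<Rightarrow> int \<Rightarrow> state"
  assumes bF: "box B F" and cyc: "\<And>i j. F j (- i - j - k) = F i j"
    and g: "\<And>i j. g i j + g j (- i - j - k) + g (- i - j - k) i = 0"
  shows "Sum_any (\<lambda>(i, j). smul (g i j) (F i j)) = 0"
proof -
  have re: "Sum_any (\<lambda>(i, j). smul (h i j) (F i j)) = Sum_any (\<lambda>(i, j). smul (h j (- i - j - k)) (F i j))" for h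
  proof (rule Sum_any.reindex_cong[of "\<lambda>(i, j). (j, - i - j - k)"])
    show "bij (\<lambda>(i, j). (j, - i - j - k))"
      by (rule bij_betw_byWitness[where f' = "\<lambda>(n, m). (- n - m - k, n)"]) auto
  qed (auto simp: fun_eq_iff cyc)
  let ?S = "\<lambda>h. Sum_any (\<lambda>(i, j). smul (h i j) (F i j))"
  have add: "?S h + ?S h' = ?S (\<lambda>i j. h i j + h' i j)" for h h'
    using Sum_any_lin_comb(2)[OF box_fin[OF bF], of "\<lambda>(i, j). h i j" "\<lambda>(i, j). h' i j"]
    by (simp add: case_prod_unfold)
  have s2: "?S (\<lambda>i j. g j (- i - j - k)) = ?S g" by (rule re[symmetric])
  have s3: "?S (\<lambda>i j. g (- i - j - k) i) = ?S g"
    using re[of "\<lambda>i j. g j (- i - j - k)"] s2 by simp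
  have "?S g + ?S g + ?S g = ?S (\<lambda>i j. g i j + g j (- i - j - k) + g (- i - j - k) i)"
    by (simp only: add[symmetric] s2 s3)
  also have "\<dots> = 0" by (simp add: g)
  finally have "?S g + ?S g + ?S g = 0" .
  then show ?thesis by (rule triple_zero)
qed

lemma pair_Cc_comm:
  assumes "v \<in> VV" "X \<noteq> Bt"
  shows "md Cc i (md Cc j (md X k v)) = md X k (md Cc i (md Cc j v))"
proof -
  have "contr_pair Cc i Cc j X k v = 0" unfolding contr_pair_def using assms(2) by simp
  then show ?thesis using pair_comm[OF assms(1), of Cc i Cc j X k] by (simp add: exch_def)
qed

lemma Q_comm_Cc_comm: assumes v: "v \<in> VL L"
  shows "Q_comm a b Cc j (md Cc l v) = md Cc l (Q_comm a b Cc j v)"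
proof (cases "j = 0")
  case True
  then show ?thesis using Q_comm_zero[OF VL_VV[OF v] v] Q_comm_zero[OF md_VV[OF VL_VV[OF v]] md_VL[OF v]] by simp
next
  case False
  have "md Cc l (lin Cc j v) = lin Cc j (md Cc l v)"
    unfolding lin_def
    by (subst md_Sum_any[OF lin_fin[OF v]])
      (simp_all add: md_smul pair_Cc_comm[OF VL_VV[OF v], of Cc _ _ l])
  then show ?thesis using Q_comm_eq[OF v, of j Cc a b] Q_comm_eq[OF md_VL[OF v], of j Cc a b] False by simp
qed

text \<open>The commutator is quadratic in c, and d acting on either factor gives the same result.
  The correction for the absent c_0 therefore occurs twice with coefficient -k/2, which gives -k as
  for the other fields.\<close>

lemma Q_comm_sq_Cc:
  assumes v: "v \<in> VL L"
  shows "Q a b (Q_comm a b Cc k v) + smul (eps Cc) (Q_comm a b Cc k (Q a b v)) = - smul (of_int k) (cc_op (md Cc k v))"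
proof (cases "k = 0")
  case True
  have "cc_op 0 = 0" by (simp add: cc_op_def)
  then show ?thesis using True v
    by (simp add: Q_comm_zero[OF VL_VV[OF v] v] Q_comm_zero[OF VL_VV[OF Q_VL[OF v]] Q_VL[OF v]] md_zero_mode[OF VL_VV[OF v]])
next
  case k: False
  have d: "Q_comm a b Cc k w = lin Cc k w" if "w \<in> VL L" for w
    using k Q_comm_eq[OF that, of k Cc a b] by simp
  have "dX_terms a b Cc k v (- n - k) = - dc_terms a b Cc k v n" for n
  proof -
    have "lin_coeff Cc (- n - k) k = - lin_coeff Cc n k" by (simp add: field_simps)
    then show ?thesis by (simp add: dX_terms_def dc_terms_def Q_comm_Cc_comm[OF v] add.commute del: lin_coeff.simps)
  qed
  then have "Sum_any (dX_terms a b Cc k v) = Sum_any (\<lambda>n. - dc_terms a b Cc k v n)"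
    by (intro Sum_any.reindex_cong[of "\<lambda>n. - n - k"])
      (auto simp: fun_eq_iff intro!: bij_betw_byWitness[where f' = "\<lambda>n. - n - k"])
  also have "\<dots> = - Sum_any (dc_terms a b Cc k v)" by (rule uminus_Sum_any[symmetric])
  finally have W: "Sum_any (dX_terms a b Cc k v) = - Sum_any (dc_terms a b Cc k v)" .
  have "Sum_any (\<lambda>(i, j). smul (lin_coeff Cc (i + j) k * (of_int (j - i) / 2)) (cc_mode Cc k v i j)) = 0"
  proof (rule cyc_Sum_any[where k = k and F = "cc_mode Cc k v" and g = "\<lambda>i j. lin_coeff Cc (i + j) k * (of_int (j - i) / 2)"])
    show "box (3 * \<bar>L\<bar> + \<bar>k\<bar>) (cc_mode Cc k v)" by (rule cc_mode_box[OF v]) simp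
    show "cc_mode Cc k v j (- i - j - k) = cc_mode Cc k v i j" for i j by (rule cc_mode_Cc_cyc[OF VL_VV[OF v]])
    show "lin_coeff Cc (i + j) k * (of_int (j - i) / 2) + lin_coeff Cc (j + (- i - j - k)) k * (of_int (- i - j - k - j) / 2) +
      lin_coeff Cc (- i - j - k + i) k * (of_int (i - (- i - j - k)) / 2) = 0" for i j
      by (simp add: field_simps)
  qed
  then have U: "Sum_any (dc_terms a b Cc k v) = smul (lin_coeff Cc 0 k) (cc_op (md Cc k v))"
    using dc_terms_sum(2)[OF v, of Cc a b k] by simp
  have E: "Q a b (lin Cc k v) = lin Cc k (Q a b v) + smul (lin_coeff Cc 0 k) (cc_op (md Cc k v)) - - smul (lin_coeff Cc 0 k) (cc_op (md Cc k v))"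
    using Q_lin(2)[OF v, of Cc a b k] unfolding W U by simp
  show ?thesis unfolding d[OF v] d[OF Q_VL[OF v]] E
    by (rule ext) (simp add: smul_def field_simps)
qed

text \<open>This is the behaviour of M L_0: M commutes with X_k, and X_k lowers the level by
  k.\<close>

lemma Q_sq_md:
  assumes v: "v \<in> VL L" and X: "X \<noteq> Bt"
  shows "Q a b (Q a b (md X k v)) = md X k (Q a b (Q a b v)) - smul (of_int k) (cc_op (md X k v))"
proof -
  have e: "eps X * eps X = 1" by (simp add: eps_def)
  have s: "Q a b (Q_comm a b X k v) + smul (eps X) (Q_comm a b X k (Q a b v)) = - smul (of_int k) (cc_op (md X k v))"
    using Q_comm_sq[OF v X] Q_comm_sq_Cc[OF v] by blast
  have de: "Q_comm a b X k v = Q a b (md X k v) + smul (- eps X) (md X k (Q a b v))"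
    unfolding Q_md[OF v] by simp
  have dV: "Q_comm a b X k v \<in> VL (L - k)"
    unfolding de by (intro VL_add VL_smul Q_VL md_VL v)
  have "Q a b (Q a b (md X k v)) = smul (eps X) (smul (eps X) (md X k (Q a b (Q a b v))) + Q_comm a b X k (Q a b v)) + Q a b (Q_comm a b X k v)"
    unfolding Q_md[OF v] Q_add[OF VL_smul[OF md_VL[OF Q_VL[OF v]]] dV] Q_smul Q_md[OF Q_VL[OF v]] ..
  also have "\<dots> = md X k (Q a b (Q a b v)) + (Q a b (Q_comm a b X k v) + smul (eps X) (Q_comm a b X k (Q a b v)))"
    by (simp add: smul_add e add_ac)
  finally show ?thesis unfolding s by simp
qed

lemma cc_op_fin: "v \<in> VL L \<Longrightarrow> finite {n. smul (of_int n) (md Cc (- n) (md Cc n v)) \<noteq> 0}"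
  using lin_fin[of v L Cc of_int 0] by simp

lemma cc_op_md:
  assumes v: "v \<in> VL L" and X: "X \<noteq> Bt"
  shows "cc_op (md X k v) = md X k (cc_op v)"
  unfolding cc_op_def
  by (subst md_Sum_any[OF cc_op_fin[OF v]])
    (use X in \<open>simp_all add: md_smul pair_Cc_comm[OF VL_VV[OF v]]\<close>)

subsection \<open>Basis states\<close>

lemma pt_VL: "valid_mono \<mu> \<Longrightarrow> pt \<mu> \<in> VL (int (level \<mu>))"
  by (auto simp: VL_def)

lemma bos_upd_inv: "bos \<nu> x \<ge> 1 \<Longrightarrow> bos_upd x Suc (bos_upd x (\<lambda>k. k - 1) \<nu>) = \<nu>"
  "bos_upd x (\<lambda>k. k - 1) (bos_upd x Suc \<nu>) = \<nu>"
  by (cases \<nu>; simp add: bos_upd_def fun_upd_idem)+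

lemma fer_upd_inv: "f \<in> fer \<nu> \<Longrightarrow> (\<nu>\<lparr>fer := fer \<nu> - {f}\<rparr>)\<lparr>fer := insert f (fer (\<nu>\<lparr>fer := fer \<nu> - {f}\<rparr>))\<rparr> = \<nu>"
  by (cases \<nu>) (simp add: insert_absorb)

lemma crB_pt: "crB x (pt \<mu>) = pt (bos_upd x Suc \<mu>)"
proof (rule ext)
  fix \<nu>
  have "bos (bos_upd x Suc \<mu>) x \<ge> 1" by (simp add: bos_upd_def)
  then show "crB x (pt \<mu>) \<nu> = pt (bos_upd x Suc \<mu>) \<nu>"
    using bos_upd_inv(1)[of \<nu> x] bos_upd_inv(2)[of x \<mu>] by (auto simp: crB_def)
qed

lemma crF_pt: assumes "f \<notin> fer \<mu>"
  shows "crF f (pt \<mu>) = smul (fsign f (fer \<mu>)) (pt (\<mu>\<lparr>fer := insert f (fer \<mu>)\<rparr>))"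
proof (rule ext)
  fix \<nu>
  let ?m = "\<mu>\<lparr>fer := insert f (fer \<mu>)\<rparr>"
  have 1: "?m\<lparr>fer := fer ?m - {f}\<rparr> = \<mu>" using assms by (cases \<mu>) simp
  have 2: "\<nu> = ?m" if "\<nu>\<lparr>fer := fer \<nu> - {f}\<rparr> = \<mu>" "f \<in> fer \<nu>"
    using fer_upd_inv[OF that(2)] that(1) by simp
  show "crF f (pt \<mu>) \<nu> = smul (fsign f (fer \<mu>)) (pt ?m) \<nu>"
  proof (cases "\<nu> = ?m")
    case True
    then show ?thesis using 1 assms by (simp add: crF_def smul_def)
  next
    case False
    then show ?thesis using 2 by (auto simp: crF_def smul_def)
  qed
qed

lemma anB_pt: "bos \<mu> x = 0 \<Longrightarrow> anB x (pt \<mu>) = 0"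
  by (auto simp: anB_def bos_upd_def fun_eq_iff)
lemma anF_pt: "f \<notin> fer \<mu> \<Longrightarrow> anF f (pt \<mu>) = 0"
  by (auto simp: anF_def fun_eq_iff)

lemma anF_pt_in: assumes "f \<in> fer \<mu>"
  shows "anF f (pt \<mu>) = smul (fsign f (fer \<mu> - {f})) (pt (\<mu>\<lparr>fer := fer \<mu> - {f}\<rparr>))"
proof (rule ext)
  fix \<nu>
  let ?m = "\<mu>\<lparr>fer := fer \<mu> - {f}\<rparr>"
  have 1: "?m\<lparr>fer := insert f (fer ?m)\<rparr> = \<mu>" by (rule fer_upd_inv[OF assms])
  have 2: "\<nu> = ?m" if "\<nu>\<lparr>fer := insert f (fer \<nu>)\<rparr> = \<mu>" "f \<notin> fer \<nu>"
    using that by (cases \<nu>) auto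
  show "anF f (pt \<mu>) \<nu> = smul (fsign f (fer \<mu> - {f})) (pt ?m) \<nu>"
  proof (cases "\<nu> = ?m")
    case True
    then show ?thesis using 1 by (simp add: anF_def smul_def)
  next
    case False
    then show ?thesis using 2 by (auto simp: anF_def smul_def)
  qed
qed

lemma level_bos_upd: "valid_mono \<mu> \<Longrightarrow> int (level (bos_upd x Suc \<mu>)) = int (level \<mu>) + int (snd x)"
  by (simp add: level_wt wt_bos_upd)
lemma level_fer_upd: "valid_mono \<mu> \<Longrightarrow> f \<notin> fer \<mu> \<Longrightarrow> int (level (\<mu>\<lparr>fer := insert f (fer \<mu>)\<rparr>)) = int (level \<mu>) + int (snd f)"
  by (simp add: level_wt wt_fer_upd)

abbreviation level_monos :: "int \<Rightarrow> mono set" where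
  "level_monos L \<equiv> {\<mu>. valid_mono \<mu> \<and> int (level \<mu>) = L}"

lemma finite_level: "finite (level_monos L)"
proof -
  let ?K = "{..<4::nat} \<times> {..nat L}"
  let ?B = "{f. \<forall>x. (x \<in> ?K \<longrightarrow> f x \<in> {..nat L}) \<and> (x \<notin> ?K \<longrightarrow> f x = 0)}"
  have "finite ?B" by (rule finite_set_of_finite_funs) auto
  then have fin: "finite ((\<lambda>(b, F). \<lparr>bos = b, fer = F\<rparr>) ` (?B \<times> Pow ?K))" by simp
  have "level_monos L \<subseteq> (\<lambda>(b, F). \<lparr>bos = b, fer = F\<rparr>) ` (?B \<times> Pow ?K)"
  proof
    fix \<mu> assume "\<mu> \<in> level_monos L"
    then have v: "valid_mono \<mu>" and L: "L = int (level \<mu>)" by auto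
    have fb: "finite {x. bos \<mu> x \<noteq> 0}" and ff: "finite (fer \<mu>)" using v by (auto simp: valid_mono_def)
    have nL: "nat L = level \<mu>" using L by simp
    have b: "bos \<mu> x * snd x \<le> nat L" if "bos \<mu> x \<noteq> 0" for x
      using member_le_sum[of x "{x. bos \<mu> x \<noteq> 0}" "\<lambda>x. bos \<mu> x * snd x"] that fb by (simp add: nL level_def)
    have f: "snd x \<le> nat L" if "x \<in> fer \<mu>" for x
      using member_le_sum[of x "fer \<mu>" snd] that ff by (simp add: nL level_def)
    have 1: "bos \<mu> \<in> ?B"
    proof (intro CollectI allI conjI impI)
      fix x
      show "bos \<mu> x \<in> {..nat L}"
      proof (cases "bos \<mu> x = 0")
        case False
        then have "1 \<le> snd x" using v unfolding valid_mono_def by blast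
        then have "bos \<mu> x \<le> bos \<mu> x * snd x" by simp
        from le_trans[OF this b[OF False]] show ?thesis by simp
      qed simp
      assume x: "x \<notin> ?K"
      show "bos \<mu> x = 0"
      proof (rule ccontr)
        assume n: "bos \<mu> x \<noteq> 0"
        then have "fst x < 4" using v unfolding valid_mono_def by blast
        moreover have "snd x \<le> bos \<mu> x * snd x" using n by simp
        from le_trans[OF this b[OF n]] have "snd x \<le> nat L" .
        ultimately show False using x by (cases x) auto
      qed
    qed
    have 2: "fer \<mu> \<in> Pow ?K" using f v by (fastforce simp: valid_mono_def)
    show "\<mu> \<in> (\<lambda>(b, F). \<lparr>bos = b, fer = F\<rparr>) ` (?B \<times> Pow ?K)"
      using 1 2 by (intro image_eqI[of _ _ "(bos \<mu>, fer \<mu>)"]) auto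
  qed
  then show ?thesis using fin finite_subset by blast
qed

lemma VL_expand: assumes "v \<in> VL L"
  shows "v = (\<Sum>\<mu>\<in>level_monos L. smul (v \<mu>) (pt \<mu>))"
proof (rule ext)
  fix \<nu>
  have "v \<nu> = (if \<nu> \<in> level_monos L then v \<nu> else 0)"
    using assms by (auto simp: VL_def)
  also have "\<dots> = (\<Sum>\<mu>\<in>level_monos L. if \<nu> = \<mu> then v \<mu> else 0)"
    by (rule sum.delta'[OF finite_level, symmetric])
  also have "\<dots> = (\<Sum>\<mu>\<in>level_monos L. smul (v \<mu>) (pt \<mu>) \<nu>)"
    by (rule sum.cong) (auto simp: smul_def)
  finally show "v \<nu> = (\<Sum>\<mu>\<in>level_monos L. smul (v \<mu>) (pt \<mu>)) \<nu>"
    by (simp only: sum_state_apply)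
qed

subsection \<open>The square of the BRST operator\<close>

text \<open>On level L the operator L_0 is the scalar a b + L, so this expresses d^2 = M
  L_0.\<close>

definition sq_formula :: "complex \<Rightarrow> complex \<Rightarrow> int \<Rightarrow> state \<Rightarrow> bool" where
  "sq_formula a b L v \<longleftrightarrow> Q a b (Q a b v) = smul (a * b + of_int L) (cc_op v)"

lemma cc_op_smul: "cc_op (smul c v) = smul c (cc_op v)"
  by (simp add: cc_op_def smul_Sum_any md_smul mult.commute)
lemma cc_op_add: assumes "v \<in> VL L" "w \<in> VL L" shows "cc_op (v + w) = cc_op v + cc_op w"
  unfolding cc_op_def by (subst Sum_any.distrib[OF cc_op_fin[OF assms(1)] cc_op_fin[OF assms(2)], symmetric])
    (simp add: md_add smul_add)
lemma cc_op_zero: "cc_op 0 = 0" by (simp add: cc_op_def)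

lemma sq_formula_smul: "sq_formula a b L v \<Longrightarrow> sq_formula a b L (smul c v)"
  by (simp add: sq_formula_def Q_smul cc_op_smul mult.commute)

lemma sq_formula_add: "v \<in> VL L \<Longrightarrow> w \<in> VL L \<Longrightarrow> sq_formula a b L v \<Longrightarrow> sq_formula a b L w \<Longrightarrow> sq_formula a b L (v + w)"
  unfolding sq_formula_def by (simp only: Q_add[of v L w] Q_add[OF Q_VL Q_VL] cc_op_add[of v L w] smul_add)

lemma sq_formula_zero: "sq_formula a b L 0"
  by (simp add: sq_formula_def cc_op_zero)

lemma sq_formula_sum: 
  assumes "\<And>i. i \<in> I \<Longrightarrow> f i \<in> VL L" "\<And>i. i \<in> I \<Longrightarrow> sq_formula a b L (f i)"
  shows "sq_formula a b L (sum f I)"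
  using assms
proof (induction I rule: infinite_finite_induct)
  case (insert x F)
  have "sum f F \<in> VL L" using insert.prems(1) by (intro sum_VL) auto
  then have "sq_formula a b L (f x + sum f F)" using insert by (intro sq_formula_add) auto
  then show ?case by (simp only: sum.insert[OF insert.hyps])
qed (simp_all add: sq_formula_zero)

lemma sq_formula_md:
  assumes v: "v \<in> VL L" and X: "X \<noteq> Bt" and a: "sq_formula a b L v"
  shows "sq_formula a b (L - k) (md X k v)"
proof -
  have "Q a b (Q a b (md X k v)) = smul (a * b + of_int L) (md X k (cc_op v)) - smul (of_int k) (md X k (cc_op v))"
    using a by (simp only: Q_sq_md[OF v X] sq_formula_def md_smul cc_op_md[OF v X])
  also have "\<dots> = smul (a * b + of_int (L - k)) (cc_op (md X k v))"
    unfolding cc_op_md[OF v X] vs.scale_left_diff_distrib[symmetric] by (simp add: algebra_simps)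
  finally show ?thesis by (simp only: sq_formula_def)
qed

text \<open>The counterpart of \<open>sq_formula_md\<close> for annihilators: from the formula on a
  lower level it follows that the defect is killed by X_k.\<close>

lemma sq_formula_annihilated:
  assumes v: "v \<in> VL L" and X: "X \<noteq> Bt" and a: "sq_formula a b (L - k) (md X k v)"
  shows "md X k (Q a b (Q a b v) - smul (a * b + of_int L) (cc_op v)) = 0"
proof -
  have "md X k (Q a b (Q a b v)) = Q a b (Q a b (md X k v)) + smul (of_int k) (cc_op (md X k v))"
    using Q_sq_md[OF v X, of a b k] by (simp only: diff_add_cancel)
  also have "\<dots> = smul (a * b + of_int (L - k)) (cc_op (md X k v)) + smul (of_int k) (cc_op (md X k v))"
    using a by (simp only: sq_formula_def)
  also have "\<dots> = smul (a * b + of_int L) (cc_op (md X k v))"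
    unfolding vs.scale_left_distrib[symmetric] by simp
  finally show ?thesis by (simp only: md_diff md_smul cc_op_md[OF v X] diff_self)
qed

subsection \<open>The vacuum and the central charge\<close>

definition vac_mono :: mono where "vac_mono = \<lparr>bos = (\<lambda>_. 0), fer = {}\<rparr>"
abbreviation vac :: state where "vac \<equiv> pt vac_mono"

lemma valid_vacm: "valid_mono vac_mono" and level_vacm [simp]: "level vac_mono = 0" and ghost_vacm [simp]: "ghost vac_mono = 0"
  by (simp_all add: vac_mono_def valid_mono_def level_def ghost_def)

lemma vac_VL: "vac \<in> VL 0"
  using pt_VL[OF valid_vacm] by simp

lemma level_zero: assumes "valid_mono \<mu>" "level \<mu> = 0" shows "\<mu> = vac_mono"
proof -
  have fb: "finite {x. bos \<mu> x \<noteq> 0}" and ff: "finite (fer \<mu>)" using assms by (auto simp: valid_mono_def)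
  have s: "(\<Sum>x | bos \<mu> x \<noteq> 0. bos \<mu> x * snd x) = 0" "(\<Sum>x\<in>fer \<mu>. snd x) = 0"
    using assms(2) by (simp_all add: level_def)
  have "bos \<mu> x = 0" for x
  proof (rule ccontr)
    assume n: "bos \<mu> x \<noteq> 0"
    then have "bos \<mu> x * snd x = 0" using s(1) unfolding sum_eq_0_iff[OF fb] by blast
    moreover have "1 \<le> snd x" using n assms(1) unfolding valid_mono_def by blast
    ultimately show False using n by simp
  qed
  moreover have "fer \<mu> = {}"
  proof (rule ccontr)
    assume "fer \<mu> \<noteq> {}"
    then obtain x where x: "x \<in> fer \<mu>" by blast
    then have "snd x = 0" using s(2) unfolding sum_eq_0_iff[OF ff] by blast
    moreover have "1 \<le> snd x" using x assms(1) unfolding valid_mono_def by blast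
    ultimately show False by simp
  qed
  ultimately show ?thesis by (cases \<mu>) (auto simp: vac_mono_def)
qed

lemma Q_ghost:
  assumes "v \<in> VV" "Q a b v \<nu> \<noteq> 0"
  shows "\<exists>\<kappa>. v \<kappa> \<noteq> 0 \<and> ghost \<nu> = ghost \<kappa> + 1"
proof -
  have "Q0 a v \<nu> \<noteq> 0 \<or> Q1 v \<nu> \<noteq> 0 \<or> Q2 b v \<nu> \<noteq> 0" using assms(2) by (auto simp: Q_def)
  then show ?thesis
    using raisesD[OF raises_Q0 assms(1)] raisesD[OF raises_Q1 assms(1)] raisesD[OF raises_Q2 assms(1)] by metis
qed

text \<open>The only monomial of level 0 is the vacuum, which leaves no room for a rise of the ghost
  number by 1.\<close>

lemma Q_VL0: assumes v: "v \<in> VL 0" shows "Q a b v = 0"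
proof (rule ext)
  fix \<nu>
  show "Q a b v \<nu> = 0 \<nu>"
  proof (rule ccontr)
    assume "Q a b v \<nu> \<noteq> 0 \<nu>"
    then have n: "Q a b v \<nu> \<noteq> 0" by simp
    obtain \<kappa> where k: "v \<kappa> \<noteq> 0" "ghost \<nu> = ghost \<kappa> + 1" using Q_ghost[OF VL_VV[OF v] n] by blast
    have "\<nu> = vac_mono" using Q_VL[OF v, of a b] n by (intro level_zero) (auto simp: VL_def)
    moreover have "\<kappa> = vac_mono" using v k by (intro level_zero) (auto simp: VL_def)
    ultimately show False using k by simp
  qed
qed

lemma vev_creator: "k < 0 \<Longrightarrow> md X k v vac_mono = 0"
  by (auto simp: md_eq cr_def crB_def crF_def vac_mono_def)

lemma ann_vac: "k \<ge> 0 \<Longrightarrow> md X k vac = 0"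
  using md_kill[OF vac_VL, of k X] md_zero_mode[OF VL_VV[OF vac_VL]] by (cases "k = 0") auto

lemma md_vac2: assumes "i > 0" shows "md A i (md C j vac) = smul (if i + j = 0 then contr A C i else 0) vac"
  using md_comm[OF VL_VV[OF vac_VL], of A i C j] ann_vac[of i A] assms by simp

lemma md_vac3: assumes "l > 0"
  shows "md B l (md C j (md E h vac)) = smul (if l + h = 0 then exch B C * contr B E l else 0) (md C j vac)
     + smul (if l + j = 0 then contr B C l else 0) (md E h vac)"
  using md_comm[OF md_VV[OF VL_VV[OF vac_VL]], of B l C j E h] md_vac2[OF assms, of B E h]
  by (simp add: md_smul mult.commute)

lemma md_vac4: assumes "i > 0" "l > 0"
  shows "md A i (md B l (md C j (md E h vac))) =
    smul ((if l + j = 0 \<and> i + h = 0 then contr B C l * contr A E i else 0)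
        + (if l + h = 0 \<and> i + j = 0 then exch B C * contr B E l * contr A C i else 0)) vac"
  unfolding md_vac3[OF assms(2)] md_add md_smul md_vac2[OF assms(1)]
  by (rule ext) (auto simp: smul_def algebra_simps)

text \<open>The summand of index m of the bilinear part of the total Virasoro generator L_k, which
  is the anticommutator of d with b_k.\<close>

definition vir :: "int \<Rightarrow> int \<Rightarrow> state \<Rightarrow> state" where
  "vir k m v = md Ap (- m) (md Am (k + m) v) + smul (of_int (m - k)) (md Cc (- m) (md Bt (k + m) v))
     + smul (of_int m) (md Ze (- m) (md Et (k + m) v)) + smul (of_int m) (md Be (- m) (md Ga (k + m) v))"

lemma vir_fin: assumes "v \<in> VL L" "k \<noteq> 0" shows "finite {m. vir k m v \<noteq> 0}"
proof (rule finite_subset)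
  show "{m. vir k m v \<noteq> 0} \<subseteq> {- L..L - k}"
  proof
    fix m assume "m \<in> {m. vir k m v \<noteq> 0}"
    then have "\<not> (- m > L \<or> k + m > L)"
      using pair_kill[OF assms(1), of _ _ "- m" "k + m"] assms(2) by (auto simp: vir_def)
    then show "m \<in> {- L..L - k}" by auto
  qed
qed simp

lemma Q_comm_Bt:
  assumes v: "v \<in> VL L" and k: "k \<noteq> 0"
  shows "Q_comm a b Bt k v = smul (a - of_int k) (md Am k v) + smul (b + of_int k) (md Ap k v) + Sum_any (\<lambda>m. vir k m v)"
proof -
  \<comment> \<open>The cubic ghost term has two c factors that b_k can contract with.
    \<open>G\<close> collects the contractions with the first c of every cubic term,
    \<open>H\<close> those with the second c; together they remove the factor 1/2.\<close>
  define H where "H n = smul (of_int (n - k) / 2) (md Cc (- n) (md Bt (k + n) v))" for n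
  define G where "G m = md Ap (- m) (md Am (k + m) v) + smul (of_int (m - k) / 2) (md Cc (- m) (md Bt (k + m) v))
     + smul (of_int m) (md Ze (- m) (md Et (k + m) v)) + smul (of_int m) (md Be (- m) (md Ga (k + m) v))" for m
  have GH: "vir k m v = G m + H m" for m
    unfolding vir_def G_def H_def by (rule ext) (simp add: smul_def field_simps)
  have supp: "- m \<le> L \<and> k + m \<le> L" if "G m \<noteq> 0 \<or> H m \<noteq> 0" for m
  proof (rule ccontr)
    assume "\<not> (- m \<le> L \<and> k + m \<le> L)"
    then have "- m > L \<or> k + m > L" by auto
    then show False using pair_kill[OF v, of _ _ "- m" "k + m"] k that by (auto simp: G_def H_def)
  qed
  have fG: "finite {m. G m \<noteq> 0}" and fH: "finite {m. H m \<noteq> 0}"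
    by (rule finite_subset[of _ "{- L..L - k}"]; use supp in force)+
  have K: "(\<lambda>(n, m). contr1 Bt k v n m) = (\<lambda>x. (\<lambda>(n, m). if n = k then G m else 0) x + (\<lambda>(n, m). if m = k then H n else 0) x)"
  proof (rule ext)
    fix x :: "int \<times> int" obtain n m where x: "x = (n, m)" by (cases x)
    have c: "k = n \<longleftrightarrow> n = k" "k = m \<longleftrightarrow> m = k" by auto
    have s: "smul ((of_int k - of_int n) / 2) w = - smul ((of_int n - of_int k) / 2) w" for w
      by (rule ext) (simp add: smul_def field_simps)
    have "contr1 Bt k v n m = (if n = k then G m else 0) + (if m = k then H n else 0)"
      using k by (cases "n = k"; cases "m = k") (simp_all add: contr1_def contr_triple_def exch_def c G_def H_def add.commute s)
    then show "(\<lambda>(n, m). contr1 Bt k v n m) x = (\<lambda>(n, m). if n = k then G m else 0) x + (\<lambda>(n, m). if m = k then H n else 0) x"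
      by (simp add: x)
  qed
  have f1: "finite {x. (\<lambda>(n, m). if n = k then G m else 0) x \<noteq> 0}"
    by (rule finite_subset[of _ "{k} \<times> {m. G m \<noteq> 0}"]) (auto split: if_splits intro: fG)
  have f2: "finite {x. (\<lambda>(n, m). if m = k then H n else 0) x \<noteq> 0}"
    by (rule finite_subset[of _ "{m. H m \<noteq> 0} \<times> {k}"]) (auto split: if_splits intro: fH)
  have 1: "Sum_any (\<lambda>(n, m). contr1 Bt k v n m) = Sum_any (\<lambda>m. vir k m v)"
    unfolding K GH Sum_any.distrib[OF f1 f2] Sum_any.distrib[OF fG fH] Sum_any_graph' Sum_any_graph ..
  have 0: "Sum_any (contr0 a Bt k v) = smul (a - of_int k) (md Am k v)"
  proof -
    have "contr0 a Bt k v n = (if n = k then smul (a - of_int k) (md Am k v) else 0)" for n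
      using k by (cases "n = k") (auto simp: contr0_def contr_pair_def exch_def)
    then show ?thesis by simp
  qed
  have 2: "Sum_any (contr2 b Bt k v) = smul (b + of_int k) (md Ap k v)"
  proof -
    have "contr2 b Bt k v n = (if n = k then smul (b + of_int k) (md Ap k v) else 0)" for n
      using k by (cases "n = k") (auto simp: contr2_def contr_pair_def exch_def)
    then show ?thesis by simp
  qed
  show ?thesis unfolding Q_comm_def 0 1 2 by (simp add: add_ac)
qed

text \<open>On the vacuum only the indices for which both modes are creators survive. Dually, in
  \<open>vev_vir\<close> the vacuum coefficient sees only the indices for which both are
  annihilators. This makes the central term a finite sum.\<close>

lemma vir_vac: assumes "k > 0" "m \<notin> {1..k - 1}" shows "vir (- k) m vac = 0"
proof -
  have p: "md X (- m) (md Y (- k + m) vac) = 0" if "contr X Y (- m) = 0 \<or> k \<noteq> 0" for X Y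
  proof (cases "m = 0 \<or> m = k")
    case True
    then show ?thesis using md_zero_mode[OF VL_VV[OF vac_VL]] md_zero_mode[OF md_VV[OF VL_VV[OF vac_VL]]] by auto
  next
    case False
    then show ?thesis using assms by (intro pair_kill[OF vac_VL]) auto
  qed
  show ?thesis using p assms by (simp add: vir_def)
qed

lemma vev_vir: assumes v: "v \<in> VL L" and k: "k > 0" "m \<notin> {- (k - 1)..- 1}" shows "vir k m v vac_mono = 0"
proof -
  note z = md_zero_mode[OF VL_VV[OF v]] md_zero_mode[OF md_VV[OF VL_VV[OF v]]]
  have p: "md X (- m) (md Y (k + m) v) vac_mono = 0" for X Y
  proof (cases "m = 0 \<or> k + m = 0")
    case True
    then show ?thesis using z by auto
  next
    case False
    then consider "- m < 0" | "k + m < 0" using k by force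
    then show ?thesis
    proof cases
      case 1 then show ?thesis by (rule vev_creator)
    next
      case 2
      have "md X (- m) (md Y (k + m) v) = smul (exch X Y) (md Y (k + m) (md X (- m) v))"
        using k by (intro pair_swap[OF VL_VV[OF v]]) auto
      then show ?thesis using vev_creator[OF 2] by (simp add: smul_def)
    qed
  qed
  show ?thesis using p by (simp add: vir_def smul_def)
qed

lemma vir_add: "vir k m (v + w) = vir k m v + vir k m w"
  by (rule ext) (simp add: vir_def md_add smul_def algebra_simps)
lemma vir_smul: "vir k m (smul c v) = smul c (vir k m v)"
  unfolding vir_def md_smul by (rule ext) (simp add: smul_def algebra_simps)
lemma vir_zero: "vir k m 0 = 0" using vir_smul[of k m 0 0] by simp
lemma vir_sum: "vir k m (sum f A) = (\<Sum>i\<in>A. vir k m (f i))"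
  using sum_comp_morphism[of "vir k m" f A] by (simp only: comp_def vir_zero vir_add)

lemma vir_vir:
  assumes "i \<in> {1..k - 1}" "j \<in> {1..k - 1}"
  shows "vir k (- i) (vir (- k) j vac) = smul (if j = k - i then - 2 * of_int k ^ 2 else 0) vac"
proof -
  have p: "0 < i" "0 < k - i" using assms by auto
  have e: "k - i + - j = 0 \<longleftrightarrow> j = k - i" "i + (- k + j) = 0 \<longleftrightarrow> j = k - i" by auto
  show ?thesis
  proof (cases "j = k - i")
    case j: True
    have r: "- k + j = - i" "k + - i = j" using j by auto
    have q: "0 < j" using assms by simp
    have k: "k = i + j" using j by simp
    have c: "i \<noteq> 0" "j \<noteq> 0" using p q by auto
    have e: "j + - i = 0 \<and> i + - j = 0 \<longleftrightarrow> i = j" "(j + - j = 0 \<and> i + - i = 0) = True" by auto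
    have u: "md A i (md B j (md C (- j) (md E (- i) vac))) =
      smul (contr B C j * contr A E i + (if i = j then exch B C * contr B E j * contr A C i else 0)) vac" for A B C E
      unfolding md_vac4[OF p(1) q] e if_True ..
    have jk: "(j = k - i) = True" using j by simp
    show ?thesis
      unfolding vir_def md_add md_smul minus_minus r u jk if_True unfolding k using c
      by (simp add: exch_def flip: vs.scale_left_distrib vs.scale_left_diff_distrib vs.scale_minus_left)
        (simp add: power2_eq_square field_simps)
  next
    case False
    have p': "0 < k + - i" using p by simp
    have e: "(k + - i + - j = 0 \<and> i + (- k + j) = 0) = False" using False by auto
    \<comment> \<open>Direct contraction needs j = k - i. The crosswise one needs B dual to E, but
      both are second factors of \<open>vir\<close>, that is, among \<open>Am\<close>,
      \<open>Bt\<close>, \<open>Et\<close>, \<open>Ga\<close>, and no two of these are dual.\<close>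
    have u: "md A i (md B (k + - i) (md C (- j) (md E (- k + j) vac))) = 0" if "\<And>x. contr B E x = 0" for A B C E
      unfolding md_vac4[OF p(1) p'] e if_False that
      by (simp only: mult_zero_left mult_zero_right if_cancel add_0_left vs.scale_zero_left)
    have u': "md A i (md B (k - i) (md C (- j) (md E (j - k) vac))) = 0" if "\<And>x. contr B E x = 0" for A B C E
      using u[OF that, of A C] by (simp only: uminus_add_conv_diff add_uminus_conv_diff)
    have c: "vir k (- i) (md C (- j) (md E (- k + j) vac)) = 0" if "(C, E) \<in> {(Ap, Am), (Cc, Bt), (Ze, Et), (Be, Ga)}" for C E
      unfolding vir_def minus_minus using that by (auto simp: u')
    show ?thesis unfolding vir_def[of "- k"] vir_add vir_smul using False c[unfolded uminus_add_conv_diff] by simp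
  qed
qed

lemma md_vac_unbalanced: assumes "0 < m" "m < k" shows "md Z k (md X (- m) (md Y (- k + m) vac)) = 0"
  using assms by (subst md_vac3) auto

lemma md_vac_unbalanced': assumes "0 < i" "i < k" shows "md X i (md Y (k - i) (md Z (- k) vac)) = 0"
proof -
  have "md Y (k - i) (md Z (- k) vac) = 0" using assms by (subst md_vac2) auto
  then show ?thesis by simp
qed

lemma vir_single: assumes "i \<in> {1..k - 1}" shows "vir k (- i) (md Z (- k) vac) = 0"
  using md_vac_unbalanced'[of i k] assms by (simp add: vir_def)

lemma Q_Bt_vac: assumes "k > 0"
  shows "Q a b (md Bt (- k) vac) = smul (a + of_int k) (md Am (- k) vac) + smul (b - of_int k) (md Ap (- k) vac)
     + (\<Sum>j\<in>{1..k - 1}. vir (- k) j vac)"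
proof -
  have "Sum_any (\<lambda>m. vir (- k) m vac) = (\<Sum>j\<in>{1..k - 1}. vir (- k) j vac)"
    using vir_vac[OF assms] by (intro Sum_any.expand_superset) auto
  moreover have "Q_comm a b Bt (- k) vac = smul (a - of_int (- k)) (md Am (- k) vac) + smul (b + of_int (- k)) (md Ap (- k) vac) + Sum_any (\<lambda>m. vir (- k) m vac)"
    using assms by (intro Q_comm_Bt[OF vac_VL]) auto
  ultimately show ?thesis
    using Q_md[OF vac_VL, of a b Bt "- k"] Q_VL0[OF vac_VL, of a b] by simp
qed

lemma fsum_superset: "finite A \<Longrightarrow> (\<And>i. i \<notin> A \<Longrightarrow> f i = 0) \<Longrightarrow> fsum f = sum f A"
  unfolding fsum_def by (rule sum.mono_neutral_left) auto

text \<open>By \<open>vir_vir\<close> each of the k - 1 pairs of intermediate modes contributes -2 k^2: the alpha pairs give i (k - i),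
 the ghosts -(i + k)(2 k - i), and beta gamma cancels zeta eta.\<close>

lemma central_charge:
  assumes k: "k > 0"
  shows "md Bt k (Q a b (Q a b (md Bt (- k) vac))) vac_mono = 2 * of_int k * (a * b + of_int k)"
proof -
  define y where "y = Q a b (md Bt (- k) vac)"
  have y: "y = smul (a + of_int k) (md Am (- k) vac) + smul (b - of_int k) (md Ap (- k) vac)
     + (\<Sum>j\<in>{1..k - 1}. vir (- k) j vac)"
    unfolding y_def by (rule Q_Bt_vac[OF k])
  have yV: "y \<in> VL k"
    unfolding y_def using Q_VL[OF md_VL[OF vac_VL, of Bt "- k"], of a b] by simp
  have "Q a b (md Bt k y) = 0"
    by (rule Q_VL0) (use md_VL[OF yV, of Bt k] in simp)
  then have "md Bt k (Q a b y) = Q_comm a b Bt k y"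
    using Q_md[OF yV, of a b Bt k] by simp
  also have "\<dots> = smul (a - of_int k) (md Am k y) + smul (b + of_int k) (md Ap k y) + Sum_any (\<lambda>m. vir k m y)"
    using k by (intro Q_comm_Bt[OF yV]) auto
  finally have e: "md Bt k (Q a b y) vac_mono = (a - of_int k) * md Am k y vac_mono + (b + of_int k) * md Ap k y vac_mono
    + Sum_any (\<lambda>m. vir k m y) vac_mono" by (simp add: smul_def)
  have Z0: "md Z k (\<Sum>j\<in>{1..k - 1}. vir (- k) j vac) = 0" for Z
    unfolding md_sum by (rule sum.neutral) (simp add: vir_def md_add md_smul md_vac_unbalanced[unfolded uminus_add_conv_diff])
  have Am: "md Am k y = smul ((b - of_int k) * of_int k) vac" and Ap: "md Ap k y = smul ((a + of_int k) * of_int k) vac"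
    unfolding y md_add md_smul Z0 md_vac2[OF k] using k by simp_all
  have "Sum_any (\<lambda>m. vir k m y) vac_mono = (\<Sum>m\<in>{- (k - 1)..- 1}. vir k m y vac_mono)"
    using k by (subst Sum_any_apply[OF vir_fin[OF yV]]) (auto intro!: fsum_superset vev_vir[OF yV])
  also have "\<dots> = (\<Sum>i\<in>{1..k - 1}. vir k (- i) y vac_mono)"
    by (rule sum.reindex_bij_witness[of _ uminus uminus]) auto
  also have "\<dots> = (\<Sum>i\<in>{1..k - 1}. - 2 * of_int k ^ 2)"
  proof (rule sum.cong[OF refl])
    fix i assume i: "i \<in> {1..k - 1}"
    have "vir k (- i) y = (\<Sum>j\<in>{1..k - 1}. smul (if j = k - i then - 2 * of_int k ^ 2 else 0) vac)"
      unfolding y vir_add vir_smul vir_sum vir_single[OF i] using vir_vir[OF i] by simp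
    also have "\<dots> = smul (\<Sum>j\<in>{1..k - 1}. if j = k - i then - 2 * of_int k ^ 2 else 0) vac"
      by (rule vs.scale_sum_left[symmetric])
    also have "(\<Sum>j\<in>{1..k - 1}. if j = k - i then - 2 * of_int k ^ 2 else 0) = (- 2 * of_int k ^ 2 :: complex)"
      using i by (subst sum.delta) auto
    finally show "vir k (- i) y vac_mono = - 2 * of_int k ^ 2" by (simp add: smul_def)
  qed
  also have "\<dots> = (of_int k - 1) * (- 2 * of_int k ^ 2)" using k by (simp add: of_nat_diff)
  \<comment> \<open>The terms linear in the alphas give k (a - k) (b - k) + k (a + k) (b + k) = 2 k
    (a b + k^2). The bilinear terms give -2 k^2 (k - 1), and the cubic powers of k cancel.\<close>
  finally show ?thesis
    unfolding y_def[symmetric] e Am Ap by (simp add: smul_def power2_eq_square algebra_simps)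
qed

lemma cc_op_Bt_vac: assumes "k > 0" shows "cc_op (md Bt (- k) vac) = smul (2 * of_int k) (md Cc (- k) vac)"
proof -
  have t: "smul (of_int n) (md Cc (- n) (md Cc n (md Bt (- k) vac))) =
     (if n = k then smul (of_int k) (md Cc (- k) vac) else 0) + (if n = - k then smul (of_int k) (md Cc (- k) vac) else 0)" for n
  proof (cases "n > 0")
    case True
    then show ?thesis using assms by (simp add: md_vac2 md_smul)
  next
    case False
    show ?thesis
    proof (cases "n = 0")
      case True then show ?thesis using assms by simp
    next
      case n: False
      have "md Cc (- n) (md Cc n (md Bt (- k) vac)) = - md Cc n (md Cc (- n) (md Bt (- k) vac))"
        by (rule cc_anti[OF md_VV[OF VL_VV[OF vac_VL]]])
      then show ?thesis using assms n False by (simp add: md_vac2 md_smul)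
    qed
  qed
  have f: "finite {n::int. (if n = c then x else 0) \<noteq> 0}" for c and x :: state
    by (rule finite_subset[of _ "{c}"]) (auto split: if_splits)
  show ?thesis unfolding cc_op_def t Sum_any.distrib[OF f f]
    by (rule ext) (simp add: smul_def)
qed

lemma Q_sq_Bt_vac:
  assumes k: "k > 0"
  shows "md Bt k (Q a b (Q a b (md Bt (- k) vac)) - smul (a * b + of_int k) (cc_op (md Bt (- k) vac))) vac_mono = 0"
  using k by (simp add: md_diff central_charge md_smul cc_op_Bt_vac md_vac2) (simp add: smul_def algebra_simps)

lemma raises_cc_op: "raises cc_op 0 2 2"
  unfolding cc_op_def by (intro raises_Sum_any raises_smul raises_eq[OF raises_pair]) auto

section \<open>The square of d on all monomials\<close>

lemma ex_bos_fld: "t < 4 \<Longrightarrow> \<exists>X. \<not> is_fer X \<and> cr_kind X = t"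
  by (rule exI[of _ "if t = 0 then Ap else if t = 1 then Am else if t = 2 then Be else Ga"]) auto
lemma ex_fer_fld: "t < 4 \<Longrightarrow> \<exists>X. is_fer X \<and> cr_kind X = t"
  by (rule exI[of _ "if t = 0 then Bt else if t = 1 then Cc else if t = 2 then Ze else Et"]) auto

lemma an_coeff_nonzero: "k > 0 \<Longrightarrow> an_coeff X k \<noteq> 0"
  by (cases X) auto

text \<open>An occupied mode would give a nonzero derivative in that mode. The derivative in a c
  creator is a mode of b, the one field not assumed to annihilate, so c creators are the only ones
  that can remain.\<close>

lemma annihilated_supp:
  assumes w: "w \<in> VL L" and a: "\<And>X k. X \<noteq> Bt \<Longrightarrow> k > 0 \<Longrightarrow> md X k w = 0" and n: "w \<nu> \<noteq> 0"
  shows "bos \<nu> = (\<lambda>_. 0)" "\<forall>x\<in>fer \<nu>. fst x = 1"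
proof -
  have v: "valid_mono \<nu>" using w n by (auto simp: VL_def)
  show "bos \<nu> = (\<lambda>_. 0)"
  proof (rule ccontr)
    assume "bos \<nu> \<noteq> (\<lambda>_. 0)"
    then obtain x where x: "bos \<nu> x \<noteq> 0" by (meson ext)
    then have ok: "fst x < 4" "snd x \<ge> 1" using v unfolding valid_mono_def by blast+
    obtain Y where Y: "\<not> is_fer Y" "cr_kind Y = fst x" using ex_bos_fld[OF ok(1)] by blast
    have "dual_fld Y \<noteq> Bt" using Y by (cases Y) auto
    then have "md (dual_fld Y) (int (snd x)) w = 0" using a ok by simp
    moreover have "md (dual_fld Y) (int (snd x)) w = smul (an_coeff (dual_fld Y) (int (snd x))) (anB x w)"
      using Y by (simp add: md_eq an_def)
    ultimately have "anB x w = 0" using an_coeff_nonzero[of "int (snd x)"] ok by simp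
    then have "anB x w (bos_upd x (\<lambda>k. k - 1) \<nu>) = 0" by simp
    moreover have "anB x w (bos_upd x (\<lambda>k. k - 1) \<nu>) = of_nat (bos \<nu> x) * w \<nu>"
      using x bos_upd_inv(1)[of \<nu> x] unfolding anB_def by (simp add: bos_upd_def of_nat_diff)
    ultimately show False using n x by simp
  qed
  show "\<forall>x\<in>fer \<nu>. fst x = 1"
  proof (rule ballI, rule ccontr)
    fix x assume x: "x \<in> fer \<nu>" and n1: "fst x \<noteq> 1"
    then have ok: "fst x < 4" "snd x \<ge> 1" using v unfolding valid_mono_def by blast+
    obtain Y where Y: "is_fer Y" "cr_kind Y = fst x" using ex_fer_fld[OF ok(1)] by blast
    have "dual_fld Y \<noteq> Bt" using Y n1 by (cases Y) auto
    then have "md (dual_fld Y) (int (snd x)) w = 0" using a ok by simp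
    moreover have "md (dual_fld Y) (int (snd x)) w = smul (an_coeff (dual_fld Y) (int (snd x))) (anF x w)"
      using Y by (simp add: md_eq an_def)
    ultimately have "anF x w = 0" using an_coeff_nonzero[of "int (snd x)"] ok by simp
    then have "anF x w (\<nu>\<lparr>fer := fer \<nu> - {x}\<rparr>) = 0" by simp
    moreover have "anF x w (\<nu>\<lparr>fer := fer \<nu> - {x}\<rparr>) = fsign x (fer \<nu> - {x}) * w \<nu>"
      unfolding anF_def fer_upd_inv[OF x] by simp
    ultimately show False using n by (simp add: fsign_def)
  qed
qed

text \<open>The defect of the formula on a monomial in the b's is annihilated by all annihilators except
 the b's, so it is a polynomial in the c creators alone, of nonnegative ghost number. Since the defect raises
 the ghost number by 2, at most two b's can occur, and the level excludes all but a single b.\<close>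

lemma sq_formula_b_only:
  assumes \<mu>: "valid_mono \<mu>" "bos \<mu> = (\<lambda>_. 0)" "\<forall>x\<in>fer \<mu>. fst x = 0"
    and IH: "\<And>\<kappa>. valid_mono \<kappa> \<Longrightarrow> level \<kappa> < level \<mu> \<Longrightarrow> sq_formula a b (int (level \<kappa>)) (pt \<kappa>)"
  shows "sq_formula a b (int (level \<mu>)) (pt \<mu>)"
proof -
  define L where "L = int (level \<mu>)"
  define w where "w = Q a b (Q a b (pt \<mu>)) - smul (a * b + of_int L) (cc_op (pt \<mu>))"
  have u: "pt \<mu> \<in> VL L" unfolding L_def by (rule pt_VL[OF \<mu>(1)])
  have MV: "cc_op (pt \<mu>) \<in> VL L" using raises_VL[OF raises_cc_op u] by simp
  have wV: "w \<in> VL L" 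
    unfolding w_def diff_conv_add_uminus by (intro VL_add VL_uminus VL_smul Q_VL u MV)
  have ann: "md X k w = 0" if X: "X \<noteq> Bt" and k: "k > 0" for X k
  proof -
    have "sq_formula a b (L - k) (md X k (pt \<mu>))"
    \<comment> \<open>On a monomial in the b's the only annihilators that act nontrivially, apart
      from those of b, are the c_k that remove an occupied b. The result has lower level, so the
      induction hypothesis applies.\<close>
    proof (cases "X = Cc \<and> (0, nat k) \<in> fer \<mu>")
      case True
      let ?\<kappa> = "\<mu>\<lparr>fer := fer \<mu> - {(0, nat k)}\<rparr>"
      have \<mu>': "?\<kappa>\<lparr>fer := insert (0, nat k) (fer ?\<kappa>)\<rparr> = \<mu>" by (rule fer_upd_inv) (use True in simp)
      have v: "valid_mono ?\<kappa>" using \<mu>(1) by (auto simp: valid_mono_def)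
      have "int (level \<mu>) = int (level ?\<kappa>) + k"
        using level_fer_upd[OF v, of "(0, nat k)"] k unfolding \<mu>' by simp
      then have l: "L - k = int (level ?\<kappa>)" "level ?\<kappa> < level \<mu>" using k by (simp_all add: L_def)
      have "md X k (pt \<mu>) = smul (fsign (0, nat k) (fer \<mu> - {(0, nat k)})) (pt ?\<kappa>)"
        using True k anF_pt_in[of "(0, nat k)" \<mu>] by (simp add: md_eq an_def)
      then show ?thesis unfolding l(1) using sq_formula_smul[OF IH[OF v l(2)]] by simp
    next
      case False
      have "an (is_fer X) (cr_kind (dual_fld X), nat k) (pt \<mu>) = 0"
        using False X \<mu> k unfolding an_def
        by (cases X) (auto intro!: anB_pt anF_pt)
      then have "md X k (pt \<mu>) = 0" using k by (simp add: md_eq)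
      then show ?thesis by (simp only: sq_formula_zero)
    qed
    then show ?thesis unfolding w_def by (rule sq_formula_annihilated[OF u X])
  qed
  have gh\<mu>: "ghost \<mu> = - int (card (fer \<mu>))"
  proof -
    have e: "{x \<in> fer \<mu>. fst x = 0} = fer \<mu>" "{x \<in> fer \<mu>. fst x = 1} = {}" "{x \<in> fer \<mu>. fst x = 2} = {}" "{x \<in> fer \<mu>. fst x = 3} = {}"
      using \<mu>(3) by auto
    show ?thesis unfolding ghost_def e by simp
  qed
  have fin\<mu>: "finite (fer \<mu>)" using \<mu>(1) by (simp add: valid_mono_def)
  have "w \<nu> = 0" for \<nu>
  proof (rule ccontr)
    assume n: "w \<nu> \<noteq> 0"
    have v: "valid_mono \<nu>" and lv: "int (level \<nu>) = L" using wV n by (auto simp: VL_def)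
    note s = annihilated_supp[OF wV ann n]
    have gh\<nu>: "ghost \<nu> = int (card (fer \<nu>))"
    proof -
      have e: "{x \<in> fer \<nu>. fst x = 1} = fer \<nu>" "{x \<in> fer \<nu>. fst x = 0} = {}" "{x \<in> fer \<nu>. fst x = 2} = {}" "{x \<in> fer \<nu>. fst x = 3} = {}"
        using s(2) by auto
      show ?thesis unfolding ghost_def e by simp
    qed
    have "Q a b (Q a b (pt \<mu>)) \<nu> \<noteq> 0 \<or> cc_op (pt \<mu>) \<nu> \<noteq> 0" using n by (auto simp: w_def smul_def)
    then have "ghost \<nu> = ghost \<mu> + 2"
    proof
      assume "Q a b (Q a b (pt \<mu>)) \<nu> \<noteq> 0"
      then obtain \<kappa> where 1: "Q a b (pt \<mu>) \<kappa> \<noteq> 0" "ghost \<nu> = ghost \<kappa> + 1"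
        using Q_ghost[OF VL_VV[OF Q_VL[OF u]]] by blast
      then obtain \<kappa>' where 2: "pt \<mu> \<kappa>' \<noteq> 0" "ghost \<kappa> = ghost \<kappa>' + 1"
        using Q_ghost[OF VL_VV[OF u]] by blast
      have "\<kappa>' = \<mu>" using 2(1) by (auto split: if_splits)
      then show ?thesis using 1 2 by simp
    next
      assume "cc_op (pt \<mu>) \<nu> \<noteq> 0"
      then obtain \<kappa>' where 2: "pt \<mu> \<kappa>' \<noteq> 0" "ghost \<nu> = ghost \<kappa>' + 2"
        by (rule raisesD[OF raises_cc_op VL_VV[OF u]])
      have "\<kappa>' = \<mu>" using 2(1) by (auto split: if_splits)
      then show ?thesis using 2 by simp
    qed
    then have c: "card (fer \<nu>) + card (fer \<mu>) = 2" using gh\<mu> gh\<nu> by simp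
    have fin\<nu>: "finite (fer \<nu>)" using v by (simp add: valid_mono_def)
    have lev: "level \<kappa> = (\<Sum>x\<in>fer \<kappa>. snd x)" if "bos \<kappa> = (\<lambda>_. 0)" for \<kappa>
      using that by (simp add: level_def)
    consider "card (fer \<mu>) = 0" | "card (fer \<nu>) = 0" | "card (fer \<mu>) = 1" "card (fer \<nu>) = 1" using c by linarith
    then show False
    proof cases
      case 1
      then have "L = 0" using fin\<mu> lev[OF \<mu>(2)] by (simp add: L_def)
      then have "\<nu> = vac_mono" using level_zero[OF v] lv by simp
      then show False using c 1 by (simp add: vac_mono_def)
    next
      case 2
      then have "L = 0" using fin\<nu> lev[OF s(1)] lv by simp
      then have "\<mu> = vac_mono" using level_zero[OF \<mu>(1)] by (simp add: L_def)
      then show False using c 2 by (simp add: vac_mono_def)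
    next
      case 3
      obtain x where x: "fer \<mu> = {x}" using 3(1) card_1_singletonE by blast
      obtain y where y: "fer \<nu> = {y}" using 3(2) card_1_singletonE by blast
      define k where "k = int (snd x)"
      have k: "k > 0" using \<mu>(1) x by (simp add: valid_mono_def k_def)
      have xk: "x = (0, nat k)" using \<mu>(3) x by (simp add: k_def prod_eq_iff)
      have Lk: "L = k" using lev[OF \<mu>(2)] x by (simp add: L_def k_def)
      have yk: "y = (1, nat k)" using s(2) y lev[OF s(1)] lv Lk by (simp add: prod_eq_iff)
      have \<nu>: "\<nu> = vac_mono\<lparr>fer := {(1, nat k)}\<rparr>" using s(1) y yk by (cases \<nu>) (simp add: vac_mono_def)
      have \<mu>e: "\<mu> = vac_mono\<lparr>fer := insert (0, nat k) (fer vac_mono)\<rparr>" using \<mu>(2) x xk by (cases \<mu>) (simp add: vac_mono_def)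
      have "fsign f {} = 1" for f by (simp add: fsign_def)
      then have "pt \<mu> = md Bt (- k) vac"
        using crF_pt[of "(0, nat k)" vac_mono] k unfolding \<mu>e by (simp add: md_eq cr_def vac_mono_def)
      then have "md Bt k w vac_mono = 0" unfolding w_def Lk using Q_sq_Bt_vac[OF k, of a b] by simp
      moreover have "md Bt k w vac_mono = w \<nu>"
        using k by (simp add: md_eq an_def smul_def anF_def \<nu> fsign_def) (simp add: vac_mono_def)
      ultimately show False using n by simp
    qed
  qed
  then have "w = 0" by (simp add: fun_eq_iff)
  then show ?thesis unfolding sq_formula_def w_def L_def[symmetric] by (simp only: right_minus_eq)
qed

text \<open>By induction on the level: any creator other than b is stripped off with
  \<open>sq_formula_md\<close>, and a monomial in the b's alone is left to
  \<open>sq_formula_b_only\<close>.\<close>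

lemma sq_formula_pt: "valid_mono \<mu> \<Longrightarrow> sq_formula a b (int (level \<mu>)) (pt \<mu>)"
proof (induction "level \<mu>" arbitrary: \<mu> rule: less_induct)
  case less
  note v = \<open>valid_mono \<mu>\<close>
  show ?case
  proof (cases "\<exists>x. bos \<mu> x \<noteq> 0")
    case True
    then obtain x where x: "bos \<mu> x \<noteq> 0" by blast
    then have ok: "fst x < 4" "snd x \<ge> 1" using v unfolding valid_mono_def by blast+
    obtain Y where Y: "\<not> is_fer Y" "cr_kind Y = fst x" using ex_bos_fld[OF ok(1)] by blast
    let ?\<kappa> = "bos_upd x (\<lambda>k. k - 1) \<mu>"
    have \<mu>: "bos_upd x Suc ?\<kappa> = \<mu>" using x by (intro bos_upd_inv(1)) simp
    have vk: "valid_mono ?\<kappa>" using v valid_bos_upd[of x ?\<kappa>] unfolding \<mu> by blast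
    have l: "int (level \<mu>) = int (level ?\<kappa>) + int (snd x)" using level_bos_upd[OF vk, of x] unfolding \<mu> .
    have "sq_formula a b (int (level ?\<kappa>)) (pt ?\<kappa>)" using l ok by (intro less.hyps vk) simp
    then have "sq_formula a b (int (level ?\<kappa>) - - int (snd x)) (md Y (- int (snd x)) (pt ?\<kappa>))"
      using Y by (intro sq_formula_md[OF pt_VL[OF vk]]) auto
    moreover have "md Y (- int (snd x)) (pt ?\<kappa>) = pt \<mu>"
      using Y ok crB_pt[of x ?\<kappa>] unfolding \<mu> by (simp add: md_eq cr_def)
    ultimately show ?thesis using l by simp
  next
    case b0: False
    show ?thesis
    proof (cases "\<exists>x\<in>fer \<mu>. fst x \<noteq> 0")
      case True
      then obtain x where x: "x \<in> fer \<mu>" "fst x \<noteq> 0" by blast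
      then have ok: "fst x < 4" "snd x \<ge> 1" using v unfolding valid_mono_def by blast+
      obtain Y where Y: "is_fer Y" "cr_kind Y = fst x" using ex_fer_fld[OF ok(1)] by blast
      have YB: "Y \<noteq> Bt" using Y x by auto
      let ?\<kappa> = "\<mu>\<lparr>fer := fer \<mu> - {x}\<rparr>"
      have \<mu>: "?\<kappa>\<lparr>fer := insert x (fer ?\<kappa>)\<rparr> = \<mu>" by (rule fer_upd_inv[OF x(1)])
      have nx: "x \<notin> fer ?\<kappa>" by simp
      have vk: "valid_mono ?\<kappa>" using v by (auto simp: valid_mono_def)
      have l: "int (level \<mu>) = int (level ?\<kappa>) + int (snd x)" using level_fer_upd[OF vk nx] unfolding \<mu> .
      have "sq_formula a b (int (level ?\<kappa>)) (pt ?\<kappa>)" using l ok by (intro less.hyps vk) simp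
      then have "sq_formula a b (int (level ?\<kappa>) - - int (snd x)) (md Y (- int (snd x)) (pt ?\<kappa>))"
        by (intro sq_formula_md[OF pt_VL[OF vk] YB])
      moreover have "md Y (- int (snd x)) (pt ?\<kappa>) = smul (fsign x (fer ?\<kappa>)) (pt \<mu>)"
        using Y ok crF_pt[OF nx] unfolding \<mu> by (simp add: md_eq cr_def)
      ultimately have "sq_formula a b (int (level \<mu>)) (smul (fsign x (fer ?\<kappa>)) (pt \<mu>))" using l by simp
      \<comment> \<open>Creating a fermion produces a sign; multiplying by the same sign again
        removes it.\<close>
      then have "sq_formula a b (int (level \<mu>)) (smul (fsign x (fer ?\<kappa>)) (smul (fsign x (fer ?\<kappa>)) (pt \<mu>)))"
        by (rule sq_formula_smul)
      then show ?thesis by (simp only: vs.scale_scale fsign_sq(2) vs.scale_one)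
    next
      case False
      show ?thesis
      proof (rule sq_formula_b_only[OF v])
        show "bos \<mu> = (\<lambda>_. 0)" using b0 by blast
        show "\<forall>x\<in>fer \<mu>. fst x = 0" using False by blast
      qed (rule less.hyps)
    qed
  qed
qed

theorem Q_sq: assumes v: "v \<in> VL L" shows "Q a b (Q a b v) = smul (a * b + of_int L) (cc_op v)"
proof -
  have "sq_formula a b L (\<Sum>\<mu>\<in>level_monos L. smul (v \<mu>) (pt \<mu>))"
    by (rule sq_formula_sum) (auto intro!: VL_smul pt_VL sq_formula_smul sq_formula_pt)
  then show ?thesis unfolding VL_expand[OF v, symmetric] by (simp only: sq_formula_def)
qed

subsection \<open>A contracting homotopy for the leading part\<close>

text \<open>Uses \<open>inverse 0 = 0\<close>: no homotopy is applied to the pair with vanishing coefficient, nor at n = 0.\<close>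

definition hom_term :: "complex \<Rightarrow> int \<Rightarrow> state \<Rightarrow> state" where
  "hom_term a n v = smul (inverse (of_int \<bar>n\<bar> * (a - of_int n))) (md Ap (- n) (md Bt n v))
     + smul (of_int (sgn n)) (md Ze (- n) (md Ga n v))"

definition hom0 :: "complex \<Rightarrow> int \<Rightarrow> state \<Rightarrow> state" where
  "hom0 a N v = (\<Sum>n\<in>{-N..N}. hom_term a n v)"

lemma hom_term_add: "hom_term a n (v + w) = hom_term a n v + hom_term a n w"
  by (simp add: hom_term_def md_add smul_add)
lemma hom_term_smul: "hom_term a n (smul c v) = smul c (hom_term a n v)"
  by (simp add: hom_term_def md_smul smul_add mult.commute)
lemma hom0_add: "hom0 a N (v + w) = hom0 a N v + hom0 a N w"
  by (simp add: hom0_def hom_term_add sum.distrib)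
lemma hom0_smul: "hom0 a N (smul c v) = smul c (hom0 a N v)"
  by (simp add: hom0_def hom_term_smul vs.scale_sum_right)

lemma raises_hom_term: "raises (hom_term a n) 0 (-1) 0"
  unfolding hom_term_def by (intro raises_add raises_smul raises_eq[OF raises_pair]) auto
lemma raises_hom0: "raises (hom0 a N) 0 (-1) 0"
  unfolding hom0_def by (intro raises_sum raises_hom_term)

lemma Q0_eq_sum: "v \<in> VL N \<Longrightarrow> Q0 a v = (\<Sum>n\<in>{-N..N}. term0 a n v)"
  unfolding Q0_def by (rule Sum_any.expand_superset) (auto dest: term0_kill)

lemma term0_sum: "term0 a n (sum f A) = (\<Sum>i\<in>A. term0 a n (f i))"
  using sum_comp_morphism[of "term0 a n" f A] term0_smul[of a n 0 0] by (simp only: comp_def term0_add vs.scale_zero_left)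
lemma hom_term_sum: "hom_term a n (sum f A) = (\<Sum>i\<in>A. hom_term a n (f i))"
  using sum_comp_morphism[of "hom_term a n" f A] hom_term_smul[of a n 0 0] by (simp only: comp_def hom_term_add vs.scale_zero_left)

lemma pair_anticomm:
  assumes v: "v \<in> VV" and s: "exch A Z * exch B Z * (exch A W * exch B W) = -1"
  shows "md A i (md B j (md Z k (md W l v))) = - md Z k (md W l (md A i (md B j v)))
     + smul (exch A Z * exch B Z) (md Z k (contr_pair A i B j W l v)) + contr_pair A i B j Z k (md W l v)"
proof -
  have p1: "md A i (md B j (md Z k (md W l v))) = smul (exch A Z * exch B Z) (md Z k (md A i (md B j (md W l v))))
     + contr_pair A i B j Z k (md W l v)" by (rule pair_comm[OF md_VV[OF v]])
  have p2: "md A i (md B j (md W l v)) = smul (exch A W * exch B W) (md W l (md A i (md B j v))) + contr_pair A i B j W l v"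
    by (rule pair_comm[OF v])
  have "md A i (md B j (md Z k (md W l v))) = smul (exch A Z * exch B Z) (md Z k (smul (exch A W * exch B W) (md W l (md A i (md B j v))) + contr_pair A i B j W l v))
     + contr_pair A i B j Z k (md W l v)"
    by (subst p1, subst p2) (rule refl)
  then show ?thesis
    unfolding md_add md_smul smul_add vs.scale_scale s by simp
qed

text \<open>The anticommutator of matching summands of d_0 and the homotopy. The alpha and bc
  bilinears have eigenvalues |n| times an occupation number up to sign, which is why
  \<open>hom_term\<close> carries 1/|n|. If a = n, the first coefficient is 0 by the convention on
  \<open>inverse\<close>.\<close>

definition num_term :: "complex \<Rightarrow> int \<Rightarrow> state \<Rightarrow> state" where
  "num_term a n v = smul ((a - of_int n) * inverse (of_int \<bar>n\<bar> * (a - of_int n))) (md Ap (- n) (md Am n v) + smul (of_int n) (md Cc (- n) (md Bt n v)))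
     + smul (of_int (sgn n)) (md Ze (- n) (md Et n v) + md Be (- n) (md Ga n v))"

lemma term0_term0: assumes v: "v \<in> VV" shows "term0 a n (term0 a m v) = - term0 a m (term0 a n v)"
proof -
  have 1: "md Cc (- n) (md Am n (md Cc (- m) (md Am m v))) = - md Cc (- m) (md Am m (md Cc (- n) (md Am n v)))"
    using pair_anticomm[OF v, of Cc Cc Am Am "- n" n "- m" m] by (simp add: exch_def contr_pair_def)
  have 2: "md Cc (- n) (md Am n (md Et m (md Be (- m) v))) = - md Et m (md Be (- m) (md Cc (- n) (md Am n v)))" for n m
    using pair_anticomm[OF v, of Cc Et Am Be "- n" n "m" "- m"] by (simp add: exch_def contr_pair_def)
  have 3: "md Et n (md Be (- n) (md Et m (md Be (- m) v))) = - md Et m (md Be (- m) (md Et n (md Be (- n) v)))"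
    using pair_anticomm[OF v, of Et Et Be Be "n" "- n" "m" "- m"] by (simp add: exch_def contr_pair_def)
  show ?thesis
    unfolding term0_def md_add md_smul 1 2 3
    by (rule ext) (simp add: smul_def algebra_simps)
qed

lemma Q0_Q0: assumes v: "v \<in> VL N" shows "Q0 a (Q0 a v) = 0"
proof -
  let ?W = "{-N..N}"
  have e: "Q0 a (Q0 a v) = (\<Sum>n\<in>?W. \<Sum>m\<in>?W. term0 a n (term0 a m v))"
    by (subst Q0_eq_sum[OF Q0_VL[OF v]], subst Q0_eq_sum[OF v]) (simp only: term0_sum)
  also have "\<dots> = (\<Sum>n\<in>?W. \<Sum>m\<in>?W. - term0 a m (term0 a n v))"
    by (intro sum.cong refl) (rule term0_term0[OF VL_VV[OF v]])
  also have "\<dots> = - (\<Sum>n\<in>?W. \<Sum>m\<in>?W. term0 a m (term0 a n v))"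
    by (simp only: sum_negf)
  also have "(\<Sum>n\<in>?W. \<Sum>m\<in>?W. term0 a m (term0 a n v)) = Q0 a (Q0 a v)"
    unfolding e by (rule sum.swap)
  finally have "Q0 a (Q0 a v) = - Q0 a (Q0 a v)" .
  then show ?thesis by (auto simp: fun_eq_iff)
qed

lemma term0_hom_term: assumes v: "v \<in> VV"
  shows "term0 a n (hom_term a m v) + hom_term a m (term0 a n v) = (if n = m then num_term a n v else 0)"
proof -
  note z = md_zero_mode[OF v] md_zero_mode[OF md_VV[OF v]]
  have 1: "md Cc (- n) (md Am n (md Ap (- m) (md Bt m v))) = - md Ap (- m) (md Bt m (md Cc (- n) (md Am n v)))
    + (if n = m then md Ap (- n) (md Am n v) + smul (of_int n) (md Cc (- n) (md Bt n v)) else 0)"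
    using pair_anticomm[OF v, of Cc Ap Am Bt "- n" n "- m" m] z by (cases "n = m"; cases "n = 0") (simp_all add: exch_def contr_pair_def)
  have 2: "md Cc (- n) (md Am n (md Ze (- m) (md Ga m v))) = - md Ze (- m) (md Ga m (md Cc (- n) (md Am n v)))"
    using pair_anticomm[OF v, of Cc Ze Am Ga "- n" n "- m" m] by (simp add: exch_def contr_pair_def)
  have 3: "md Et n (md Be (- n) (md Ap (- m) (md Bt m v))) = - md Ap (- m) (md Bt m (md Et n (md Be (- n) v)))"
    using pair_anticomm[OF v, of Et Ap Be Bt "n" "- n" "- m" m] by (simp add: exch_def contr_pair_def)
  have 4: "md Et n (md Be (- n) (md Ze (- m) (md Ga m v))) = - md Ze (- m) (md Ga m (md Et n (md Be (- n) v)))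
    + (if n = m then md Ze (- n) (md Et n v) + md Be (- n) (md Ga n v) else 0)"
    using pair_anticomm[OF v, of Et Ze Be Ga "n" "- n" "- m" m] z by (cases "n = m"; cases "n = 0") (simp_all add: exch_def contr_pair_def md_uminus)
  show ?thesis
    unfolding term0_def hom_term_def num_term_def md_add md_smul 1 2 3 4
    by (rule ext) (auto simp: smul_def algebra_simps)
qed

lemma cr_an_number:
  assumes "v \<in> VV"
  shows "crB x (anB x v) \<mu> = of_nat (bos \<mu> x) * v \<mu>"
    "crF f (anF f v) \<mu> = (if f \<in> fer \<mu> then v \<mu> else 0)"
proof -
  show "crB x (anB x v) \<mu> = of_nat (bos \<mu> x) * v \<mu>"
  proof (cases "bos \<mu> x")
    case (Suc k)
    then show ?thesis using bos_upd_inv(1)[of \<mu> x] by (simp add: crB_def anB_def) (simp add: bos_upd_def)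
  qed (simp add: crB_def)
  show "crF f (anF f v) \<mu> = (if f \<in> fer \<mu> then v \<mu> else 0)"
    using fer_upd_inv[of f \<mu>] by (simp add: crF_def anF_def fsign_sq)
qed

text \<open>Positive n counts the creators of alpha+, c, beta and zeta at index n, negative n those
  of alpha-, b, gamma and eta-tilde at index |n|. At a = n the pair from alpha and the bc ghosts is
  left out, because its coefficient in d_0 vanishes.\<close>

definition nu1 :: "complex \<Rightarrow> int \<Rightarrow> mono \<Rightarrow> nat" where
  "nu1 a n \<mu> = (if n > 0 then (if a = of_int n then 0 else bos \<mu> (0, nat n) + (if (1, nat n) \<in> fer \<mu> then 1 else 0))
        + bos \<mu> (2, nat n) + (if (2, nat n) \<in> fer \<mu> then 1 else 0)
     else if n < 0 then (if a = of_int n then 0 else bos \<mu> (1, nat (- n)) + (if (0, nat (- n)) \<in> fer \<mu> then 1 else 0))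
        + bos \<mu> (3, nat (- n)) + (if (3, nat (- n)) \<in> fer \<mu> then 1 else 0)
     else 0)"

lemma num_term_nu1: assumes v: "v \<in> VV" shows "num_term a n v \<mu> = of_nat (nu1 a n \<mu>) * v \<mu>"
proof -
  consider "n = 0" | "n > 0" | "n < 0" by linarith
  then show ?thesis
  proof cases
    case 1
    then show ?thesis by (simp add: num_term_def nu1_def)
  next
    case 2
    have c: "(a - of_int n) * inverse (of_int \<bar>n\<bar> * (a - of_int n)) = (if a = of_int n then 0 else inverse (of_int n))"
      using 2 by (simp add: field_simps)
    show ?thesis unfolding num_term_def c using 2
      by (simp add: md_eq cr_def an_def op_smul[of False, unfolded cr_def an_def, simplified] smul_def[of _ "_ + _"] nu1_def)
        (simp add: smul_def cr_an_number[OF v] field_simps)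
  next
    case 3
    define k where "k = - n"
    have k: "k > 0" and n: "n = - k" using 3 by (simp_all add: k_def)
    have c: "(a - of_int n) * inverse (of_int \<bar>n\<bar> * (a - of_int n)) = (if a = of_int n then 0 else inverse (of_int k))"
    proof (cases "a = of_int n")
      case False
      then have "a - of_int n \<noteq> 0" by simp
      moreover have "of_int \<bar>n\<bar> = (of_int k :: complex)" using k by (simp add: n)
      ultimately show ?thesis using False by simp
    qed simp
    \<comment> \<open>For negative n the annihilators stand on the left. The constants produced by
      reordering cancel between each boson and its fermionic partner.\<close>
    have aB: "anB x (crB x v) \<mu> = of_nat (bos \<mu> x) * v \<mu> + v \<mu>" for x
      by (simp add: anB_crB cr_an_number[OF v])
    have aF: "anF x (crF x v) \<mu> = v \<mu> - (if x \<in> fer \<mu> then v \<mu> else 0)" for x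
      by (simp add: anF_crF[OF v] cr_an_number[OF v])
    show ?thesis unfolding num_term_def c using k
      by (simp add: md_eq cr_def an_def n nu1_def)
        (simp add: smul_def aB aF field_simps)
  qed
qed

definition nu :: "complex \<Rightarrow> int \<Rightarrow> mono \<Rightarrow> nat" where
  "nu a N \<mu> = (\<Sum>n\<in>{-N..N}. nu1 a n \<mu>)"

definition num_op :: "complex \<Rightarrow> int \<Rightarrow> state \<Rightarrow> state" where
  "num_op a N v = (\<lambda>\<mu>. of_nat (nu a N \<mu>) * v \<mu>)"
text \<open>\<open>num_inv\<close> kills the states of eigenvalue 0, as \<open>x / 0 = 0\<close>.\<close>
definition num_inv :: "complex \<Rightarrow> int \<Rightarrow> state \<Rightarrow> state" where
  "num_inv a N v = (\<lambda>\<mu>. v \<mu> / of_nat (nu a N \<mu>))"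
definition exc :: "complex \<Rightarrow> int \<Rightarrow> state \<Rightarrow> state" where
  "exc a N v = (\<lambda>\<mu>. if nu a N \<mu> = 0 then v \<mu> else 0)"

lemma VL_subset: "v \<in> VL N \<Longrightarrow> (\<And>\<mu>. w \<mu> \<noteq> 0 \<Longrightarrow> v \<mu> \<noteq> 0) \<Longrightarrow> w \<in> VL N"
  by (auto simp: VL_def)

lemma num_op_VL: "v \<in> VL N \<Longrightarrow> num_op a N v \<in> VL N" and num_inv_VL: "v \<in> VL N \<Longrightarrow> num_inv a N v \<in> VL N"
  and exc_VL: "v \<in> VL N \<Longrightarrow> exc a N v \<in> VL N"
  by (erule VL_subset; simp add: num_op_def num_inv_def exc_def split: if_splits)+

lemma hom0_VL: "v \<in> VL N \<Longrightarrow> hom0 a M' v \<in> VL N"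
  using raises_VL[OF raises_hom0] by simp

lemma Q0_hom0: assumes v: "v \<in> VL N"
  shows "Q0 a (hom0 a N v) + hom0 a N (Q0 a v) = num_op a N v"
proof -
  let ?W = "{-N..N}"
  have "Q0 a (hom0 a N v) = (\<Sum>n\<in>?W. \<Sum>m\<in>?W. term0 a n (hom_term a m v))"
    unfolding Q0_eq_sum[OF hom0_VL[OF v]] unfolding hom0_def term0_sum ..
  moreover have "hom0 a N (Q0 a v) = (\<Sum>n\<in>?W. \<Sum>m\<in>?W. hom_term a m (term0 a n v))"
    unfolding Q0_eq_sum[OF v] hom0_def hom_term_sum by (rule sum.swap)
  ultimately have "Q0 a (hom0 a N v) + hom0 a N (Q0 a v) = (\<Sum>n\<in>?W. \<Sum>m\<in>?W. if n = m then num_term a n v else 0)"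
    by (simp only: sum.distrib[symmetric] term0_hom_term[OF VL_VV[OF v]])
  also have "\<dots> = (\<Sum>n\<in>?W. num_term a n v)"
    by (rule sum.cong[OF refl], subst sum.delta') auto
  also have "\<dots> = num_op a N v"
    by (rule ext) (simp add: sum_state_apply num_term_nu1[OF VL_VV[OF v]] num_op_def nu_def sum_distrib_right)
  finally show ?thesis .
qed

lemma anB_zero_if_unoccupied: "(\<And>\<mu>. w \<mu> \<noteq> 0 \<Longrightarrow> bos \<mu> x = 0) \<Longrightarrow> anB x w = 0"
proof (rule ext)
  fix \<nu> :: mono assume a: "\<And>\<mu>. w \<mu> \<noteq> 0 \<Longrightarrow> bos \<mu> x = 0"
  have "bos (bos_upd x Suc \<nu>) x \<noteq> 0" by (simp add: bos_upd_def)
  then have "w (bos_upd x Suc \<nu>) = 0" using a[of "bos_upd x Suc \<nu>"] by fastforce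
  then show "anB x w \<nu> = 0 \<nu>" by (simp add: anB_def)
qed

lemma anF_zero_if_unoccupied: "(\<And>\<mu>. w \<mu> \<noteq> 0 \<Longrightarrow> f \<notin> fer \<mu>) \<Longrightarrow> anF f w = 0"
proof (rule ext)
  fix \<nu> :: mono assume a: "\<And>\<mu>. w \<mu> \<noteq> 0 \<Longrightarrow> f \<notin> fer \<mu>"
  have "f \<in> fer (\<nu>\<lparr>fer := insert f (fer \<nu>)\<rparr>)" by simp
  then have "w (\<nu>\<lparr>fer := insert f (fer \<nu>)\<rparr>) = 0" using a[of "\<nu>\<lparr>fer := insert f (fer \<nu>)\<rparr>"] by fastforce
  then show "anF f w \<nu> = 0 \<nu>" by (simp add: anF_def)
qed

text \<open>Each summand of d_0 either has coefficient 0 or contains an annihilator of a counted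
  mode, which these monomials do not occupy. Hence all of the kernel of the number operator consists
  of d_0-cocycles.\<close>

lemma Q0_exc: assumes v: "v \<in> VL N" shows "Q0 a (exc a N v) = 0"
proof -
  let ?w = "exc a N v"
  have w: "?w \<in> VL N" by (rule exc_VL[OF v])
  have n0: "nu1 a n \<mu> = 0" if "?w \<mu> \<noteq> 0" "n \<in> {-N..N}" for \<mu> n
    using that by (auto simp: exc_def nu_def split: if_splits)
  have sw: "md Cc (- n) (md Am n ?w) = md Am n (md Cc (- n) ?w)" "md Et n (md Be (- n) ?w) = md Be (- n) (md Et n ?w)" for n
    using pair_swap[OF VL_VV[OF w], of Cc Am "- n" n] pair_swap[OF VL_VV[OF w], of Et Be "n" "- n"] by (simp_all add: exch_def)
  have "term0 a n ?w = 0" if n: "n \<in> {-N..N}" for n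
  proof -
    consider "n = 0" | "n > 0" | "n < 0" by linarith
    then show ?thesis
    proof cases
      case 1
      then show ?thesis using md_zero_mode[OF VL_VV[OF w]] md_zero_mode[OF md_VV[OF VL_VV[OF w]]] by (simp add: term0_def)
    next
      case 2
      have "anF (2, nat n) ?w = 0" 
        by (rule anF_zero_if_unoccupied) (use n0[OF _ n] 2 in \<open>fastforce simp: nu1_def\<close>)
      then have e: "md Et n ?w = 0" using 2 by (simp add: md_eq an_def)
      show ?thesis
      proof (cases "a = of_int n")
        case True then show ?thesis using sw(2)[of n] e by (simp add: term0_def)
      next
        case False
        have "anB (0, nat n) ?w = 0"
          by (rule anB_zero_if_unoccupied) (use n0[OF _ n] 2 False in \<open>fastforce simp: nu1_def\<close>)
        then have "md Am n ?w = 0" using 2 by (simp add: md_eq an_def)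
        then show ?thesis using sw(2)[of n] e by (simp add: term0_def)
      qed
    next
      case 3
      have "anB (3, nat (- n)) ?w = 0" 
        by (rule anB_zero_if_unoccupied) (use n0[OF _ n] 3 in \<open>fastforce simp: nu1_def\<close>)
      then have e: "md Be (- n) ?w = 0" using 3 by (simp add: md_eq an_def)
      show ?thesis
      proof (cases "a = of_int n")
        case True then show ?thesis using e by (simp add: term0_def)
      next
        case False
        have "anF (0, nat (- n)) ?w = 0"
          by (rule anF_zero_if_unoccupied) (use n0[OF _ n] 3 False in \<open>fastforce simp: nu1_def\<close>)
        then have "md Cc (- n) ?w = 0" using 3 by (simp add: md_eq an_def)
        then show ?thesis using sw(1)[of n] e by (simp add: term0_def)
      qed
    qed
  qed
  then show ?thesis unfolding Q0_eq_sum[OF w] by simp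
qed

text \<open>Dividing by the eigenvalue turns the identity {d_0, hom0} = number operator into {d_0,
  hom} = 1 - exc.\<close>

definition hom :: "complex \<Rightarrow> int \<Rightarrow> state \<Rightarrow> state" where
  "hom a N v = hom0 a N (num_inv a N v)"

lemma num_op_num_inv: "num_op a N (num_inv a N v) = v - exc a N v"
  by (rule ext) (simp add: num_op_def num_inv_def exc_def)
lemma num_inv_num_op: "num_inv a N (num_op a N v) = v - exc a N v"
  by (rule ext) (simp add: num_op_def num_inv_def exc_def)
lemma exc_num_op: "exc a N (num_op a N v) = 0"
  by (rule ext) (simp add: num_op_def exc_def)
lemma num_inv_add: "num_inv a N (v + w) = num_inv a N v + num_inv a N w"
  by (rule ext) (simp add: num_inv_def add_divide_distrib)
lemma exc_add: "exc a N (v + w) = exc a N v + exc a N w"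
  by (rule ext) (simp add: exc_def)
lemma exc_smul: "exc a N (smul c v) = smul c (exc a N v)"
  by (rule ext) (simp add: exc_def smul_def)
lemma exc_diff: "exc a N (v - w) = exc a N v - exc a N w"
  by (rule ext) (simp add: exc_def)
lemma hom_add: "hom a N (v + w) = hom a N v + hom a N w"
  by (simp add: hom_def num_inv_add hom0_add)
lemma hom_zero [simp]: "hom a N 0 = 0"
proof -
  have "num_inv a N 0 = 0" by (rule ext) (simp add: num_inv_def)
  then show ?thesis unfolding hom_def using hom0_smul[of a N 0 0] by simp
qed

lemma Q0_num_op: assumes v: "v \<in> VL N" shows "Q0 a (num_op a N v) = num_op a N (Q0 a v)"
proof -
  have "Q0 a (num_op a N v) = Q0 a (Q0 a (hom0 a N v)) + Q0 a (hom0 a N (Q0 a v))"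
    unfolding Q0_hom0[OF v, symmetric] by (rule Q0_add[OF Q0_VL[OF hom0_VL[OF v]] hom0_VL[OF Q0_VL[OF v]]])
  also have "Q0 a (Q0 a (hom0 a N v)) = 0" by (rule Q0_Q0[OF hom0_VL[OF v]])
  also have "0 + Q0 a (hom0 a N (Q0 a v)) = Q0 a (hom0 a N (Q0 a v)) + hom0 a N (Q0 a (Q0 a v))"
    unfolding Q0_Q0[OF v] using hom0_smul[of a N 0 0] by simp
  also have "\<dots> = num_op a N (Q0 a v)" by (rule Q0_hom0[OF Q0_VL[OF v]])
  finally show ?thesis .
qed

lemma num_op_decomp: "v = num_op a N (num_inv a N v) + exc a N v"
  unfolding num_op_num_inv by simp

lemma Q0_decomp: assumes v: "v \<in> VL N" shows "Q0 a v = num_op a N (Q0 a (num_inv a N v))"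
proof -
  have "Q0 a v = Q0 a (num_op a N (num_inv a N v) + exc a N v)" by (simp only: num_op_decomp[symmetric])
  also have "\<dots> = Q0 a (num_op a N (num_inv a N v)) + Q0 a (exc a N v)"
    by (rule Q0_add[OF num_op_VL[OF num_inv_VL[OF v]] exc_VL[OF v]])
  finally show ?thesis by (simp only: Q0_exc[OF v] Q0_num_op[OF num_inv_VL[OF v]] add_0_right)
qed

text \<open>Since d_0 commutes with the number operator and vanishes on its kernel, its image lies
  in the image of that operator. So the leading part never creates an exceptional component.\<close>

lemma exc_Q0: "v \<in> VL N \<Longrightarrow> exc a N (Q0 a v) = 0"
  by (simp only: Q0_decomp exc_num_op)

lemma Q0_num_inv: assumes v: "v \<in> VL N" shows "num_inv a N (Q0 a v) = Q0 a (num_inv a N v)"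
  by (simp only: Q0_decomp[OF v] num_inv_num_op exc_Q0[OF num_inv_VL[OF v]] diff_zero)

lemma Q0_hom: assumes v: "v \<in> VL N"
  shows "Q0 a (hom a N v) + hom a N (Q0 a v) = v - exc a N v"
  unfolding hom_def Q0_num_inv[OF v] Q0_hom0[OF num_inv_VL[OF v]] num_op_num_inv ..

subsection \<open>The filtration\<close>

text \<open>By \<open>abs_deg_le_level\<close> the index -N imposes no condition on the degree and
  every index above N leaves only 0, so the filtration is finite.\<close>

definition filt :: "int \<Rightarrow> int \<Rightarrow> int \<Rightarrow> state set" where
  "filt N g f = {v \<in> VL N. \<forall>\<mu>. v \<mu> \<noteq> 0 \<longrightarrow> ghost \<mu> = g \<and> f \<le> deg \<mu>}"

lemma filt_VL: "v \<in> filt N g f \<Longrightarrow> v \<in> VL N" by (simp add: filt_def)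
lemma filt_zero: "0 \<in> filt N g f" by (simp add: filt_def)
lemma filt_add: "v \<in> filt N g f \<Longrightarrow> w \<in> filt N g f \<Longrightarrow> v + w \<in> filt N g f"
  unfolding filt_def by (auto simp: VL_add) (metis add.right_neutral)+
lemma filt_smul: "v \<in> filt N g f \<Longrightarrow> smul c v \<in> filt N g f"
  unfolding filt_def by (auto simp: VL_smul) (auto simp: smul_def)
lemma filt_uminus: "v \<in> filt N g f \<Longrightarrow> - v \<in> filt N g f"
  using filt_smul[of v N g f "-1"] by simp
lemma filt_diff: "v \<in> filt N g f \<Longrightarrow> w \<in> filt N g f \<Longrightarrow> v - w \<in> filt N g f"
  unfolding diff_conv_add_uminus by (intro filt_add filt_uminus)
lemma filt_mono: "v \<in> filt N g f \<Longrightarrow> f' \<le> f \<Longrightarrow> v \<in> filt N g f'"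
  unfolding filt_def by auto

lemma raises_filt: assumes "raises A 0 g' f'" "v \<in> filt N g f" shows "A v \<in> filt N (g + g') (f + f')"
proof -
  have v: "v \<in> VL N" using assms(2) by (rule filt_VL)
  have "ghost \<mu> = g + g' \<and> f + f' \<le> deg \<mu>" if nz: "A v \<mu> \<noteq> 0" for \<mu>
  proof -
    obtain \<nu> where n: "v \<nu> \<noteq> 0" "ghost \<mu> = ghost \<nu> + g'" "deg \<mu> = deg \<nu> + f'"
      by (rule raisesD[OF assms(1) VL_VV[OF v] nz])
    have "ghost \<nu> = g \<and> f \<le> deg \<nu>" using assms(2) n(1) unfolding filt_def by blast
    then show ?thesis using n by simp
  qed
  then show ?thesis using raises_VL[OF assms(1) v] by (simp add: filt_def)
qed

lemma hom_Fl: assumes "v \<in> filt N g f" shows "hom a N v \<in> filt N (g - 1) f"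
proof -
  have "num_inv a N v \<in> filt N g f" using assms num_inv_VL[of v N a] by (auto simp: filt_def num_inv_def)
  from raises_filt[OF raises_hom0 this, of a N] show ?thesis unfolding hom_def by simp
qed

definition Q_pos :: "complex \<Rightarrow> state \<Rightarrow> state" where "Q_pos b v = Q1 v + Q2 b v"

lemma Q_decomp: "Q a b v = Q0 a v + Q_pos b v" by (simp add: Q_def Q_pos_def add.assoc)

lemma Q_pos_filt: assumes v: "v \<in> filt N g f" shows "Q_pos b v \<in> filt N (g + 1) (f + 1)"
  unfolding Q_pos_def
  by (rule filt_add[OF raises_filt[OF raises_Q1 v] filt_mono[OF raises_filt[OF raises_Q2 v]]]) simp
lemma Q_filt: assumes v: "v \<in> filt N g f" shows "Q a b v \<in> filt N (g + 1) f"
proof -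
  have "Q0 a v \<in> filt N (g + 1) f" using raises_filt[OF raises_Q0 v, of a] by simp
  moreover have "Q_pos b v \<in> filt N (g + 1) f" by (rule filt_mono[OF Q_pos_filt[OF v]]) simp
  ultimately show ?thesis unfolding Q_decomp by (rule filt_add)
qed

definition rest :: "complex \<Rightarrow> complex \<Rightarrow> int \<Rightarrow> state \<Rightarrow> state" where
  "rest a b N v = Q_pos b (hom a N v) + hom a N (Q_pos b v)"

lemma rest_filt: assumes v: "v \<in> filt N g f" shows "rest a b N v \<in> filt N g (f + 1)"
proof -
  have "Q_pos b (hom a N v) \<in> filt N g (f + 1)" using Q_pos_filt[OF hom_Fl[OF v]] by simp
  moreover have "hom a N (Q_pos b v) \<in> filt N g (f + 1)" using hom_Fl[OF Q_pos_filt[OF v]] by simp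
  ultimately show ?thesis unfolding rest_def by (rule filt_add)
qed

text \<open>The homotopy for d_0 is used unchanged for d. Its error \<open>rest\<close> strictly
  raises the filtration, so it can be removed by iteration.\<close>

lemma Q_hom: assumes v: "v \<in> VL N"
  shows "v - Q a b (hom a N v) = hom a N (Q a b v) + exc a N v - rest a b N v"
proof -
  have "Q a b (hom a N v) + hom a N (Q a b v) = (Q0 a (hom a N v) + hom a N (Q0 a v)) + rest a b N v"
    unfolding Q_decomp rest_def hom_add by (simp add: add_ac)
  also have "\<dots> = v - exc a N v + rest a b N v" by (simp only: Q0_hom[OF v])
  finally show ?thesis by (simp add: algebra_simps)
qed

text \<open>Each occupied mode changes the degree by at most 1 and the level by at least 1.\<close>

lemma abs_deg_le_level: assumes "valid_mono \<mu>" shows "\<bar>deg \<mu>\<bar> \<le> int (level \<mu>)"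
proof -
  have "\<bar>deg \<mu>\<bar> \<le> \<bar>\<Sum>x | bos \<mu> x \<noteq> 0. int (bos \<mu> x) * dg_bos x\<bar> + \<bar>\<Sum>x\<in>fer \<mu>. dg_fer x\<bar>"
    unfolding deg_def wt_def by (rule abs_triangle_ineq)
  also have "\<dots> \<le> (\<Sum>x | bos \<mu> x \<noteq> 0. \<bar>int (bos \<mu> x) * dg_bos x\<bar>) + (\<Sum>x\<in>fer \<mu>. \<bar>dg_fer x\<bar>)"
    by (intro add_mono sum_abs)
  also have "\<dots> \<le> (\<Sum>x | bos \<mu> x \<noteq> 0. int (bos \<mu> x) * int (snd x)) + (\<Sum>x\<in>fer \<mu>. int (snd x))"
  proof (intro add_mono sum_mono)
    fix x assume "x \<in> {x. bos \<mu> x \<noteq> 0}"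
    then have "1 \<le> snd x" using assms unfolding valid_mono_def by blast
    then have "\<bar>dg_bos x\<bar> \<le> int (snd x)" by (simp add: dg_bos_def)
    then show "\<bar>int (bos \<mu> x) * dg_bos x\<bar> \<le> int (bos \<mu> x) * int (snd x)"
      unfolding abs_mult by (simp add: mult_left_mono)
  next
    fix x assume "x \<in> fer \<mu>"
    then have "1 \<le> snd x" using assms unfolding valid_mono_def by blast
    then show "\<bar>dg_fer x\<bar> \<le> int (snd x)" by (simp add: dg_fer_def)
  qed
  also have "\<dots> = int (level \<mu>)" by (simp add: level_wt wt_def)
  finally show ?thesis .
qed

lemma filt_top: assumes "v \<in> filt N g f" "f > N" shows "v = 0"
proof (rule ext)
  fix \<mu>
  show "v \<mu> = 0 \<mu>"
  proof (rule ccontr)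
    assume "v \<mu> \<noteq> 0 \<mu>"
    then have "valid_mono \<mu>" "int (level \<mu>) = N" "f \<le> deg \<mu>" using assms(1) by (auto simp: filt_def VL_def)
    then show False using abs_deg_le_level[of \<mu>] assms(2) by simp
  qed
qed

lemma exc_Fl: assumes "v \<in> filt N g f"
    and "\<And>\<mu>. valid_mono \<mu> \<Longrightarrow> int (level \<mu>) = N \<Longrightarrow> nu a N \<mu> = 0 \<Longrightarrow> deg \<mu> = s0"
  shows "exc a N v \<in> filt N g s0" "f > s0 \<Longrightarrow> exc a N v = 0"
proof -
  have V: "exc a N v \<in> VL N" using assms(1) by (intro exc_VL filt_VL)
  have *: "ghost \<mu> = g \<and> deg \<mu> = s0 \<and> f \<le> deg \<mu>" if "exc a N v \<mu> \<noteq> 0" for \<mu>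
    using that assms by (auto simp: exc_def filt_def VL_def split: if_splits)
  then show "exc a N v \<in> filt N g s0" using V by (auto simp: filt_def)
  show "exc a N v = 0" if "f > s0"
    using * that by (intro ext) (force simp: zero_fun_def)
qed

section \<open>Cohomology of d when all exceptional monomials have one common degree\<close>

context
  fixes a b :: complex and N s0 :: int
  assumes ab: "a * b = - of_int N"
    and s0: "\<And>\<mu>. valid_mono \<mu> \<Longrightarrow> int (level \<mu>) = N \<Longrightarrow> nu a N \<mu> = 0 \<Longrightarrow> deg \<mu> = s0"
    and s0N: "- N \<le> s0"
begin

lemma Q_nilpotent: "v \<in> VL N \<Longrightarrow> Q a b (Q a b v) = 0"
  by (simp add: Q_sq ab)

lemma Q_diff: "v \<in> VL N \<Longrightarrow> w \<in> VL N \<Longrightarrow> Q a b (v - w) = Q a b v - Q a b w"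
  unfolding diff_conv_add_uminus by (simp only: Q_add[of v N] VL_uminus Q_uminus)

lemma closed_step: 
  assumes "z \<in> VL N" "Q a b z = 0"
  shows "Q a b (z - Q a b (hom a N z)) = 0" "z - Q a b (hom a N z) = exc a N z - rest a b N z"
proof -
  have h: "hom a N z \<in> VL N" unfolding hom_def by (intro hom0_VL num_inv_VL assms)
  show "Q a b (z - Q a b (hom a N z)) = 0"
    by (simp only: Q_diff[OF assms(1) Q_VL[OF h]] assms(2) Q_nilpotent[OF h] diff_self)
  show "z - Q a b (hom a N z) = exc a N z - rest a b N z"
    by (simp only: Q_hom[OF assms(1)] assms(2) hom_zero add_0_left)
qed

text \<open>Above \<open>s0\<close> there is no exceptional component, so replacing z by z - d(hom
  z) raises the filtration index. After finitely many steps nothing is left, and the subtracted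
  terms add up to a primitive.\<close>

lemma exact_above: "z \<in> filt N g f \<Longrightarrow> Q a b z = 0 \<Longrightarrow> f > s0 \<Longrightarrow> \<exists>y\<in>filt N (g - 1) f. Q a b y = z"
proof (induction "nat (N + 1 - f)" arbitrary: z f)
  case 0
  then have "z = 0" by (intro filt_top[of z N g f]) auto
  then show ?case using filt_zero Q_zero by metis
next
  case (Suc k)
  note z = filt_VL[OF Suc.prems(1)]
  note st = closed_step[OF z Suc.prems(2)]
  have e: "exc a N z = 0" by (rule exc_Fl(2)[OF Suc.prems(1) s0 Suc.prems(3)])
  have F: "z - Q a b (hom a N z) \<in> filt N g (f + 1)"
    unfolding st(2) e using filt_uminus[OF rest_filt[OF Suc.prems(1)]] by simp
  have kk: "k = nat (N + 1 - (f + 1))" "s0 < f + 1" using Suc.hyps(2) Suc.prems(3) by auto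
  obtain y where y: "y \<in> filt N (g - 1) (f + 1)" "Q a b y = z - Q a b (hom a N z)"
    using Suc.hyps(1)[OF _ F st(1)] kk by blast
  have "y \<in> filt N (g - 1) f" by (rule filt_mono[OF y(1)]) simp
  moreover have "Q a b (hom a N z + y) = z"
    by (simp only: Q_add[OF filt_VL[OF hom_Fl[OF Suc.prems(1)]] filt_VL[OF y(1)]] y(2)) simp
  ultimately show ?case using hom_Fl[OF Suc.prems(1), of a] by (intro bexI[of _ "hom a N z + y"] filt_add)
qed

text \<open>The same iteration from below: the exceptional component already has degree
  \<open>s0\<close> and does not stop the rise until that degree is reached.\<close>

lemma push_to_s0: "z \<in> filt N g f \<Longrightarrow> Q a b z = 0 \<Longrightarrow> - N \<le> f \<Longrightarrow> f \<le> s0 \<Longrightarrow>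
    \<exists>y\<in>filt N (g - 1) (- N). z - Q a b y \<in> filt N g s0"
proof (induction "nat (s0 - f)" arbitrary: z f)
  case 0
  then have "f = s0" by simp
  then show ?case using 0(2,4) filt_zero Q_zero diff_zero 0(5) 0(3) by metis
next
  case (Suc k)
  note z = filt_VL[OF Suc.prems(1)]
  note st = closed_step[OF z Suc.prems(2)]
  have "exc a N z \<in> filt N g (f + 1)"
    by (rule filt_mono[OF exc_Fl(1)[OF Suc.prems(1) s0]]) (use Suc.hyps(2) in auto)
  then have F: "z - Q a b (hom a N z) \<in> filt N g (f + 1)"
    unfolding st(2) by (intro filt_diff rest_filt Suc.prems(1))
  have kk: "k = nat (s0 - (f + 1))" "- N \<le> f + 1" "f + 1 \<le> s0" using Suc.hyps(2) Suc.prems(3) by auto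
  obtain y where y: "y \<in> filt N (g - 1) (- N)" "z - Q a b (hom a N z) - Q a b y \<in> filt N g s0"
    using Suc.hyps(1)[OF kk(1) F st(1) kk(2,3)] by blast
  have h: "hom a N z \<in> filt N (g - 1) (- N)" by (rule filt_mono[OF hom_Fl[OF Suc.prems(1)] Suc.prems(3)])
  have e: "z - Q a b (hom a N z + y) = z - Q a b (hom a N z) - Q a b y"
    by (simp only: Q_add[OF filt_VL[OF h] filt_VL[OF y(1)]] diff_diff_eq)
  have "z - Q a b (hom a N z + y) \<in> filt N g s0" unfolding e by (rule y(2))
  then show ?case using filt_add[OF h y(1)] by blast
qed

text \<open>Without an exceptional component one correction passes beyond \<open>s0\<close>, where
  \<open>exact_above\<close> takes over.\<close>

lemma exact_at_s0:
  assumes "z \<in> filt N g s0" "Q a b z = 0" "exc a N z = 0"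
  shows "\<exists>y\<in>filt N (g - 1) (- N). Q a b y = z"
proof -
  note z = filt_VL[OF assms(1)]
  note st = closed_step[OF z assms(2)]
  have F: "z - Q a b (hom a N z) \<in> filt N g (s0 + 1)"
    unfolding st(2) assms(3) using filt_uminus[OF rest_filt[OF assms(1)]] by simp
  obtain y where y: "y \<in> filt N (g - 1) (s0 + 1)" "Q a b y = z - Q a b (hom a N z)"
    using exact_above[OF F st(1)] by auto
  have "Q a b (hom a N z + y) = z"
    by (simp only: Q_add[OF filt_VL[OF hom_Fl[OF assms(1)]] filt_VL[OF y(1)]] y(2)) simp
  moreover have "hom a N z \<in> filt N (g - 1) (- N)" by (rule filt_mono[OF hom_Fl[OF assms(1)] s0N])
  moreover have "y \<in> filt N (g - 1) (- N)" using s0N by (intro filt_mono[OF y(1)]) simp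
  ultimately show ?thesis by (intro bexI[of _ "hom a N z + y"] filt_add)
qed

text \<open>The obstruction d(pt e) is closed and of degree above \<open>s0\<close>, because d_0
  kills \<open>pt e\<close>. So it is d of some y of higher degree, and pt e - y is a cocycle with
  the same exceptional component.\<close>

lemma lift_exc_mono:
  assumes e: "valid_mono e" "int (level e) = N" "nu a N e = 0" "ghost e = g"
  shows "\<exists>w\<in>filt N g s0. Q a b w = 0 \<and> exc a N w = pt e"
proof -
  have V: "pt e \<in> VL N" using pt_VL[OF e(1)] e(2) by simp
  have F: "pt e \<in> filt N g s0" using V e s0 by (auto simp: filt_def)
  have x: "exc a N (pt e) = pt e" using e by (auto simp: exc_def fun_eq_iff)
  have "Q0 a (pt e) = 0" using Q0_exc[OF V, of a] unfolding x .
  then have d: "Q a b (pt e) \<in> filt N (g + 1) (s0 + 1)" unfolding Q_decomp using Q_pos_filt[OF F] by simp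
  obtain y where y: "y \<in> filt N g (s0 + 1)" "Q a b y = Q a b (pt e)"
    using exact_above[OF d Q_nilpotent[OF V]] by auto
  have "pt e - y \<in> filt N g s0" by (intro filt_diff F filt_mono[OF y(1)]) simp
  moreover have "Q a b (pt e - y) = 0" by (simp only: Q_diff[OF V filt_VL[OF y(1)]] y(2) diff_self)
  moreover have "exc a N y = 0" by (rule exc_Fl(2)[OF y(1) s0]) auto
  then have "exc a N (pt e - y) = pt e" by (simp only: exc_diff x diff_zero)
  ultimately show ?thesis by blast
qed

text \<open>A primitive of low degree is moved up to degree \<open>s0\<close> by subtracting exact terms; there only the
 leading part of d contributes in degree \<open>s0\<close>, and its image has no exceptional component.\<close>

lemma exc_image: "x \<in> filt N g f \<Longrightarrow> Q a b x \<in> filt N (g + 1) s0 \<Longrightarrow> f \<le> s0 \<Longrightarrow> exc a N (Q a b x) = 0"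
proof (induction "nat (s0 - f)" arbitrary: x f)
  case 0
  then have f: "f = s0" by simp
  have "exc a N (Q_pos b x) = 0"
    by (rule exc_Fl(2)[OF Q_pos_filt[OF 0(2)] s0]) (auto simp: f)
  then show ?case unfolding Q_decomp exc_add exc_Q0[OF filt_VL[OF 0(2)]] by simp
next
  case (Suc k)
  note x = filt_VL[OF Suc.prems(1)]
  have h: "hom a N x \<in> VL N" by (rule filt_VL[OF hom_Fl[OF Suc.prems(1)]])
  have fs: "f + 1 \<le> s0" using Suc.hyps(2) by simp
  have "hom a N (Q a b x) \<in> filt N g (f + 1)" using filt_mono[OF hom_Fl[OF Suc.prems(2)] fs] by simp
  moreover have "exc a N x \<in> filt N g (f + 1)" by (rule filt_mono[OF exc_Fl(1)[OF Suc.prems(1) s0] fs]) auto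
  ultimately have F: "x - Q a b (hom a N x) \<in> filt N g (f + 1)"
    unfolding Q_hom[OF x] by (intro filt_diff filt_add rest_filt Suc.prems(1))
  have e: "Q a b (x - Q a b (hom a N x)) = Q a b x"
    by (simp only: Q_diff[OF x Q_VL[OF h]] Q_nilpotent[OF h] diff_zero)
  have kk: "k = nat (s0 - (f + 1))" using Suc.hyps(2) by auto
  show ?case using Suc.hyps(1)[OF kk F _ fs] Suc.prems(2) unfolding e by blast
qed

end

subsection \<open>The exceptional monomials\<close>

definition exc_bos :: "int \<Rightarrow> mode" where "exc_bos r = (if r > 0 then 0 else 1, nat \<bar>r\<bar>)"
definition exc_fer :: "int \<Rightarrow> mode" where "exc_fer r = (if r > 0 then 1 else 0, nat \<bar>r\<bar>)"
text \<open>For r > 0 the surviving pair is (alpha+, c), for r < 0 it is (alpha-, b), at index |r|.\<close>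

definition exc_cand :: "int \<Rightarrow> nat \<Rightarrow> mode set \<Rightarrow> mono" where
  "exc_cand r j F = \<lparr>bos = (\<lambda>_. 0)(exc_bos r := j), fer = F\<rparr>"

lemma wt_exc_cand: "wt wB wF (exc_cand r j F) = int j * wB (exc_bos r) + (\<Sum>x\<in>F. wF x)"
proof -
  have "(\<Sum>x | bos (exc_cand r j F) x \<noteq> 0. int (bos (exc_cand r j F) x) * wB x) = (\<Sum>x\<in>{exc_bos r}. int (bos (exc_cand r j F) x) * wB x)"
    by (rule sum.mono_neutral_left) (auto simp: exc_cand_def split: if_splits)
  then show ?thesis by (simp add: wt_def exc_cand_def)
qed

lemma exc_cand_props:
  assumes "r \<noteq> 0" "F = {} \<or> F = {exc_fer r}"
  shows "valid_mono (exc_cand r j F)" "int (level (exc_cand r j F)) = (int j + int (card F)) * \<bar>r\<bar>"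
    "deg (exc_cand r j F) = (int j + int (card F)) * sgn r" "ghost (exc_cand r j F) = int (card F) * sgn r"
proof -
  have "finite {x. bos (exc_cand r j F) x \<noteq> 0}"
    by (rule finite_subset[of _ "{exc_bos r}"]) (auto simp: exc_cand_def split: if_splits)
  then show v: "valid_mono (exc_cand r j F)"
    using assms by (auto simp: valid_mono_def exc_cand_def exc_bos_def exc_fer_def split: if_splits)
  show "int (level (exc_cand r j F)) = (int j + int (card F)) * \<bar>r\<bar>"
    using assms unfolding level_wt wt_exc_cand by (auto simp: exc_bos_def exc_fer_def algebra_simps)
  show "deg (exc_cand r j F) = (int j + int (card F)) * sgn r"
    using assms unfolding deg_def wt_exc_cand by (auto simp: exc_bos_def exc_fer_def dg_bos_def dg_fer_def sgn_if)
  show "ghost (exc_cand r j F) = int (card F) * sgn r"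
    using assms unfolding ghost_wt[OF v] wt_exc_cand by (auto simp: exc_fer_def gh_wt_def sgn_if)
qed

lemma occupied_le_level:
  assumes "valid_mono \<mu>" "bos \<mu> x \<noteq> 0 \<or> x \<in> fer \<mu>"
  shows "fst x < 4" "1 \<le> snd x" "snd x \<le> level \<mu>"
proof -
  have fb: "finite {x. bos \<mu> x \<noteq> 0}" and ff: "finite (fer \<mu>)" using assms(1) by (auto simp: valid_mono_def)
  show "fst x < 4" "1 \<le> snd x" using assms unfolding valid_mono_def by blast+
  show "snd x \<le> level \<mu>"
  proof (cases "bos \<mu> x = 0")
    case False
    have "snd x \<le> bos \<mu> x * snd x" using False by simp
    also have "\<dots> \<le> (\<Sum>x | bos \<mu> x \<noteq> 0. bos \<mu> x * snd x)"
      using member_le_sum[of x "{x. bos \<mu> x \<noteq> 0}" "\<lambda>x. bos \<mu> x * snd x"] False fb by simp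
    finally show ?thesis by (simp only: level_def)
  next
    case True
    then have "snd x \<le> (\<Sum>x\<in>fer \<mu>. snd x)"
      using member_le_sum[of x "fer \<mu>" snd] assms(2) ff by simp
    then show ?thesis by (simp only: level_def)
  qed
qed

text \<open>An occupied mode has index at most the level N, so it falls in the range counted by
  \<open>nu\<close>. It can escape being counted only through the vanishing coefficient at a =
  n.\<close>

lemma exc_mono_occupied:
  assumes v: "valid_mono \<mu>" and N: "int (level \<mu>) = N" and n: "nu a N \<mu> = 0"
  shows "bos \<mu> x \<noteq> 0 \<Longrightarrow> \<exists>r. r \<noteq> 0 \<and> a = of_int r \<and> x = exc_bos r"
    and "x \<in> fer \<mu> \<Longrightarrow> \<exists>r. r \<noteq> 0 \<and> a = of_int r \<and> x = exc_fer r"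
proof -
  define m where "m = int (snd x)"
  have n0: "nu1 a k \<mu> = 0" if "k \<in> {-N..N}" for k using n that by (auto simp: nu_def)
  have m: "m > 0" "m \<in> {-N..N}" "- m \<in> {-N..N}" if "bos \<mu> x \<noteq> 0 \<or> x \<in> fer \<mu>"
    using occupied_le_level[OF v that] N by (auto simp: m_def)
  have x: "x = (0, nat m) \<or> x = (1, nat m) \<or> x = (2, nat m) \<or> x = (3, nat m)" if "bos \<mu> x \<noteq> 0 \<or> x \<in> fer \<mu>"
    using occupied_le_level(1)[OF v that] by (cases x) (auto simp: m_def)
  show "\<exists>r. r \<noteq> 0 \<and> a = of_int r \<and> x = exc_bos r" if b: "bos \<mu> x \<noteq> 0"
  proof -
    have o: "bos \<mu> x \<noteq> 0 \<or> x \<in> fer \<mu>" using b by simp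
    note mm = m[OF o]
    have "(x = (0, nat m) \<and> a = of_int m) \<or> (x = (1, nat m) \<and> a = of_int (- m))"
      using n0[OF mm(2)] n0[OF mm(3)] mm(1) x[OF o] b by (auto simp: nu1_def split: if_splits)
    then show ?thesis
    proof
      assume "x = (0, nat m) \<and> a = of_int m"
      then show ?thesis using mm(1) by (intro exI[of _ m]) (simp add: exc_bos_def)
    next
      assume "x = (1, nat m) \<and> a = of_int (- m)"
      then show ?thesis using mm(1) by (intro exI[of _ "- m"]) (simp add: exc_bos_def)
    qed
  qed
  show "\<exists>r. r \<noteq> 0 \<and> a = of_int r \<and> x = exc_fer r" if b: "x \<in> fer \<mu>"
  proof -
    have o: "bos \<mu> x \<noteq> 0 \<or> x \<in> fer \<mu>" using b by simp
    note mm = m[OF o]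
    have "(x = (1, nat m) \<and> a = of_int m) \<or> (x = (0, nat m) \<and> a = of_int (- m))"
      using n0[OF mm(2)] n0[OF mm(3)] mm(1) x[OF o] b by (auto simp: nu1_def split: if_splits)
    then show ?thesis
    proof
      assume "x = (1, nat m) \<and> a = of_int m"
      then show ?thesis using mm(1) by (intro exI[of _ m]) (simp add: exc_fer_def)
    next
      assume "x = (0, nat m) \<and> a = of_int (- m)"
      then show ?thesis using mm(1) by (intro exI[of _ "- m"]) (simp add: exc_fer_def)
    qed
  qed
qed

lemma exc_mono_cand:
  assumes v: "valid_mono \<mu>" and N: "int (level \<mu>) = N" "N > 0" and n: "nu a N \<mu> = 0"
  shows "\<exists>r j F. r \<noteq> 0 \<and> a = of_int r \<and> (F = {} \<or> F = {exc_fer r}) \<and> \<mu> = exc_cand r j F"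
proof -
  have "\<mu> \<noteq> vac_mono" using N by auto
  then have "bos \<mu> \<noteq> (\<lambda>_. 0) \<or> fer \<mu> \<noteq> {}" by (cases \<mu>) (simp add: vac_mono_def)
  then obtain r where r: "r \<noteq> 0" "a = of_int r"
    using exc_mono_occupied[OF v N(1) n] by (metis ex_in_conv ext)
  have "bos \<mu> x = 0" if "x \<noteq> exc_bos r" for x
    using exc_mono_occupied(1)[OF v N(1) n, of x] r that by (auto simp del: neq0_conv)
  then have "bos \<mu> = (\<lambda>_. 0)(exc_bos r := bos \<mu> (exc_bos r))" by (intro ext) auto
  moreover have "fer \<mu> \<subseteq> {exc_fer r}"
    using exc_mono_occupied(2)[OF v N(1) n] r by auto
  then have "fer \<mu> = {} \<or> fer \<mu> = {exc_fer r}" by blast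
  ultimately show ?thesis using r
    by (intro exI[of _ r] exI[of _ "bos \<mu> (exc_bos r)"] exI[of _ "fer \<mu>"]) (cases \<mu>, simp add: exc_cand_def)
qed

lemma nu_exc_cand:
  assumes "r \<noteq> 0" "a = of_int r" "F = {} \<or> F = {exc_fer r}"
  shows "nu a N (exc_cand r j F) = 0"
proof -
  have "nu1 a n (exc_cand r j F) = 0" for n
  proof (cases "n = r")
    case True
    then show ?thesis using assms by (cases "r > 0") (auto simp: nu1_def exc_cand_def exc_bos_def exc_fer_def)
  next
    case False
    then have "a \<noteq> of_int n" "n > 0 \<and> r > 0 \<longrightarrow> nat n \<noteq> nat r" "n < 0 \<and> r < 0 \<longrightarrow> nat (- n) \<noteq> nat (- r)"
      using assms(2) by auto
    then show ?thesis using assms(1,3)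
      by (cases "r > 0"; cases "n > 0") (auto simp: nu1_def exc_cand_def exc_bos_def exc_fer_def)
  qed
  then show ?thesis by (simp add: nu_def)
qed

definition exc_mono :: "complex \<Rightarrow> int \<Rightarrow> mono \<Rightarrow> bool" where
  "exc_mono a N \<mu> \<longleftrightarrow> valid_mono \<mu> \<and> int (level \<mu>) = N \<and> nu a N \<mu> = 0"

text \<open>The value a fixes r, the level fixes the number of occupied modes as N / |r|, and the
  degree is this number times the sign of r. The ghost number then decides whether the fermion is
  present.\<close>

lemma exc_mono_unique:
  assumes "exc_mono a N \<mu>" "exc_mono a N \<nu>" "N > 0"
  shows "deg \<mu> = deg \<nu>" "ghost \<mu> = ghost \<nu> \<Longrightarrow> \<mu> = \<nu>"
proof -
  obtain r j F where 1: "r \<noteq> 0" "a = of_int r" "F = {} \<or> F = {exc_fer r}" "\<mu> = exc_cand r j F"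
    using exc_mono_cand[of \<mu> N a] assms by (auto simp: exc_mono_def)
  obtain r' j' F' where 2: "a = of_int r'" "F' = {} \<or> F' = {exc_fer r'}" "\<nu> = exc_cand r' j' F'"
    using exc_mono_cand[of \<nu> N a] assms by (auto simp: exc_mono_def)
  have r': "r' = r" using 1 2 by simp
  note 2 = 2[unfolded r']
  have "(int j + int (card F)) * \<bar>r\<bar> = (int j' + int (card F')) * \<bar>r\<bar>"
    using exc_cand_props(2)[OF 1(1,3), of j] exc_cand_props(2)[OF 1(1) 2(2), of j'] 1(4) 2(3) assms(1,2)
    by (simp add: exc_mono_def)
  then have jj: "int j + int (card F) = int j' + int (card F')" using 1(1) by simp
  then show "deg \<mu> = deg \<nu>"
    unfolding 1(4) 2(3) exc_cand_props(3)[OF 1(1,3)] exc_cand_props(3)[OF 1(1) 2(2)] by simp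
  assume "ghost \<mu> = ghost \<nu>"
  then have "card F = card F'"
    using 1(1) unfolding 1(4) 2(3) exc_cand_props(4)[OF 1(1,3)] exc_cand_props(4)[OF 1(1) 2(2)] by (simp add: sgn_if split: if_splits)
  then have "F = F'" "j = j'" using jj 1(3) 2(2) by auto
  then show "\<mu> = \<nu>" using 1(4) 2(3) by simp
qed

lemma ex_exc_mono:
  assumes "N > 0"
  shows "(\<exists>\<mu>. exc_mono a N \<mu> \<and> ghost \<mu> = g) \<longleftrightarrow> (\<exists>r. r \<noteq> 0 \<and> a = of_int r \<and> r dvd N \<and> (g = 0 \<or> g = sgn r))"
proof
  assume "\<exists>\<mu>. exc_mono a N \<mu> \<and> ghost \<mu> = g"
  then obtain \<mu> where m: "exc_mono a N \<mu>" "ghost \<mu> = g" by blast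
  obtain r j F where 1: "r \<noteq> 0" "a = of_int r" "F = {} \<or> F = {exc_fer r}" "\<mu> = exc_cand r j F"
    using exc_mono_cand[of \<mu> N a] m assms by (auto simp: exc_mono_def)
  have "N = (int j + int (card F)) * \<bar>r\<bar>" using m(1) exc_cand_props(2)[OF 1(1,3), of j] 1(4) by (simp add: exc_mono_def)
  then have "r dvd N" by simp
  moreover have "g = 0 \<or> g = sgn r" using m(2) 1(3) unfolding 1(4) exc_cand_props(4)[OF 1(1,3)] by auto
  ultimately show "\<exists>r. r \<noteq> 0 \<and> a = of_int r \<and> r dvd N \<and> (g = 0 \<or> g = sgn r)" using 1 by blast
next
  assume "\<exists>r. r \<noteq> 0 \<and> a = of_int r \<and> r dvd N \<and> (g = 0 \<or> g = sgn r)"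
  then obtain r where r: "r \<noteq> 0" "a = of_int r" "r dvd N" "g = 0 \<or> g = sgn r" by blast
  define s where "s = N div \<bar>r\<bar>"
  have s: "N = s * \<bar>r\<bar>" using r(3) by (simp add: s_def)
  then have "s > 0" using assms r(1) by (simp add: zero_less_mult_iff)
  define F where "F = (if g = 0 then {} else {exc_fer r})"
  \<comment> \<open>N / |r| modes are needed in all, one of them possibly the fermion; as s is at
    least 1, the subtraction is not truncated.\<close>
  define j where "j = nat s - card F"
  have F: "F = {} \<or> F = {exc_fer r}" by (simp add: F_def)
  have jF: "int j + int (card F) = s" using \<open>s > 0\<close> by (auto simp: j_def F_def)
  have "exc_mono a N (exc_cand r j F)"
    unfolding exc_mono_def using exc_cand_props(1,2)[OF r(1) F, of j] nu_exc_cand[OF r(1,2) F] s jF by simp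
  moreover have "ghost (exc_cand r j F) = g" using r(4) unfolding exc_cand_props(4)[OF r(1) F] by (auto simp: F_def)
  ultimately show "\<exists>\<mu>. exc_mono a N \<mu> \<and> ghost \<mu> = g" by blast
qed

subsection \<open>Dimensions\<close>

text \<open>The ambient space is infinite dimensional; S serves to show that a basis of B is finite,
  so that its cardinality grows by 1.\<close>

lemma dim_insert_subspace:
  assumes B: "vs.subspace B" "B \<subseteq> vs.span S" "finite S" and w: "w \<notin> B"
  shows "vs.dim (vs.span (insert w B)) = vs.dim B + 1"
proof -
  obtain Bs where Bs: "Bs \<subseteq> B" "vs.independent Bs" "B \<subseteq> vs.span Bs" "card Bs = vs.dim B"
    using vs.basis_exists[of B] by metis
  have fin: "finite Bs" using vs.independent_span_bound[OF B(3) Bs(2)] Bs(1) B(2) by blast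
  have sB: "vs.span Bs = B" using vs.span_minimal[OF Bs(1) B(1)] Bs(3) by blast
  have "w \<notin> Bs" using w Bs(1) by blast
  have ind: "vs.independent (insert w Bs)" by (rule vs.independent_insertI) (use w sB Bs(2) in auto)
  have "vs.span (insert w Bs) = vs.span (vs.span (insert w B))"
  proof -
    have "vs.span (insert w B) = vs.span (insert w Bs)"
    proof
      have "insert w B \<subseteq> vs.span (insert w Bs)"
        using sB vs.span_mono[of Bs "insert w Bs"] vs.span_base[of w "insert w Bs"] by auto
      then show "vs.span (insert w B) \<subseteq> vs.span (insert w Bs)" by (rule vs.span_minimal) (rule vs.subspace_span)
      show "vs.span (insert w Bs) \<subseteq> vs.span (insert w B)" by (rule vs.span_mono) (use Bs(1) in auto)
    qed
    then show ?thesis by (simp only: vs.span_span)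
  qed
  then have "vs.dim (vs.span (insert w B)) = card (insert w Bs)" using ind by (rule vs.dim_eq_card)
  then show ?thesis using fin \<open>w \<notin> Bs\<close> Bs(4) by simp
qed

lemma VL_span: "VL L \<subseteq> vs.span (pt ` level_monos L)"
proof
  fix v assume v: "v \<in> VL L"
  show "v \<in> vs.span (pt ` level_monos L)"
    by (subst VL_expand[OF v]) (intro vs.span_sum vs.span_scale vs.span_base, auto)
qed

lemma filt_subspace: "vs.subspace (filt N g f)"
  by (simp add: vs.subspace_def filt_zero filt_add filt_smul)

lemma image_subspace: "vs.subspace (Q a b ` filt N g f)"
  unfolding vs.subspace_def
proof (intro conjI allI ballI)
  show "0 \<in> Q a b ` filt N g f" using filt_zero[of N g f] Q_zero by (metis image_eqI)
  fix x y assume x: "x \<in> Q a b ` filt N g f" and y: "y \<in> Q a b ` filt N g f"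
  obtain u w where u: "u \<in> filt N g f" "x = Q a b u" and w: "w \<in> filt N g f" "y = Q a b w" using x y by blast
  have "x + y = Q a b (u + w)" unfolding u(2) w(2) by (rule Q_add[symmetric, OF filt_VL[OF u(1)] filt_VL[OF w(1)]])
  then show "x + y \<in> Q a b ` filt N g f" using filt_add[OF u(1) w(1)] by blast
next
  fix c x assume "x \<in> Q a b ` filt N g f"
  then obtain u where u: "u \<in> filt N g f" "x = Q a b u" by blast
  have "smul c x = Q a b (smul c u)" unfolding u(2) Q_smul ..
  then show "smul c x \<in> Q a b ` filt N g f" using filt_smul[OF u(1)] by blast
qed

text \<open>Boundaries lie in the finite dimensional space of cocycles, so the difference is the
  dimension of the quotient. The exceptional component detects classes: it vanishes on boundaries
  that lie in degree \<open>s0\<close> and above, and a cocycle there without it is exact.\<close>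

lemma coh_level:
  assumes ab: "a * b = - of_int N" and N: "N > 0"
  shows "vs.dim {v \<in> filt N g (- N). Q a b v = 0} - vs.dim (Q a b ` filt N (g - 1) (- N)) =
    (if \<exists>\<mu>. exc_mono a N \<mu> \<and> ghost \<mu> = g then 1 else 0)"
proof -
  \<comment> \<open>Exceptional monomials share one degree by \<open>exc_mono_unique\<close>, so any
    choice among them will do. If there are none, the condition on \<open>s0\<close> is vacuous and
    -N is the lowest value allowed.\<close>
  define s0 where "s0 = (if \<exists>\<mu>. exc_mono a N \<mu> then deg (SOME \<mu>. exc_mono a N \<mu>) else - N)"
  have some: "exc_mono a N (SOME \<mu>. exc_mono a N \<mu>)" if "exc_mono a N \<mu>" for \<mu> using that by (rule someI)
  have s0: "deg \<mu> = s0" if "valid_mono \<mu>" "int (level \<mu>) = N" "nu a N \<mu> = 0" for \<mu>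
  proof -
    have e: "exc_mono a N \<mu>" using that by (simp add: exc_mono_def)
    then show ?thesis using exc_mono_unique(1)[OF e some[OF e] N] by (auto simp: s0_def)
  qed
  have s0N: "- N \<le> s0"
  proof (cases "\<exists>\<mu>. exc_mono a N \<mu>")
    case True
    then obtain \<mu> where e: "exc_mono a N \<mu>" by blast
    then have "deg \<mu> = s0" using s0 by (simp add: exc_mono_def)
    then show ?thesis using abs_deg_le_level[of \<mu>] e by (simp add: exc_mono_def)
  qed (simp add: s0_def)
  let ?Z = "{v \<in> filt N g (- N). Q a b v = 0}" and ?B = "Q a b ` filt N (g - 1) (- N)"
  have BZ: "?B \<subseteq> ?Z"
  proof
    fix z assume "z \<in> ?B"
    then obtain y where y: "y \<in> filt N (g - 1) (- N)" "z = Q a b y" by blast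
    have "Q a b y \<in> filt N g (- N)" using Q_filt[OF y(1), of a b] by simp
    moreover have "Q a b (Q a b y) = 0" by (rule Q_nilpotent[OF ab s0 s0N filt_VL[OF y(1)]])
    ultimately show "z \<in> ?Z" using y(2) by simp
  qed
  have red: "\<exists>y\<in>filt N (g - 1) (- N). z - Q a b y \<in> filt N g s0 \<and> Q a b (z - Q a b y) = 0" if "z \<in> ?Z" for z
  proof -
    have z: "z \<in> filt N g (- N)" "Q a b z = 0" using that by auto
    obtain y where y: "y \<in> filt N (g - 1) (- N)" "z - Q a b y \<in> filt N g s0"
      using push_to_s0[OF ab s0 s0N z order_refl s0N] by blast
    have "Q a b (z - Q a b y) = 0"
      by (simp only: Q_diff[OF ab s0 s0N filt_VL[OF z(1)] Q_VL[OF filt_VL[OF y(1)]]] z(2) Q_nilpotent[OF ab s0 s0N filt_VL[OF y(1)]] diff_self)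
    then show ?thesis using y by blast
  qed
  show ?thesis
  proof (cases "\<exists>\<mu>. exc_mono a N \<mu> \<and> ghost \<mu> = g")
    case False
    have "?Z \<subseteq> ?B"
    proof
      fix z assume "z \<in> ?Z"
      then obtain y where y: "y \<in> filt N (g - 1) (- N)" "z - Q a b y \<in> filt N g s0" "Q a b (z - Q a b y) = 0"
        using red by blast
      have "exc a N (z - Q a b y) \<mu> = 0" for \<mu>
        using False y(2) by (auto simp: exc_def filt_def VL_def exc_mono_def)
      then have "exc a N (z - Q a b y) = 0" by (simp add: fun_eq_iff)
      then obtain y' where y': "y' \<in> filt N (g - 1) (- N)" "Q a b y' = z - Q a b y"
        using exact_at_s0[OF ab s0 s0N y(2,3)] by blast
      have "Q a b (y' + y) = z" by (simp only: Q_add[OF filt_VL[OF y'(1)] filt_VL[OF y(1)]] y'(2) diff_add_cancel)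
      then show "z \<in> ?B" using filt_add[OF y'(1) y(1)] by blast
    qed
    then have "?Z = ?B" using BZ by blast
    then show ?thesis using False by simp
  next
    case True
    then obtain e where e: "exc_mono a N e" "ghost e = g" by blast
    then have e': "valid_mono e" "int (level e) = N" "nu a N e = 0" by (auto simp: exc_mono_def)
    obtain w where w: "w \<in> filt N g s0" "Q a b w = 0" "exc a N w = pt e"
      using lift_exc_mono[OF ab s0 s0N e' e(2)] by blast
    have wZ: "w \<in> ?Z" using filt_mono[OF w(1) s0N] w(2) by simp
    have wB: "w \<notin> ?B"
    proof
      assume "w \<in> ?B"
      then obtain x where x: "x \<in> filt N (g - 1) (- N)" "w = Q a b x" by blast
      have Dx: "Q a b x \<in> filt N (g - 1 + 1) s0" using w(1) unfolding x(2) by simp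
      have "exc a N (Q a b x) = 0" by (rule exc_image[OF ab s0 s0N x(1) Dx s0N])
      then have "pt e e = 0" using w(3) x(2) by (metis zero_fun_apply)
      then show False by simp
    qed
    have sub: "vs.subspace ?Z"
      unfolding vs.subspace_def using filt_subspace[of N g "- N"]
      by (auto simp: vs.subspace_def Q_smul Q_add[OF filt_VL filt_VL])
    have "vs.span (insert w ?B) = ?Z"
    proof
      show "vs.span (insert w ?B) \<subseteq> ?Z" by (rule vs.span_minimal[OF _ sub]) (use wZ BZ in auto)
      show "?Z \<subseteq> vs.span (insert w ?B)"
      proof
        fix z assume "z \<in> ?Z"
        then obtain y where y: "y \<in> filt N (g - 1) (- N)" "z - Q a b y \<in> filt N g s0" "Q a b (z - Q a b y) = 0"
          using red by blast
        \<comment> \<open>At given ghost number there is only one exceptional monomial, so the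
          exceptional component is a multiple of \<open>pt e\<close>; subtracting that multiple of w
          leaves an exact cocycle.\<close>
        define c where "c = exc a N (z - Q a b y) e"
        have "exc a N (z - Q a b y) \<mu> = smul c (pt e) \<mu>" for \<mu>
        proof (cases "\<mu> = e")
          case True then show ?thesis by (simp add: c_def smul_def)
        next
          case False
          have "exc a N (z - Q a b y) \<mu> = 0"
          proof (rule ccontr)
            assume "exc a N (z - Q a b y) \<mu> \<noteq> 0"
            then have m: "exc_mono a N \<mu>" "ghost \<mu> = g"
              using y(2) by (auto simp: exc_def filt_def VL_def exc_mono_def split: if_splits)
            then show False using exc_mono_unique(2)[OF m(1) e(1) N] e(2) False by simp
          qed
          then show ?thesis using False by (simp add: smul_def)
        qed
        then have ec: "exc a N (z - Q a b y) = smul c (pt e)" by (rule ext)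
        let ?z = "z - Q a b y - smul c w"
        have "?z \<in> filt N g s0" by (intro filt_diff filt_smul y(2) w(1))
        moreover have "Q a b ?z = 0"
          by (simp only: Q_diff[OF ab s0 s0N filt_VL[OF y(2)] VL_smul[OF filt_VL[OF w(1)]]] y(3) Q_smul w(2)) simp
        moreover have "exc a N ?z = 0"
          unfolding exc_diff[of a N "z - Q a b y"] ec exc_smul w(3) by simp
        ultimately obtain y' where y': "y' \<in> filt N (g - 1) (- N)" "Q a b y' = ?z"
          using exact_at_s0[OF ab s0 s0N, of ?z g] by blast
        have "Q a b (y' + y) + smul c w = z"
          by (simp only: Q_add[OF filt_VL[OF y'(1)] filt_VL[OF y(1)]] y'(2)) simp
        moreover have "Q a b (y' + y) + smul c w \<in> vs.span (insert w ?B)"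
          using filt_add[OF y'(1) y(1)] by (intro vs.span_add vs.span_scale vs.span_base) auto
        ultimately show "z \<in> vs.span (insert w ?B)" by simp
      qed
    qed
    moreover have "vs.dim (vs.span (insert w ?B)) = vs.dim ?B + 1"
    proof (rule dim_insert_subspace[OF image_subspace _ _ wB])
      show "?B \<subseteq> vs.span (pt ` level_monos N)"
        using BZ VL_span[of N] filt_VL by blast
      show "finite (pt ` level_monos N)"
        using finite_level by (rule finite_imageI)
    qed
    ultimately show ?thesis using True by simp
  qed
qed

section \<open>From the kernel of L_0 to the levels, and the degenerate cases\<close>

lemma kerL0_eq:
  assumes "pP p q * pM p q = - of_int N"
  shows "kerL0 p q = VL N"
proof -
  have c: "pP p q * pM p q + of_nat n = 0 \<longleftrightarrow> int n = N" for n
  proof -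
    have "of_nat n = (of_int (int n) :: complex)" by simp
    then have "pP p q * pM p q + of_nat n = of_int (int n - N)" using assms by simp
    then show ?thesis by (simp only: of_int_eq_0_iff right_minus_eq)
  qed
  have "finite {\<mu>. v \<mu> \<noteq> 0}" if "v \<in> VL N" for v
    using that by (intro finite_subset[OF _ finite_level[of N]]) (auto simp: VL_def)
  then show ?thesis
    by (auto simp: kerL0_def Fock_def L0_def fun_eq_iff c VL_def)
qed

lemma ghost_part_eq:
  assumes "pP p q * pM p q = - of_int N"
  shows "ghost_part p q g = filt N g (- N)"
proof -
  have "- N \<le> deg \<mu>" if "v \<in> VL N" "v \<mu> \<noteq> 0" for v \<mu>
  proof -
    have "valid_mono \<mu>" "int (level \<mu>) = N" using that by (auto simp: VL_def)
    then show ?thesis using abs_deg_le_level[of \<mu>] by simp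
  qed
  then show ?thesis by (auto simp: ghost_part_def kerL0_eq[OF assms] filt_def)
qed

lemma coh_dim_eq:
  assumes ab: "pP p q * pM p q = - of_int N"
  shows "coh_dim p q g = vs.dim {v \<in> filt N g (- N). Q (pP p q) (pM p q) v = 0} 
    - vs.dim (Q (pP p q) (pM p q) ` filt N (g - 1) (- N))"
proof -
  have d: "dhat p q v = Q (pP p q) (pM p q) v" if "v \<in> filt N g f" for v g f
    by (rule dhat_eq_Q[OF filt_VL[OF that]])
  have "{v \<in> filt N g (- N). dhat p q v = (\<lambda>_. 0)} = {v \<in> filt N g (- N). Q (pP p q) (pM p q) v = 0}"
    using d by (auto simp: zero_fun_def)
  moreover have "dhat p q ` filt N (g - 1) (- N) = Q (pP p q) (pM p q) ` filt N (g - 1) (- N)"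
    using d by (intro image_cong) auto
  ultimately show ?thesis by (simp only: coh_dim_def ghost_part_eq[OF ab] cdim_def)
qed

text \<open>No level satisfies a b + level = 0, so the kernel of L_0 is zero.\<close>

lemma coh_dim_trivial:
  assumes ab: "pP p q * pM p q \<noteq> 0" and N: "\<And>N. N > 0 \<Longrightarrow> pP p q * pM p q \<noteq> - of_int N"
  shows "coh_dim p q g = 0"
proof -
  have "pP p q * pM p q + of_nat n \<noteq> 0" for n
  proof
    assume "pP p q * pM p q + of_nat n = 0"
    then have "pP p q * pM p q = - of_int (int n)" by (simp add: add_eq_0_iff2)
    then show False using N[of "int n"] ab by (cases "n = 0") auto
  qed
  then have "kerL0 p q \<subseteq> {0}" by (auto simp: kerL0_def L0_def fun_eq_iff)
  then have "{v \<in> ghost_part p q g. dhat p q v = (\<lambda>_. 0)} \<subseteq> vs.span {}" 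
    by (auto simp: ghost_part_def)
  then have "vs.dim {v \<in> ghost_part p q g. dhat p q v = (\<lambda>_. 0)} \<le> card ({} :: state set)"
    by (rule vs.dim_le_card) simp
  then show ?thesis by (simp add: coh_dim_def cdim_def)
qed

text \<open>The kernel of L_0 is the line of the vacuum, on which d vanishes by
  \<open>Q_VL0\<close>.\<close>

lemma coh_dim_level0:
  assumes ab: "pP p q * pM p q = 0"
  shows "coh_dim p q g = (if g = 0 then 1 else 0)"
proof -
  have VL0: "VL 0 = vs.span {vac}"
  proof
    have "level_monos 0 \<subseteq> {vac_mono}" using level_zero by auto
    then have "vs.span (pt ` level_monos 0) \<subseteq> vs.span {vac}"
      by (intro vs.span_mono) auto
    then show "VL 0 \<subseteq> vs.span {vac}" using VL_span[of 0] by blast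
    have "vs.subspace (VL 0)" by (simp add: vs.subspace_def VL_add VL_smul)
    then show "vs.span {vac} \<subseteq> VL 0" using vac_VL by (intro vs.span_minimal) auto
  qed
  have g0: "v \<mu> \<noteq> 0 \<Longrightarrow> v \<in> VL 0 \<Longrightarrow> \<mu> = vac_mono" for v \<mu>
    by (intro level_zero) (auto simp: VL_def)
  have vd: "ghost vac_mono = 0 \<and> deg vac_mono = 0" by (simp add: deg_def wt_def vac_mono_def ghost_def)
  have F: "filt 0 g' 0 = (if g' = 0 then VL 0 else {0})" for g'
  proof (cases "g' = 0")
    case True
    have "ghost \<mu> = 0 \<and> 0 \<le> deg \<mu>" if "v \<in> VL 0" "v \<mu> \<noteq> 0" for v \<mu>
      unfolding g0[OF that(2,1)] using vd by simp
    then show ?thesis using True by (auto simp: filt_def)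
  next
    case False
    have "v = 0" if v: "v \<in> filt 0 g' 0" for v
    proof (rule ccontr)
      assume "v \<noteq> 0"
      then obtain \<mu> where m: "v \<mu> \<noteq> 0" by (auto simp: fun_eq_iff)
      then have "ghost vac_mono = g'" using v g0[OF m filt_VL[OF v]] by (auto simp: filt_def)
      then show False using False vd by simp
    qed
    then show ?thesis using False filt_zero by auto
  qed
  have Q0: "Q a b ` filt 0 (g - 1) 0 \<subseteq> {0}" for a b
    using Q_VL0 filt_VL by blast
  have "vs.dim (Q (pP p q) (pM p q) ` filt 0 (g - 1) 0) \<le> card ({} :: state set)"
    using Q0 by (intro vs.dim_le_card) auto
  then have B: "vs.dim (Q (pP p q) (pM p q) ` filt 0 (g - 1) 0) = 0" by simp
  have Z: "{v \<in> filt 0 g 0. Q (pP p q) (pM p q) v = 0} = filt 0 g 0"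
    using Q_VL0 filt_VL by blast
  have nz: "vac \<noteq> 0" by (auto simp: fun_eq_iff)
  have "vs.dim (vs.span {vac}) = card {vac}"
    by (rule vs.dim_span_eq_card_independent) (simp add: nz)
  moreover have "vs.dim {0 :: state} \<le> card ({} :: state set)"
    by (rule vs.dim_le_card) auto
  ultimately have "vs.dim (filt 0 g 0) = (if g = 0 then 1 else 0)"
    unfolding F VL0 by simp
  then show ?thesis using coh_dim_eq[of p q 0 g] ab B Z by simp
qed

theorem theorem5:
  fixes p p\<^sub>\<phi> :: complex and g :: int
  shows "coh_dim p p\<^sub>\<phi> g =
    (if pP p p\<^sub>\<phi> * pM p p\<^sub>\<phi> = 0 \<and>
        ((\<forall>n::int. n \<noteq> 0 \<longrightarrow> PP p p\<^sub>\<phi> n \<noteq> 0) \<or> (\<forall>n::int. n \<noteq> 0 \<longrightarrow> PM p p\<^sub>\<phi> n \<noteq> 0))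
     then (if g = 0 then 1 else 0)
     else if (\<exists>r s :: int. r < 0 \<and> s < 0 \<and> pP p p\<^sub>\<phi> = of_int r \<and> pM p p\<^sub>\<phi> = - of_int s)
     then (if g = -1 \<or> g = 0 then 1 else 0)
     else if (\<exists>r s :: int. r > 0 \<and> s > 0 \<and> pP p p\<^sub>\<phi> = of_int r \<and> pM p p\<^sub>\<phi> = - of_int s)
     then (if g = 0 \<or> g = 1 then 1 else 0)
     else 0)"
proof -
  define a where "a = pP p p\<^sub>\<phi>"
  define b where "b = pM p p\<^sub>\<phi>"
  let ?neg = "\<exists>r s :: int. r < 0 \<and> s < 0 \<and> a = of_int r \<and> b = - of_int s"
  let ?pos = "\<exists>r s :: int. r > 0 \<and> s > 0 \<and> a = of_int r \<and> b = - of_int s"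
  consider "a * b = 0" | N where "N > 0" "a * b = - of_int N" | "a * b \<noteq> 0" "\<And>N. N > 0 \<Longrightarrow> a * b \<noteq> - of_int N"
    by blast
  then show ?thesis
  proof cases
    case 1
    \<comment> \<open>One of a and b is 0, so P+(n) = -n for all n or P-(n) = n for all n, and the
      corresponding alternative holds.\<close>
    then have "(\<forall>n::int. n \<noteq> 0 \<longrightarrow> PP p p\<^sub>\<phi> n \<noteq> 0) \<or> (\<forall>n::int. n \<noteq> 0 \<longrightarrow> PM p p\<^sub>\<phi> n \<noteq> 0)"
      by (auto simp: PP_def PM_def a_def b_def)
    then show ?thesis using 1 coh_dim_level0[of p p\<^sub>\<phi> g] by (simp add: a_def b_def)
  next
    case (2 N)
    have ab: "a * b \<noteq> 0" using 2 by simp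
    \<comment> \<open>Given a = r, the relation a b = -N makes b = -s equivalent to N = r s. So the
      existence of s is divisibility of N by r, and s has the sign of r because N is
      positive.\<close>
    have neg: "?neg \<longleftrightarrow> (\<exists>r. r < 0 \<and> a = of_int r \<and> r dvd N)"
      and pos: "?pos \<longleftrightarrow> (\<exists>r. r > 0 \<and> a = of_int r \<and> r dvd N)"
    proof -
      have rs: "r dvd N \<and> N = r * s" if "a = of_int r" "b = - of_int s" for r s
      proof -
        have "of_int N = (of_int (r * s) :: complex)" using 2(2) that by simp
        then have "N = r * s" by (simp only: of_int_eq_iff)
        then show ?thesis by simp
      qed
      have ex: "b = - of_int (N div r) \<and> N = r * (N div r)" if "a = of_int r" "r dvd N" "r \<noteq> 0" for r
      proof -
        have N: "N = r * (N div r)" using that(2) by simp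
        then have "of_int N = (of_int r * of_int (N div r) :: complex)" by (metis of_int_mult)
        then have "of_int r * b = of_int r * (- of_int (N div r))" using 2(2) that(1) by simp
        moreover have "(of_int r :: complex) \<noteq> 0" using that(3) by simp
        ultimately have "b = - of_int (N div r)" by (metis mult_left_cancel)
        then show ?thesis using N by simp
      qed
      show "?neg \<longleftrightarrow> (\<exists>r. r < 0 \<and> a = of_int r \<and> r dvd N)"
      proof
        assume "\<exists>r. r < 0 \<and> a = of_int r \<and> r dvd N"
        then obtain r where r: "r < 0" "a = of_int r" "r dvd N" by blast
        have "N = r * (N div r)" using r(3) by simp
        then have "N div r < 0"
          using mult_nonpos_nonneg[of r "N div r"] r(1) 2(1) by (cases "N div r < 0") auto
        then show ?neg using r ex[of r] by blast
      qed (use rs in blast)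
      show "?pos \<longleftrightarrow> (\<exists>r. r > 0 \<and> a = of_int r \<and> r dvd N)"
      proof
        assume "\<exists>r. r > 0 \<and> a = of_int r \<and> r dvd N"
        then obtain r where r: "r > 0" "a = of_int r" "r dvd N" by blast
        then have "N div r > 0" using 2(1) by (simp add: pos_imp_zdiv_pos_iff zdvd_imp_le)
        then show ?pos using r ex[of r] by (metis less_irrefl)
      qed (use rs in blast)
    qed
    have c: "coh_dim p p\<^sub>\<phi> g = (if \<exists>r. r \<noteq> 0 \<and> a = of_int r \<and> r dvd N \<and> (g = 0 \<or> g = sgn r) then 1 else 0)"
      using coh_dim_eq[of p p\<^sub>\<phi> N g] coh_level[OF 2(2,1), of g] 2(2) 
      unfolding ex_exc_mono[OF 2(1)] by (simp add: a_def b_def)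
    have u: "r' = r" if "a = of_int r" "a = of_int r'" for r r' using that by simp
    have "coh_dim p p\<^sub>\<phi> g = (if ?neg then (if g = -1 \<or> g = 0 then 1 else 0) else if ?pos then (if g = 0 \<or> g = 1 then 1 else 0) else 0)"
    proof (cases ?neg)
      case True
      then obtain r where r: "r < 0" "a = of_int r" "r dvd N" unfolding neg by blast
      have "(\<exists>r. r \<noteq> 0 \<and> a = of_int r \<and> r dvd N \<and> (g = 0 \<or> g = sgn r)) \<longleftrightarrow> g = -1 \<or> g = 0"
        using r u by (auto intro!: exI[of _ r])
      then show ?thesis using True c by simp
    next
      case nn: False
      show ?thesis
      proof (cases ?pos)
        case True
        then obtain r where r: "r > 0" "a = of_int r" "r dvd N" unfolding pos by blast
        have "(\<exists>r. r \<noteq> 0 \<and> a = of_int r \<and> r dvd N \<and> (g = 0 \<or> g = sgn r)) \<longleftrightarrow> g = 0 \<or> g = 1"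
          using r u by (auto intro!: exI[of _ r])
        then show ?thesis using True nn c by simp
      next
        case False
        then have "\<not> (\<exists>r. r \<noteq> 0 \<and> a = of_int r \<and> r dvd N \<and> (g = 0 \<or> g = sgn r))"
          using nn unfolding neg pos by (metis linorder_neqE_linordered_idom)
        then show ?thesis using False nn c by simp
      qed
    qed
    then show ?thesis
      unfolding a_def[symmetric] b_def[symmetric] by (simp only: ab simp_thms if_False)
  next
    case 3
    have "a * b = - of_int (r * s)" if "a = of_int r" "b = - of_int s" for r s using that by simp
    then have np: "\<not> ?neg" "\<not> ?pos" using 3(2) by (metis mult_neg_neg, metis mult_pos_pos)
    have "coh_dim p p\<^sub>\<phi> g = 0"
      using 3 by (intro coh_dim_trivial) (simp_all add: a_def b_def)
    then show ?thesis
      unfolding a_def[symmetric] b_def[symmetric] by (simp only: np 3(1) simp_thms if_False)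
  qed
qed

end
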